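(* There is a constant $C>0$ (independent of $V$, $k$ and $m$) such that the following holds for every $m\ge 0$ and every potential $V:\mathbb{R}^2\to\mathbb{C}^{2\times 2}$ as in the context. If $k\in\mathbb{C}\setminus\sigma(D_m)$ is an eigenvalue of the operator $D=D_m+V$, and $\mu\in\mathbb{C}$ satisfies $\mu^2=k^2-m^2$, then $$ C\left(\bigl|\ln|\mu|\bigr|\sup_{x\in\mathbb{R}^2}\int_{|x-y|<(2|\mu|)^{-1}}|V(y)|\,dy+\sup_{x\in\mathbb{R}^2}\int_{\mathbb{R}^2}\bigl(1+\bigl|\ln|x-y|\bigr|\bigr)|V(y)|\,dy\right) $$ $$ {}+C\int_{\mathbb{R}^2}|V(x)|\,dx\left(\sqrt{\left|\frac{k-m}{k+m}\right|}+\sqrt{\left|\frac{k+m}{k-m}\right|}+1\right)\ge 1 . $$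
   Context: For $m\ge 0$, $D_m$ is the operator in $L^2(\mathbb{R}^2;\mathbb{C}^2)$ with domain the Sobolev space $\mathcal{H}^2(\mathbb{R}^2;\mathbb{C}^2)$ given by $$ D_m=\begin{pmatrix} m & 4\partial_{\bar z}^2\\ 4\partial_z^2 & -m\end{pmatrix},\qquad \partial_{\bar z}=\tfrac12\Bigl(\tfrac{\partial}{\partial x_1}+\tfrac1i\tfrac{\partial}{\partial x_2}\Bigr),\qquad \partial_z=\tfrac12\Bigl(\tfrac{\partial}{\partial x_1}-\tfrac1i\tfrac{\partial}{\partial x_2}\Bigr). $$ One has $D_m^2=\Delta^2+m^2$ and $\sigma(D_m)=(-\infty,-m]\cup[m,\infty)$. The potential $V=(V_{i,j})_{i,j=1,2}$ is a measurable function with values in the complex $2\times2$ matrices, not necessarily self-adjoint, and $|V(x)|=\bigl(\sum_{i,j=1,2}|V_{i,j}(x)|^2\bigr)^{1/2}$. The operator $D=D_m+V$ acts in $L^2(\mathbb{R}^2;\mathbb{C}^2)$ with domain $\mathcal{H}^2(\mathbb{R}^2;\mathbb{C}^2)$ (so $V$ is such that $Vu\in L^2$ for all $u\in\mathcal{H}^2$). A number $k\in\mathbb{C}$ is an eigenvalue of $D$ if $Du=ku$ for some nonzero $u\in\mathcal{H}^2(\mathbb{R}^2;\mathbb{C}^2)$. The integrals of $|V|$ are allowed to be $+\infty$, in which case the inequality is trivial. *)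

theory Defs
  imports "HOL-Analysis.Analysis"
begin

text \<open>
  Elements of \<open>L\<^sup>2\<close> are represented by functions rather than by equivalence classes, so every
  equality between them is an equality almost everywhere.
\<close>

definition L2 :: "('a::euclidean_space \<Rightarrow> 'b::real_normed_vector) set" where
  "L2 = {f. f \<in> borel_measurable lebesgue \<and> integrable lebesgue (\<lambda>x. (norm (f x))\<^sup>2)}"

definition L2_norm :: "('a::euclidean_space \<Rightarrow> 'b::real_normed_vector) \<Rightarrow> real" where
  "L2_norm f = sqrt (LINT x|lebesgue. (norm (f x))\<^sup>2)"

definition ae_eq :: "('a::euclidean_space \<Rightarrow> 'b) \<Rightarrow> ('a \<Rightarrow> 'b) \<Rightarrow> bool"
  where "ae_eq f g \<longleftrightarrow> (AE x in lebesgue. f x = g x)"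


subsection \<open>Weak derivatives and Sobolev spaces\<close>

definition partial_deriv :: "'n \<Rightarrow> (real^'n \<Rightarrow> complex) \<Rightarrow> real^'n \<Rightarrow> complex" where
  "partial_deriv i f x = frechet_derivative f (at x) (axis i 1)"

text \<open>
  A multi-index of order \<open>n\<close> is given as a list of \<open>n\<close> coordinate directions.
\<close>

definition partial_derivs :: "'n list \<Rightarrow> (real^'n \<Rightarrow> complex) \<Rightarrow> real^'n \<Rightarrow> complex" where
  "partial_derivs is f = foldr partial_deriv is f"

text \<open>
  Differentiability of all iterated partial derivatives entails their continuity, so the
  following is \<open>C\<^sub>c\<^sup>\<infinity>\<close>.
\<close>

definition test_function :: "(real^'n \<Rightarrow> complex) \<Rightarrow> bool" where
  "test_function \<phi> \<longleftrightarrow>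
     (\<forall>is x. partial_derivs is \<phi> differentiable (at x)) \<and> compact (closure {x. \<phi> x \<noteq> 0})"

definition locally_integrable :: "('a::euclidean_space \<Rightarrow> complex) \<Rightarrow> bool" where
  "locally_integrable f \<longleftrightarrow> (\<forall>K. compact K \<longrightarrow> set_integrable lebesgue K f)"

definition has_weak_deriv ::
    "'n list \<Rightarrow> (real^'n \<Rightarrow> complex) \<Rightarrow> (real^'n \<Rightarrow> complex) \<Rightarrow> bool" where
  "has_weak_deriv is f g \<longleftrightarrow>
     locally_integrable f \<and> locally_integrable g \<and>
     (\<forall>\<phi>. test_function \<phi> \<longrightarrow>
        (LINT x|lebesgue. f x * partial_derivs is \<phi> x) =
        (-1) ^ length is * (LINT x|lebesgue. g x * \<phi> x))"

definition sobolev :: "nat \<Rightarrow> (real^'n \<Rightarrow> complex) set" where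
  "sobolev s = {f \<in> L2. \<forall>is. length is \<le> s \<longrightarrow> (\<exists>g \<in> L2. has_weak_deriv is f g)}"

definition sobolev_vec :: "nat \<Rightarrow> (real^'n \<Rightarrow> complex^'k) set" where
  "sobolev_vec s = {u. \<forall>j. (\<lambda>x. u x $ j) \<in> sobolev s}"

text \<open>
  Weak derivatives are unique up to null sets; \<open>weak_partial i f\<close> is some representative, and is
  only meaningful if \<open>f\<close> has a weak derivative in direction \<open>i\<close>.
\<close>

definition weak_partial :: "'n \<Rightarrow> (real^'n \<Rightarrow> complex) \<Rightarrow> real^'n \<Rightarrow> complex" where
  "weak_partial i f = (SOME g. has_weak_deriv [i] f g)"


subsection \<open>Unbounded operators in \<open>L\<^sup>2(\<real>\<^sup>2; \<complex>\<^sup>2)\<close>\<close>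

type_synonym spinor = "real^2 \<Rightarrow> complex^2"

text \<open>
  An operator is given by its domain \<open>X\<close> and its action \<open>A\<close>. The last conjunct says that the
  inverse of \<open>A - z\<close> is bounded.
\<close>

definition resolvent_set :: "spinor set \<Rightarrow> (spinor \<Rightarrow> spinor) \<Rightarrow> complex set" where
  "resolvent_set X A = {z.
     (\<forall>f \<in> L2. \<exists>u \<in> X. ae_eq (\<lambda>x. A u x - z *s u x) f) \<and>
     (\<forall>u \<in> X. \<forall>v \<in> X.
        ae_eq (\<lambda>x. A u x - z *s u x) (\<lambda>x. A v x - z *s v x) \<longrightarrow> ae_eq u v) \<and>
     (\<exists>c. \<forall>u \<in> X. L2_norm u \<le> c * L2_norm (\<lambda>x. A u x - z *s u x))}"

definition spectrum :: "spinor set \<Rightarrow> (spinor \<Rightarrow> spinor) \<Rightarrow> complex set" where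
  "spectrum X A = - resolvent_set X A"

definition eigenvalue :: "spinor set \<Rightarrow> (spinor \<Rightarrow> spinor) \<Rightarrow> complex \<Rightarrow> bool" where
  "eigenvalue X A z \<longleftrightarrow>
     (\<exists>u \<in> X. \<not> ae_eq u (\<lambda>x. 0) \<and> ae_eq (A u) (\<lambda>x. z *s u x))"


subsection \<open>The operator \<open>D\<^sub>m\<close> and its perturbations\<close>

abbreviation H2 :: "spinor set" where
  "H2 \<equiv> sobolev_vec 2"

definition d_zbar :: "(real^2 \<Rightarrow> complex) \<Rightarrow> real^2 \<Rightarrow> complex" where
  "d_zbar f x = 1/2 * (weak_partial 1 f x + 1/\<i> * weak_partial 2 f x)"

definition d_z :: "(real^2 \<Rightarrow> complex) \<Rightarrow> real^2 \<Rightarrow> complex" where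
  "d_z f x = 1/2 * (weak_partial 1 f x - 1/\<i> * weak_partial 2 f x)"

definition D_free :: "real \<Rightarrow> spinor \<Rightarrow> spinor" where
  "D_free m u x = vector
     [of_real m * u x $ 1 + 4 * d_zbar (d_zbar (\<lambda>y. u y $ 2)) x,
      4 * d_z (d_z (\<lambda>y. u y $ 1)) x - of_real m * u x $ 2]"

type_synonym potential = "real^2 \<Rightarrow> complex^2^2"

definition D_pert :: "real \<Rightarrow> potential \<Rightarrow> spinor \<Rightarrow> spinor" where
  "D_pert m V u x = D_free m u x + V x *v u x"

definition admissible_potential :: "potential \<Rightarrow> bool" where
  "admissible_potential V \<longleftrightarrow>
     V \<in> borel_measurable lebesgue \<and> (\<forall>u \<in> H2. (\<lambda>x. V x *v u x) \<in> L2)"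

text \<open>The library norm on matrices is \<open>|V(x)|\<close>:\<close>

lemma norm_matrix_eq:
  fixes A :: "complex^2^2"
  shows "norm A = sqrt (\<Sum>i\<in>UNIV. \<Sum>j\<in>UNIV. (cmod (A $ i $ j))\<^sup>2)"
  by (simp add: norm_vec_def L2_set_def sum_nonneg)

end

theory Submission
  imports Defs
begin

text \<open>
  The eigenvalue equation reads \<open>(D\<^sub>m - k) u = - V u\<close>. Let \<open>S\<close> be the bracket with the two square
  roots. The resolvent of \<open>D\<^sub>m\<close> at \<open>k\<close> has an integral kernel that is bounded by an absolute multiple
  of \<open>S\<close>. Hence \<open>|u| \<le> C S \<integral>|V||u|\<close> almost everywhere, and integration against \<open>|V|\<close> gives
  \<open>N \<le> C S (\<integral>|V|) N\<close> with \<open>N = \<integral>|V||u|\<close>. Since \<open>0 < N < \<infinity>\<close>, the last summand of the inequality alone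
  is at least one (\<open>eigenfunction_estimate\<close>).

  The kernel is bounded for the following reason. Put \<open>L\<^sub>d = \<partial>\<^sub>1\<^sup>2 + 2 i d \<partial>\<^sub>1\<partial>\<^sub>2 - \<partial>\<^sub>2\<^sup>2\<close>, so that \<open>L\<^sub>1\<close> is four times
  the square of \<open>\<partial>\<^sub>z\<close>, \<open>L\<^sub>-\<^sub>1\<close> is its conjugate and \<open>L\<^sub>1 L\<^sub>-\<^sub>1 = \<Delta>\<^sup>2\<close>. The resolvent is assembled from
  \<open>h = (\<Delta>\<^sup>2 - \<mu>\<^sup>2)\<^sup>-\<^sup>1 g\<close>, with coefficients of modulus \<open>|k \<plusminus> m|\<close>, and from \<open>L\<^sub>\<plusminus>\<^sub>1 h\<close>. Moreover
  \<open>(\<Delta>\<^sup>2 - \<mu>\<^sup>2)\<^sup>-\<^sup>1 = ((-\<Delta> - \<mu>)\<^sup>-\<^sup>1 - (-\<Delta> + \<mu>)\<^sup>-\<^sup>1) / (2\<mu>)\<close>, and the logarithmic singularities of the two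
  terms cancel. To see this uniformly in the argument of \<open>\<mu>\<close>, apply the Fourier transform in the first
  variable only: the transformed kernels are \<open>e\<^sup>-\<^sup>s\<^sup>|\<^sup>t\<^sup>| / (2s)\<close> with \<open>s\<^sup>2 = \<xi>\<^sup>2 \<minusplus> \<mu>\<close> and \<open>Re s \<ge> 0\<close>. Near
  \<open>\<xi>\<^sup>2 = |\<mu>|\<close> they have at worst an inverse square root singularity, which is integrable in \<open>\<xi>\<close>; for large
  \<open>\<xi>\<close> the difference of the two is of order \<open>|\<mu>| / |\<xi>|\<^sup>3\<close>. So the absolute value of the transformed
  kernel is integrable in \<open>\<xi>\<close>, with a bound of order \<open>1 / |\<mu>|\<close> for \<open>h\<close> and of order one for \<open>L\<^sub>\<plusminus>\<^sub>1 h\<close>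
  (\<open>kernel_bounds\<close>, \<open>resolvent_integral_bounds\<close>).

  The function \<open>u\<close> itself is never Fourier transformed. The weak form of the equation is tested with
  truncated plane waves \<open>e\<^sup>i\<^sup>\<xi>\<^sup>x\<^sub>1 b(x\<^sub>2)\<close>, where \<open>b\<close> solves an ordinary differential equation with right-hand
  side \<open>g(x\<^sub>2)\<close> (\<open>cutoff_estimate\<close>). Integration over \<open>\<xi>\<close> against the transform of the indicator of an
  interval, damped by \<open>e\<^sup>-\<^sup>\<epsilon>\<^sup>|\<^sup>\<xi>\<^sup>|\<close>, bounds averages of \<open>u\<close> (\<open>averaged_bound\<close>); the truncation errors disappear
  because \<open>u\<close> is square integrable (\<open>L2_mass_decay\<close>). Letting \<open>\<epsilon>\<close> tend to zero and shrinking the boxes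
  bounds \<open>u\<close> almost everywhere (\<open>box_integral_bound\<close>, \<open>pointwise_bound\<close>).

  Since \<open>k\<close> lies outside the spectrum, \<open>k\<close> differs from \<open>m\<close> and \<open>-m\<close>, hence \<open>\<mu> \<noteq> 0\<close>, because
  \<open>D\<^sub>m \<minusplus> m\<close> is not surjective (\<open>thresholds_in_spectrum\<close>).
\<close>

section \<open>Smooth functions of one real variable\<close>

text \<open>
  The recursion goes through the derivative rather than through an iterated derivative operator, so
  that each closure property is an induction on the order.
\<close>

fun times_differentiable :: "nat \<Rightarrow> (real \<Rightarrow> complex) \<Rightarrow> bool" where
  "times_differentiable 0 f = True"
| "times_differentiable (Suc n) f =
     (\<exists>f'. (\<forall>x. (f has_vector_derivative f' x) (at x)) \<and> times_differentiable n f')"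

definition smooth :: "(real \<Rightarrow> complex) \<Rightarrow> bool" where
  "smooth f \<longleftrightarrow> (\<forall>n. times_differentiable n f)"

lemma times_differentiable_SucI:
  "(\<And>x. (f has_vector_derivative f' x) (at x)) \<Longrightarrow> times_differentiable n f' \<Longrightarrow> times_differentiable (Suc n) f"
  by auto

lemma times_differentiable_Suc_imp: "times_differentiable (Suc n) f \<Longrightarrow> times_differentiable n f"
proof (induction n arbitrary: f)
  case (Suc n)
  then obtain f' where "\<forall>x. (f has_vector_derivative f' x) (at x)" "times_differentiable (Suc n) f'"
    by auto
  with Suc.IH show ?case by auto
qed simp

lemma times_differentiable_add:
  "times_differentiable n f \<Longrightarrow> times_differentiable n g \<Longrightarrow> times_differentiable n (\<lambda>x. f x + g x)"
proof (induction n arbitrary: f g)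
  case (Suc n)
  then obtain f' g' where "\<forall>x. (f has_vector_derivative f' x) (at x)" "times_differentiable n f'"
    "\<forall>x. (g has_vector_derivative g' x) (at x)" "times_differentiable n g'"
    by auto
  then show ?case
    by (auto intro!: exI[of _ "\<lambda>x. f' x + g' x"] Suc.IH derivative_eq_intros)
qed simp

lemma times_differentiable_cmult:
  "times_differentiable n f \<Longrightarrow> times_differentiable n (\<lambda>x. c * f x)"
proof (induction n arbitrary: f)
  case (Suc n)
  then obtain f' where "\<forall>x. (f has_vector_derivative f' x) (at x)" "times_differentiable n f'"
    by auto
  then show ?case
    by (auto intro!: exI[of _ "\<lambda>x. c * f' x"] Suc.IH derivative_eq_intros)
qed simp

lemma times_differentiable_mult:
  "times_differentiable n f \<Longrightarrow> times_differentiable n g \<Longrightarrow> times_differentiable n (\<lambda>x. f x * g x)"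
proof (induction n arbitrary: f g)
  case (Suc n)
  from Suc.prems have fg: "times_differentiable n f" "times_differentiable n g"
    by (auto intro: times_differentiable_Suc_imp simp del: times_differentiable.simps)
  from Suc.prems obtain f' g' where fg': "\<forall>x. (f has_vector_derivative f' x) (at x)" "times_differentiable n f'"
    "\<forall>x. (g has_vector_derivative g' x) (at x)" "times_differentiable n g'"
    by auto
  have "times_differentiable n (\<lambda>x. f x * g' x + f' x * g x)"
    using fg fg' by (intro times_differentiable_add Suc.IH) auto
  with fg' show ?case
    by (auto intro!: exI[of _ "\<lambda>x. f x * g' x + f' x * g x"] derivative_eq_intros)
qed simp

lemma times_differentiable_affine:
  "times_differentiable n f \<Longrightarrow> times_differentiable n (\<lambda>x. f (r * x + t))"
proof (induction n arbitrary: f)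
  case (Suc n)
  then obtain f' where f': "\<forall>x. (f has_vector_derivative f' x) (at x)" "times_differentiable n f'"
    by auto
  have "((\<lambda>x. f (r * x + t)) has_vector_derivative of_real r * f' (r * x + t)) (at x)" for x
  proof -
    have "(f \<circ> (\<lambda>x. r * x + t) has_vector_derivative r *\<^sub>R f' (r * x + t)) (at x)"
      by (rule vector_diff_chain_at) (use f'(1) in \<open>auto intro!: derivative_eq_intros\<close>)
    then show ?thesis by (simp add: o_def scaleR_conv_of_real)
  qed
  with f' Suc.IH show ?case
    by (auto intro!: exI[of _ "\<lambda>x. of_real r * f' (r * x + t)"] times_differentiable_cmult)
qed simp

lemma smooth_add: "smooth f \<Longrightarrow> smooth g \<Longrightarrow> smooth (\<lambda>x. f x + g x)"
  and smooth_cmult: "smooth f \<Longrightarrow> smooth (\<lambda>x. c * f x)"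
  and smooth_mult: "smooth f \<Longrightarrow> smooth g \<Longrightarrow> smooth (\<lambda>x. f x * g x)"
  and smooth_affine: "smooth f \<Longrightarrow> smooth (\<lambda>x. f (r * x + t))"
  by (auto simp: smooth_def intro: times_differentiable_add times_differentiable_cmult
      times_differentiable_mult times_differentiable_affine)

lemma smooth_diff: "smooth f \<Longrightarrow> smooth g \<Longrightarrow> smooth (\<lambda>x. f x - g x)"
  using smooth_add[of f "\<lambda>x. -1 * g x"] smooth_cmult[of g "-1"] by simp

lemma smoothI:
  assumes "\<And>x. (f has_vector_derivative f' x) (at x)" "smooth f'"
  shows "smooth f"
  unfolding smooth_def
proof
  fix n show "times_differentiable n f"
    using assms by (cases n) (auto simp: smooth_def)
qed

lemma smooth_derivative:
  assumes "smooth f" "\<And>x. (f has_vector_derivative f' x) (at x)"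
  shows "smooth f'"
  unfolding smooth_def
proof
  fix n
  from assms(1) obtain g where g: "\<forall>x. (f has_vector_derivative g x) (at x)" "times_differentiable n g"
    unfolding smooth_def by (metis times_differentiable.simps(2))
  have "g = f'"
    using g(1) assms(2) by (auto intro!: ext vector_derivative_unique_at)
  with g show "times_differentiable n f'" by simp
qed

lemma smooth_has_derivative:
  assumes "smooth f"
  obtains f' where "\<And>x. (f has_vector_derivative f' x) (at x)" "smooth f'"
proof -
  have "times_differentiable 1 f" using assms unfolding smooth_def by blast
  then obtain f' where f': "\<And>x. (f has_vector_derivative f' x) (at x)" by auto
  with that smooth_derivative[OF assms f'] show thesis by blast
qed

lemma smooth_continuous: "smooth f \<Longrightarrow> continuous_on UNIV f"
  by (meson continuous_at_imp_continuous_on has_vector_derivative_continuous smooth_has_derivative)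

lemma smooth_exp: "smooth (\<lambda>x. exp (c * of_real x))"
proof -
  have *: "((\<lambda>x. exp (c * of_real x)) has_vector_derivative c * exp (c * of_real x)) (at x)" for x :: real
    by (rule has_vector_derivative_real_field) (auto intro!: derivative_eq_intros)
  have "times_differentiable n (\<lambda>x. exp (c * of_real x))" for n
    by (induction n) (use * in \<open>auto intro!: exI[of _ "\<lambda>x. c * exp (c * of_real x)"] times_differentiable_cmult\<close>)
  then show ?thesis by (simp add: smooth_def)
qed

text \<open>
  The equation \<open>f'' = c f - g\<close> gains derivatives: if \<open>f\<close> and \<open>f'\<close> are \<open>n\<close> times differentiable, so is
  \<open>f''\<close>.
\<close>

lemma smooth_ode:
  assumes f: "\<And>x. (f has_vector_derivative f' x) (at x)"
    and f': "\<And>x. (f' has_vector_derivative c * f x - g x) (at x)" and g: "smooth g"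
  shows "smooth f"
proof -
  have "times_differentiable n f \<and> times_differentiable n f'" for n
  proof (induction n)
    case (Suc n)
    have "times_differentiable n (\<lambda>x. c * f x + (-1) * g x)"
      using Suc g by (intro times_differentiable_add times_differentiable_cmult) (auto simp: smooth_def)
    then have "times_differentiable (Suc n) f'"
      by (rule times_differentiable_SucI[rotated]) (use f' in auto)
    with Suc f show ?case by (auto simp del: times_differentiable.simps intro: times_differentiable_SucI)
  qed simp
  then show ?thesis by (simp add: smooth_def)
qed

text \<open>
  The parameter \<open>k\<close> makes the family closed under differentiation, up to linear combinations.
\<close>

definition flat_exp :: "nat \<Rightarrow> real \<Rightarrow> complex" where
  "flat_exp k x = (if x \<le> 0 then 0 else of_real (exp (- (1 / x)) / x ^ k))"

lemma power_le_fact_exp: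
  fixes y :: real
  assumes "y \<ge> 0"
  shows "y ^ n \<le> fact n * exp y"
proof -
  have "(\<lambda>n. inverse (fact n) * y ^ n) sums exp y" using exp_converges[of y] by simp
  then have "sum (\<lambda>n. inverse (fact n) * y ^ n) {n} \<le> exp y"
    by (subst sums_unique, assumption)
      (rule sum_le_suminf, use assms in \<open>auto simp: sums_iff\<close>)
  then show ?thesis by (simp add: field_simps del: fact_Suc)
qed

text \<open>
  With \<open>y = 1/x\<close> this is \<open>y\<^sup>k\<^sup>+\<^sup>2 \<le> (k + 2)! e\<^sup>y\<close>. A quadratic bound is what makes the derivative at the
  origin exist and vanish.
\<close>

lemma flat_exp_bound: "cmod (flat_exp k x) \<le> fact (k + 2) * x\<^sup>2"
proof (cases "x \<le> 0")
  case False
  define y where "y = 1 / x"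
  have y: "y > 0" using False by (simp add: y_def)
  have "y ^ (k + 2) \<le> fact (k + 2) * exp y" using y by (intro power_le_fact_exp) simp
  then have "exp (- y) * y ^ (k + 2) \<le> fact (k + 2)"
    by (simp add: exp_minus field_simps del: fact_Suc)
  then have "exp (- (1/x)) / x ^ (k + 2) \<le> fact (k + 2)"
    using False by (simp add: y_def power_one_over field_simps del: fact_Suc power_Suc)
  then have "exp (- (1/x)) / x ^ k / x\<^sup>2 \<le> fact (k + 2)"
    unfolding power_add by simp
  then have "exp (- (1/x)) / x ^ k \<le> fact (k + 2) * x\<^sup>2"
    using False by (simp add: pos_divide_le_eq mult_ac del: fact_Suc)
  then show ?thesis using False by (simp add: flat_exp_def norm_divide norm_power del: fact_Suc)
qed (simp add: flat_exp_def)

lemma flat_exp_derivative: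
  "(flat_exp k has_vector_derivative flat_exp (k + 2) x - of_nat k * flat_exp (k + 1) x) (at x)"
proof -
  consider "x < 0" | "x = 0" | "x > 0" by linarith
  then show ?thesis
  proof cases
    case 1
    have "((\<lambda>x. 0) has_vector_derivative (0::complex)) (at x)" by simp
    then have "(flat_exp k has_vector_derivative 0) (at x)"
      by (rule has_vector_derivative_transform_within_open[of _ _ _ "{..<0}"]) (use 1 in \<open>auto simp: flat_exp_def\<close>)
    then show ?thesis using 1 by (simp add: flat_exp_def)
  next
    case 2
    define C where "C = (fact (k + 2) :: real)"
    have "C > 0" by (simp add: C_def)
    have "(flat_exp k has_derivative (\<lambda>h. 0)) (at 0)"
      unfolding has_derivative_at_alt
    proof (intro conjI allI impI)
      fix e :: real assume "e > 0"
      show "\<exists>d>0. \<forall>y. norm (y - 0) < d \<longrightarrow>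
         norm (flat_exp k y - flat_exp k 0 - 0) \<le> e * norm (y - 0)"
      proof (intro exI[of _ "e / C"] conjI allI impI)
        fix y :: real assume "norm (y - 0) < e / C"
        then have "C * \<bar>y\<bar> \<le> e" using \<open>C > 0\<close> by (simp add: field_simps)
        then have "C * \<bar>y\<bar> * \<bar>y\<bar> \<le> e * \<bar>y\<bar>" by (rule mult_right_mono) simp
        then show "norm (flat_exp k y - flat_exp k 0 - 0) \<le> e * norm (y - 0)"
          using flat_exp_bound[of k y] by (simp add: flat_exp_def[of _ 0] C_def power2_eq_square)
      qed (use \<open>C > 0\<close> \<open>e > 0\<close> in auto)
    qed (rule bounded_linear_zero)
    then show ?thesis using 2 by (simp add: flat_exp_def has_vector_derivative_def)
  next
    case 3
    have "((\<lambda>x. exp (- (1 / x)) / x ^ k) has_field_derivative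
        exp (- (1 / x)) / x ^ (k + 2) - k * (exp (- (1 / x)) / x ^ (k + 1))) (at x)"
      using 3
      by (auto intro!: derivative_eq_intros simp: field_simps power2_eq_square)
        (cases k; simp add: field_simps)+
    then have "((\<lambda>x. complex_of_real (exp (- (1 / x)) / x ^ k)) has_vector_derivative
        of_real (exp (- (1 / x)) / x ^ (k + 2) - k * (exp (- (1 / x)) / x ^ (k + 1)))) (at x)"
      by (rule has_vector_derivative_of_real)
    then have "((\<lambda>x. complex_of_real (exp (- (1 / x)) / x ^ k)) has_vector_derivative
        flat_exp (k + 2) x - of_nat k * flat_exp (k + 1) x) (at x)"
      using 3 by (simp add: flat_exp_def)
    then show ?thesis using 3
      by (rule_tac has_vector_derivative_transform_within_open[of _ _ _ "{0<..}"]) (auto simp: flat_exp_def)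
  qed
qed

lemma smooth_flat_exp: "smooth (flat_exp k)"
proof -
  have "times_differentiable n (flat_exp k)" for n
  proof (induction n arbitrary: k)
    case (Suc n)
    have "times_differentiable n (\<lambda>x. flat_exp (k + 2) x + (- of_nat k) * flat_exp (k + 1) x)"
      by (intro times_differentiable_add times_differentiable_cmult Suc.IH)
    then show ?case
      by (rule times_differentiable_SucI[rotated]) (use flat_exp_derivative[of k] in simp)
  qed simp
  then show ?thesis by (simp add: smooth_def)
qed

lemma bump_exists:
  obtains \<beta> :: "real \<Rightarrow> real" where "smooth (\<lambda>x. of_real (\<beta> x))" "\<And>x. \<beta> x \<ge> 0" "\<beta> 0 = 1"
    "\<And>x. \<bar>x\<bar> \<ge> 1 \<Longrightarrow> \<beta> x = 0"
proof -
  \<comment> \<open>The factor \<open>exp 2\<close> compensates the value \<open>exp (-1) * exp (-1)\<close> of the product at the origin.\<close>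
  define \<beta> where "\<beta> x = exp 2 * (Re (flat_exp 0 (1 * x + 1)) * Re (flat_exp 0 (-1 * x + 1)))" for x :: real
  have real: "flat_exp 0 x = of_real (Re (flat_exp 0 x))" for x by (simp add: flat_exp_def)
  have eq: "complex_of_real (\<beta> x) = exp 2 * (flat_exp 0 (1 * x + 1) * flat_exp 0 (-1 * x + 1))" for x
    unfolding \<beta>_def of_real_mult real[symmetric] by (simp add: exp_of_real[symmetric])
  show thesis
  proof
    show "smooth (\<lambda>x. of_real (\<beta> x))"
      unfolding eq by (intro smooth_cmult smooth_mult smooth_affine smooth_flat_exp)
    show "\<beta> x \<ge> 0" for x by (auto simp: \<beta>_def flat_exp_def)
    show "\<beta> 0 = 1" by (simp add: \<beta>_def flat_exp_def exp_add[symmetric] mult_exp_exp)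
    show "\<beta> x = 0" if "\<bar>x\<bar> \<ge> 1" for x using that by (auto simp: \<beta>_def flat_exp_def)
  qed
qed

text \<open>
  The step is a normalized antiderivative of a bump.
\<close>

lemma smooth_step_exists:
  obtains \<theta> :: "real \<Rightarrow> real" where "smooth (\<lambda>x. of_real (\<theta> x))" "mono \<theta>"
    "\<And>x. x \<le> -1 \<Longrightarrow> \<theta> x = 0" "\<And>x. x \<ge> 1 \<Longrightarrow> \<theta> x = 1"
proof -
  obtain \<beta> :: "real \<Rightarrow> real" where \<beta>: "smooth (\<lambda>x. of_real (\<beta> x))" "\<And>x. \<beta> x \<ge> 0" "\<beta> 0 = 1"
    "\<And>x. \<bar>x\<bar> \<ge> 1 \<Longrightarrow> \<beta> x = 0" using bump_exists by blast
  have cont: "continuous_on UNIV \<beta>"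
    using continuous_on_Re[OF smooth_continuous[OF \<beta>(1)]] by simp
  then have "\<exists>F. \<forall>x. -\<infinity> < ereal x \<longrightarrow> ereal x < \<infinity> \<longrightarrow> (F has_vector_derivative \<beta> x) (at x)"
    by (intro einterval_antiderivative) (auto simp: continuous_on_eq_continuous_at)
  then obtain F where F: "\<And>x. (F has_real_derivative \<beta> x) (at x)"
    by (auto simp: has_real_derivative_iff_has_vector_derivative)
  have mono: "F x \<le> F y" if "x \<le> y" for x y
    using that F \<beta>(2) by (meson DERIV_nonneg_imp_nondecreasing)
  have const: "F x = F y" if "x \<le> y" "\<And>z. x \<le> z \<Longrightarrow> z \<le> y \<Longrightarrow> \<beta> z = 0" for x y
  proof (cases "x = y")
    case False
    show ?thesis
    proof (rule DERIV_isconst_end[of x y F, symmetric])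
      show "x < y" using that False by simp
      show "continuous_on {x..y} F" using F by (meson DERIV_isCont continuous_at_imp_continuous_on)
      show "(F has_real_derivative 0) (at z)" if "x < z" "z < y" for z
        using F[of z] \<open>\<And>z. x \<le> z \<Longrightarrow> z \<le> y \<Longrightarrow> \<beta> z = 0\<close>[of z] that by simp
    qed
  qed simp
  have lo: "F x = F (-1)" if "x \<le> -1" for x using const[OF that] \<beta>(4) by simp
  have hi: "F x = F 1" if "x \<ge> 1" for x using const[OF that] \<beta>(4) by simp
  \<comment> \<open>Otherwise the monotone \<open>F\<close> would be constant between, against \<open>\<beta> 0 = 1\<close>.\<close>
  have "F (-1) \<noteq> F 1"
  proof
    assume eq: "F (-1) = F 1"
    have "(F has_real_derivative 0) (at 0)"
    proof (rule has_field_derivative_transform_within_open[of "\<lambda>x. F 1" _ _ "{-1<..<1}"])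
      fix x :: real assume "x \<in> {-1<..<1}"
      then show "F 1 = F x" using mono[of "-1" x] mono[of x 1] eq by auto
    qed auto
    with F[of 0] \<beta>(3) show False using DERIV_unique by fastforce
  qed
  with mono[of "-1" 1] have c: "F 1 - F (-1) > 0" by simp
  define \<theta> where "\<theta> x = (F x - F (-1)) / (F 1 - F (-1))" for x
  show thesis
  proof
    have "((\<lambda>x. complex_of_real (\<theta> x)) has_vector_derivative complex_of_real (1 / (F 1 - F (-1))) * of_real (\<beta> x)) (at x)" for x
    proof -
      have "(\<theta> has_real_derivative \<beta> x / (F 1 - F (-1))) (at x)"
        unfolding \<theta>_def using c F by (auto intro!: derivative_eq_intros)
      then have "((\<lambda>x. complex_of_real (\<theta> x)) has_vector_derivative of_real (\<beta> x / (F 1 - F (-1)))) (at x)"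
        by (rule has_vector_derivative_of_real)
      then show ?thesis by simp
    qed
    then show "smooth (\<lambda>x. of_real (\<theta> x))"
      by (rule smoothI) (intro smooth_cmult \<beta>)
    show "mono \<theta>" using mono c by (auto intro!: monoI divide_right_mono simp: \<theta>_def)
    show "\<theta> x = 0" if "x \<le> -1" for x using lo[OF that] by (simp add: \<theta>_def)
    show "\<theta> x = 1" if "x \<ge> 1" for x using hi[OF that] c by (simp add: \<theta>_def)
  qed
qed

text \<open>
  The product of a rising and a falling step.
\<close>

lemma cutoff_exists:
  obtains \<zeta> :: "real \<Rightarrow> real" where "smooth (\<lambda>x. of_real (\<zeta> x))" "\<And>x. 0 \<le> \<zeta> x" "\<And>x. \<zeta> x \<le> 1"
    "\<And>x. \<bar>x\<bar> \<le> 1 \<Longrightarrow> \<zeta> x = 1" "\<And>x. \<bar>x\<bar> \<ge> 3 \<Longrightarrow> \<zeta> x = 0"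
proof -
  obtain \<theta> :: "real \<Rightarrow> real" where \<theta>: "smooth (\<lambda>x. of_real (\<theta> x))" "mono \<theta>"
    "\<And>x. x \<le> -1 \<Longrightarrow> \<theta> x = 0" "\<And>x. x \<ge> 1 \<Longrightarrow> \<theta> x = 1" using smooth_step_exists by blast
  have 01: "0 \<le> \<theta> x \<and> \<theta> x \<le> 1" for x
  proof -
    have "\<theta> (min x (-1)) \<le> \<theta> x" "\<theta> x \<le> \<theta> (max x 1)" using \<theta>(2) by (auto intro: monoD)
    then show ?thesis using \<theta>(3)[of "min x (-1)"] \<theta>(4)[of "max x 1"] by simp
  qed
  show thesis
  proof
    show "smooth (\<lambda>x. of_real (\<theta> (1 * x + 2) * \<theta> (-1 * x + 2)))"
      unfolding of_real_mult using \<theta>(1) smooth_affine by (intro smooth_mult) blast+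
  qed (use 01 \<theta>(3,4) in \<open>auto simp: mult_le_one abs_if split: if_splits\<close>)
qed

lemma derivative_zero_outside:
  fixes f :: "real \<Rightarrow> complex"
  assumes "\<And>x. (f has_vector_derivative f' x) (at x)" "\<And>x. \<bar>x\<bar> > r \<Longrightarrow> f x = 0" "\<bar>x\<bar> > r"
  shows "f' x = 0"
proof -
  have "open {x::real. \<bar>x\<bar> > r}" by (intro open_Collect_less continuous_intros)
  have "(f has_vector_derivative 0) (at x)"
  proof (rule has_vector_derivative_transform_within_open)
    show "((\<lambda>x. 0) has_vector_derivative 0) (at x)" by (rule has_vector_derivative_const)
    show "0 = f y" if "y \<in> {x. \<bar>x\<bar> > r}" for y using that assms(2) by simp
  qed (use \<open>open _\<close> assms(3) in auto)
  then show ?thesis using assms(1) vector_derivative_unique_at by blast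
qed

lemma bounded_compact_support:
  fixes f :: "real \<Rightarrow> complex"
  assumes "continuous_on UNIV f" "\<And>x. \<bar>x\<bar> > r \<Longrightarrow> f x = 0"
  obtains M where "\<And>x. cmod (f x) \<le> M"
proof -
  have "bounded (f ` {-r..r})"
    using assms(1) by (meson compact_Icc compact_continuous_image compact_imp_bounded continuous_on_subset top_greatest)
  then obtain M where M: "\<And>x. x \<in> {-r..r} \<Longrightarrow> cmod (f x) \<le> M"
    unfolding bounded_iff by blast
  show thesis
  proof
    show "cmod (f x) \<le> max M 0" for x
      using M[of x] assms(2)[of x] by (cases "\<bar>x\<bar> > r") (auto simp: le_max_iff_disj abs_le_iff not_less)
  qed
qed

lemma cutoff_with_derivatives:
  obtains \<zeta> \<zeta>1 \<zeta>2 :: "real \<Rightarrow> complex" and M :: real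
  where "smooth \<zeta>" "\<And>x. (\<zeta> has_vector_derivative \<zeta>1 x) (at x)" "\<And>x. (\<zeta>1 has_vector_derivative \<zeta>2 x) (at x)"
    "\<And>x. cmod (\<zeta> x) \<le> 1" "\<And>x. cmod (\<zeta>1 x) \<le> M" "\<And>x. cmod (\<zeta>2 x) \<le> M" "M \<ge> 1"
    "\<And>x. \<bar>x\<bar> > 3 \<Longrightarrow> \<zeta> x = 0" "\<And>x. \<bar>x\<bar> \<le> 1 \<Longrightarrow> \<zeta> x = 1"
proof -
  obtain \<omega> :: "real \<Rightarrow> real" where \<omega>: "smooth (\<lambda>x. of_real (\<omega> x))" "\<And>x. 0 \<le> \<omega> x" "\<And>x. \<omega> x \<le> 1"
    "\<And>x. \<bar>x\<bar> \<le> 1 \<Longrightarrow> \<omega> x = 1" "\<And>x. \<bar>x\<bar> \<ge> 3 \<Longrightarrow> \<omega> x = 0"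
    using cutoff_exists by blast
  define \<zeta> where "\<zeta> = (\<lambda>x. complex_of_real (\<omega> x))"
  have \<zeta>: "smooth \<zeta>" "\<And>x. \<bar>x\<bar> > 3 \<Longrightarrow> \<zeta> x = 0" "\<And>x. cmod (\<zeta> x) \<le> 1" "\<And>x. \<bar>x\<bar> \<le> 1 \<Longrightarrow> \<zeta> x = 1"
    using \<omega> by (simp_all add: \<zeta>_def)
  obtain \<zeta>1 where \<zeta>1: "\<And>x. (\<zeta> has_vector_derivative \<zeta>1 x) (at x)" "smooth \<zeta>1"
    using smooth_has_derivative[OF \<zeta>(1)] by blast
  obtain \<zeta>2 where \<zeta>2: "\<And>x. (\<zeta>1 has_vector_derivative \<zeta>2 x) (at x)" "smooth \<zeta>2"
    using smooth_has_derivative[OF \<zeta>1(2)] by blast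
  have 1: "\<zeta>1 x = 0" if "\<bar>x\<bar> > 3" for x using derivative_zero_outside[OF \<zeta>1(1) \<zeta>(2) that] by simp
  have 2: "\<zeta>2 x = 0" if "\<bar>x\<bar> > 3" for x using derivative_zero_outside[OF \<zeta>2(1) 1 that] by simp
  obtain M1 where M1: "\<And>x. cmod (\<zeta>1 x) \<le> M1"
    using bounded_compact_support[OF smooth_continuous[OF \<zeta>1(2)] 1] by blast
  obtain M2 where M2: "\<And>x. cmod (\<zeta>2 x) \<le> M2"
    using bounded_compact_support[OF smooth_continuous[OF \<zeta>2(2)] 2] by blast
  show thesis
  proof
    show "cmod (\<zeta>1 x) \<le> max 1 (max M1 M2)" "cmod (\<zeta>2 x) \<le> max 1 (max M1 M2)" for x
      using M1[of x] M2[of x] by auto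
  qed (fact \<zeta> \<zeta>1 \<zeta>2 | simp)+
qed

section \<open>Test functions and second-order weak derivatives\<close>

lemma test_function_continuous: "test_function \<phi> \<Longrightarrow> continuous_on UNIV \<phi>"
  unfolding test_function_def
  by (metis continuous_at_imp_continuous_on differentiable_imp_continuous_within foldr.simps(1) id_apply partial_derivs_def)

text \<open>
  The derivative vanishes on the complement of the closed support, since that set is open and the
  function vanishes there.
\<close>

lemma test_function_partial_deriv:
  assumes "test_function \<phi>"
  shows "test_function (partial_deriv i \<phi>)"
proof -
  let ?S = "{x. \<phi> x \<noteq> 0}"
  have "{x. partial_deriv i \<phi> x \<noteq> 0} \<subseteq> closure ?S"
  proof safe
    fix x assume nz: "partial_deriv i \<phi> x \<noteq> 0"
    show "x \<in> closure ?S"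
    proof (rule ccontr)
      assume x: "x \<notin> closure ?S"
      have "(\<phi> has_derivative (\<lambda>h. 0)) (at x)"
      proof (rule has_derivative_transform_within_open[of "\<lambda>x. 0" _ _ _ "- closure ?S"])
        show "0 = \<phi> y" if "y \<in> - closure ?S" for y
          using that closure_subset[of ?S] by auto
      qed (use x in auto)
      then have "frechet_derivative \<phi> (at x) = (\<lambda>h. 0)" by (metis frechet_derivative_at)
      with nz show False by (simp add: partial_deriv_def)
    qed
  qed
  then have "closure {x. partial_deriv i \<phi> x \<noteq> 0} \<subseteq> closure ?S"
    by (simp add: closure_minimal)
  moreover have "partial_derivs is (partial_deriv i \<phi>) = partial_derivs (is @ [i]) \<phi>" for "is"
    by (simp add: partial_derivs_def)
  ultimately show ?thesis
    using assms unfolding test_function_def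
    by (metis closed_closure compact_Int_closed inf.absorb_iff2)
qed

lemma locally_integrable_mult_test_function:
  assumes "locally_integrable g" "test_function \<phi>"
  shows "integrable lebesgue (\<lambda>x. g x * \<phi> x)"
proof -
  let ?K = "closure {x. \<phi> x \<noteq> 0}"
  have K: "compact ?K" using assms by (simp add: test_function_def)
  have cont: "continuous_on UNIV \<phi>" by (rule test_function_continuous) fact
  then have "bounded (\<phi> ` ?K)"
    using K by (meson compact_continuous_image compact_imp_bounded continuous_on_subset top_greatest)
  then obtain M where M: "\<And>x. x \<in> ?K \<Longrightarrow> norm (\<phi> x) \<le> M" by (auto simp: bounded_iff)
  have g: "integrable lebesgue (\<lambda>x. indicator ?K x *\<^sub>R g x)"
    using assms(1) K by (auto simp: locally_integrable_def set_integrable_def)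
  have eq: "(\<lambda>x. g x * \<phi> x) = (\<lambda>x. (indicator ?K x *\<^sub>R g x) * \<phi> x)"
    using closure_subset[of "{x. \<phi> x \<noteq> 0}"] by (intro ext) (auto simp: indicator_def)
  show ?thesis unfolding eq
  proof (rule Bochner_Integration.integrable_bound)
    show "integrable lebesgue (\<lambda>x. M * norm (indicator ?K x *\<^sub>R g x))"
      by (intro integrable_mult_right integrable_norm g)
    have "\<phi> \<in> borel_measurable lebesgue"
      using borel_measurable_continuous_onI[OF cont] by (intro measurable_completion) simp
    then show "(\<lambda>x. indicator ?K x *\<^sub>R g x * \<phi> x) \<in> borel_measurable lebesgue"
      by (rule borel_measurable_times[OF borel_measurable_integrable[OF g]])
    show "AE x in lebesgue. norm (indicator ?K x *\<^sub>R g x * \<phi> x) \<le> norm (M * norm (indicator ?K x *\<^sub>R g x))"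
    proof (rule AE_I2)
      fix x
      show "norm (indicator ?K x *\<^sub>R g x * \<phi> x) \<le> norm (M * norm (indicator ?K x *\<^sub>R g x))"
      proof (cases "x \<in> ?K")
        case True
        with M[OF True] norm_ge_zero[of "\<phi> x"] have "norm (\<phi> x) \<le> \<bar>M\<bar>" by linarith
        then show ?thesis using True
          by (simp add: norm_mult abs_mult mult.commute[of _ "cmod (g x)"] mult_left_mono)
      qed auto
    qed
  qed
qed

lemma locally_integrable_lincomb:
  assumes "locally_integrable f" "locally_integrable g"
  shows "locally_integrable (\<lambda>x. d * (f x + c * g x))"
  using assms by (auto simp: locally_integrable_def)

lemma weak_partialI:
  assumes "has_weak_deriv [i] f g"
  shows "has_weak_deriv [i] f (weak_partial i f)"
  unfolding weak_partial_def by (rule someI[of "\<lambda>g. has_weak_deriv [i] f g"]) fact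

text \<open>
  For \<open>c = - \<i>\<close> and \<open>c = \<i>\<close> these are the derivatives with respect to \<open>z\<close> conjugate and \<open>z\<close>.
\<close>

definition wirtinger :: "complex \<Rightarrow> (real^2 \<Rightarrow> complex) \<Rightarrow> real^2 \<Rightarrow> complex" where
  "wirtinger c f x = 1/2 * (weak_partial 1 f x + c * weak_partial 2 f x)"

text \<open>
  The constant \<open>weak_partial\<close> selects some representative, so for the second application one has to
  know that the first-order combination selected before is again weakly differentiable. The second-order
  derivatives provided by the Sobolev space serve as its derivatives, because a partial derivative of a
  test function is a test function.
\<close>

lemma weak_second_order:
  fixes u :: "real^2 \<Rightarrow> complex" and c :: complex
  assumes u: "u \<in> sobolev 2" and \<phi>: "test_function \<phi>"
  shows "locally_integrable (wirtinger c (wirtinger c u))"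
    and "(LINT x|lebesgue. wirtinger c (wirtinger c u) x * \<phi> x) =
      1/4 * (LINT x|lebesgue. u x * (partial_derivs [1,1] \<phi> x + c * partial_derivs [2,1] \<phi> x
         + c * partial_derivs [1,2] \<phi> x + c\<^sup>2 * partial_derivs [2,2] \<phi> x))"
proof -
  have ex: "\<exists>g. has_weak_deriv is u g" if "length is \<le> 2" for "is"
    using u that unfolding sobolev_def by blast
  have wp: "has_weak_deriv [i] u (weak_partial i u)" for i
    using ex[of "[i]"] by (auto intro: weak_partialI)
  have u_loc: "locally_integrable u" using wp by (auto simp: has_weak_deriv_def)
  have wp_loc: "locally_integrable (weak_partial i u)" for i
    using wp by (auto simp: has_weak_deriv_def)
  have wp_eq: "(LINT x|lebesgue. weak_partial i u x * \<psi> x) = - (LINT x|lebesgue. u x * partial_deriv i \<psi> x)"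
    if "test_function \<psi>" for i \<psi>
    using wp[of i] that by (auto simp: has_weak_deriv_def partial_derivs_def)
  note int = locally_integrable_mult_test_function
  have d_loc: "locally_integrable (wirtinger c u)"
    unfolding wirtinger_def[abs_def] by (intro locally_integrable_lincomb wp_loc)
  have d_eq: "(LINT x|lebesgue. wirtinger c u x * \<psi> x) =
      - (1/2) * ((LINT x|lebesgue. u x * partial_deriv 1 \<psi> x) + c * (LINT x|lebesgue. u x * partial_deriv 2 \<psi> x))"
    if \<psi>: "test_function \<psi>" for \<psi>
  proof -
    have "(LINT x|lebesgue. wirtinger c u x * \<psi> x) =
      (LINT x|lebesgue. 1/2 * (weak_partial 1 u x * \<psi> x) + c/2 * (weak_partial 2 u x * \<psi> x))"
      by (rule Bochner_Integration.integral_cong) (auto simp: wirtinger_def[abs_def] field_simps)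
    also have "\<dots> = 1/2 * (LINT x|lebesgue. weak_partial 1 u x * \<psi> x) + c/2 * (LINT x|lebesgue. weak_partial 2 u x * \<psi> x)"
      using int[OF wp_loc \<psi>] by simp
    finally show ?thesis unfolding wp_eq[OF \<psi>] by (simp add: field_simps)
  qed
  have "\<exists>g. has_weak_deriv [i] (wirtinger c u) g" for i
  proof -
    obtain g1 where g1: "has_weak_deriv [1,i] u g1" using ex[of "[1,i]"] by auto
    obtain g2 where g2: "has_weak_deriv [2,i] u g2" using ex[of "[2,i]"] by auto
    have loc: "locally_integrable g1" "locally_integrable g2"
      using g1 g2 by (auto simp: has_weak_deriv_def)
    have "(LINT x|lebesgue. wirtinger c u x * partial_deriv i \<psi> x) = - (LINT x|lebesgue. 1/2 * (g1 x + c * g2 x) * \<psi> x)"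
      if \<psi>: "test_function \<psi>" for \<psi>
    proof -
      have "(LINT x|lebesgue. 1/2 * (g1 x + c * g2 x) * \<psi> x) =
         (LINT x|lebesgue. 1/2 * (g1 x * \<psi> x) + c/2 * (g2 x * \<psi> x))"
        by (rule Bochner_Integration.integral_cong) (auto simp: field_simps)
      also have "\<dots> = 1/2 * (LINT x|lebesgue. g1 x * \<psi> x) + c/2 * (LINT x|lebesgue. g2 x * \<psi> x)"
        using loc[THEN int, OF \<psi>] by simp
      also have "(LINT x|lebesgue. g1 x * \<psi> x) = (LINT x|lebesgue. u x * partial_deriv 1 (partial_deriv i \<psi>) x)"
        using g1 \<psi> by (auto simp: has_weak_deriv_def partial_derivs_def)
      also have "(LINT x|lebesgue. g2 x * \<psi> x) = (LINT x|lebesgue. u x * partial_deriv 2 (partial_deriv i \<psi>) x)"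
        using g2 \<psi> by (auto simp: has_weak_deriv_def partial_derivs_def)
      finally show ?thesis
        unfolding d_eq[OF test_function_partial_deriv[OF \<psi>]] by (simp add: field_simps)
    qed
    then have "has_weak_deriv [i] (wirtinger c u) (\<lambda>x. 1/2 * (g1 x + c * g2 x))"
      using d_loc locally_integrable_lincomb[OF loc, of "1/2" c] by (auto simp: has_weak_deriv_def partial_derivs_def)
    then show ?thesis by blast
  qed
  then have wp2: "has_weak_deriv [i] (wirtinger c u) (weak_partial i (wirtinger c u))" for i
    by (auto intro: weak_partialI)
  have wp2_loc: "locally_integrable (weak_partial i (wirtinger c u))" for i
    using wp2 by (auto simp: has_weak_deriv_def)
  then show "locally_integrable (wirtinger c (wirtinger c u))"
    by (subst wirtinger_def[abs_def]) (intro locally_integrable_lincomb)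
  have wp2_eq: "(LINT x|lebesgue. weak_partial i (wirtinger c u) x * \<phi> x) =
       1/2 * ((LINT x|lebesgue. u x * partial_deriv 1 (partial_deriv i \<phi>) x) + c * (LINT x|lebesgue. u x * partial_deriv 2 (partial_deriv i \<phi>) x))" for i
    using wp2[of i] \<phi> d_eq[OF test_function_partial_deriv[OF \<phi>, of i]] by (auto simp: has_weak_deriv_def partial_derivs_def)
  have "(LINT x|lebesgue. wirtinger c (wirtinger c u) x * \<phi> x) =
      (LINT x|lebesgue. 1/2 * (weak_partial 1 (wirtinger c u) x * \<phi> x) + c/2 * (weak_partial 2 (wirtinger c u) x * \<phi> x))"
    by (rule Bochner_Integration.integral_cong, simp, subst wirtinger_def) (auto simp: field_simps)
  also have "\<dots> = 1/2 * (LINT x|lebesgue. weak_partial 1 (wirtinger c u) x * \<phi> x) + c/2 * (LINT x|lebesgue. weak_partial 2 (wirtinger c u) x * \<phi> x)"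
    using int[OF wp2_loc \<phi>] by simp
  also have "\<dots> = 1/4 * ((LINT x|lebesgue. u x * partial_derivs [1,1] \<phi> x) + c * (LINT x|lebesgue. u x * partial_derivs [2,1] \<phi> x)
    + c * (LINT x|lebesgue. u x * partial_derivs [1,2] \<phi> x) + c\<^sup>2 * (LINT x|lebesgue. u x * partial_derivs [2,2] \<phi> x))"
    unfolding wp2_eq by (simp add: partial_derivs_def field_simps power2_eq_square)
  also have "\<dots> = 1/4 * (LINT x|lebesgue. u x * partial_derivs [1,1] \<phi> x + c * (u x * partial_derivs [2,1] \<phi> x)
    + c * (u x * partial_derivs [1,2] \<phi> x) + c\<^sup>2 * (u x * partial_derivs [2,2] \<phi> x))"
    using \<phi> by (simp add: partial_derivs_def int u_loc test_function_partial_deriv)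
  finally show "(LINT x|lebesgue. wirtinger c (wirtinger c u) x * \<phi> x) =
      1/4 * (LINT x|lebesgue. u x * (partial_derivs [1,1] \<phi> x + c * partial_derivs [2,1] \<phi> x
         + c * partial_derivs [1,2] \<phi> x + c\<^sup>2 * partial_derivs [2,2] \<phi> x))"
    by (simp add: field_simps)
qed

text \<open>
  Products of functions of one variable are sufficient as test functions, and partial derivatives act
  on their factors separately.
\<close>

definition tensor :: "(real \<Rightarrow> complex) \<Rightarrow> (real \<Rightarrow> complex) \<Rightarrow> real^2 \<Rightarrow> complex" where
  "tensor a b x = a (x $ 1) * b (x $ 2)"

lemma tensor_has_derivative:
  assumes "\<And>t. (a has_vector_derivative a' t) (at t)" "\<And>t. (b has_vector_derivative b' t) (at t)"
  shows "(tensor a b has_derivative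
    (\<lambda>h. of_real (h $ 1) * tensor a' b x + of_real (h $ 2) * tensor a b' x)) (at x)"
proof -
  have nth: "((\<lambda>x. x $ i) has_derivative (\<lambda>h. h $ i)) (at x)" for i :: 2
    by (rule bounded_linear_imp_has_derivative) (rule bounded_linear_vec_nth)
  have 1: "((\<lambda>x. a (x $ 1)) has_derivative (\<lambda>h. (h $ 1) *\<^sub>R a' (x $ 1))) (at x)"
    using has_derivative_compose[OF nth assms(1)[unfolded has_vector_derivative_def, of "x $ 1"]] by simp
  have 2: "((\<lambda>x. b (x $ 2)) has_derivative (\<lambda>h. (h $ 2) *\<^sub>R b' (x $ 2))) (at x)"
    using has_derivative_compose[OF nth assms(2)[unfolded has_vector_derivative_def, of "x $ 2"]] by simp
  show ?thesis unfolding tensor_def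
    using has_derivative_mult[OF 1 2] by (simp add: scaleR_conv_of_real algebra_simps)
qed

lemma partial_deriv_tensor:
  assumes "\<And>t. (a has_vector_derivative a' t) (at t)" "\<And>t. (b has_vector_derivative b' t) (at t)"
  shows "partial_deriv 1 (tensor a b) = tensor a' b" "partial_deriv 2 (tensor a b) = tensor a b'"
  unfolding partial_deriv_def
  by (simp_all add: fun_eq_iff frechet_derivative_at[OF tensor_has_derivative[OF assms], symmetric] axis_def)

text \<open>
  Iterated partial derivatives of a product of smooth functions are products of smooth functions.
\<close>

lemma test_function_tensor:
  assumes "smooth a" "smooth b" "\<And>t. \<bar>t\<bar> > r \<Longrightarrow> a t = 0" "\<And>t. \<bar>t\<bar> > r \<Longrightarrow> b t = 0"
  shows "test_function (tensor a b)"
proof -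
  have "\<exists>a' b'. smooth a' \<and> smooth b' \<and> partial_derivs is (tensor a b) = tensor a' b'" for "is"
  proof (induction "is")
    case Nil
    then show ?case using assms by (auto simp: partial_derivs_def)
  next
    case (Cons i "is")
    then obtain a' b' where *: "smooth a'" "smooth b'" "partial_derivs is (tensor a b) = tensor a' b'" by blast
    obtain a'' where a'': "\<And>x. (a' has_vector_derivative a'' x) (at x)" "smooth a''"
      using smooth_has_derivative[OF *(1)] by blast
    obtain b'' where b'': "\<And>x. (b' has_vector_derivative b'' x) (at x)" "smooth b''"
      using smooth_has_derivative[OF *(2)] by blast
    have "partial_derivs (i # is) (tensor a b) = partial_deriv i (tensor a' b')"
      using * by (simp add: partial_derivs_def)
    then show ?case
      using exhaust_2[of i] partial_deriv_tensor[of a' a'' b' b'', OF a''(1) b''(1)] * a'' b'' by auto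
  qed
  moreover have "tensor a' b' differentiable (at x)" if sm: "smooth a'" "smooth b'" for a' b' x
  proof -
    obtain a'' where a'': "\<And>x. (a' has_vector_derivative a'' x) (at x)"
      using smooth_has_derivative[OF sm(1)] by blast
    obtain b'' where b'': "\<And>x. (b' has_vector_derivative b'' x) (at x)"
      using smooth_has_derivative[OF sm(2)] by blast
    show ?thesis
      using tensor_has_derivative[of a' a'' b' b'', OF a'' b''] unfolding differentiable_def by blast
  qed
  moreover have "compact (closure {x. tensor a b x \<noteq> 0})"
  proof -
    have "{x. tensor a b x \<noteq> 0} \<subseteq> cbox (vector [-r, -r]) (vector [r, r])"
    proof
      fix x assume "x \<in> {x. tensor a b x \<noteq> 0}"
      then have "\<not> \<bar>x $ 1\<bar> > r" "\<not> \<bar>x $ 2\<bar> > r" using assms(3,4) by (auto simp: tensor_def)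
      then show "x \<in> cbox (vector [-r, -r]) (vector [r, r])"
        by (auto simp: mem_box_cart forall_2)
    qed
    then show ?thesis by (meson bounded_cbox bounded_subset compact_closure)
  qed
  ultimately show ?thesis unfolding test_function_def
  proof (intro conjI allI)
    fix "is" x
    assume "\<And>is. \<exists>a' b'. smooth a' \<and> smooth b' \<and> partial_derivs is (tensor a b) = tensor a' b'"
    then obtain a' b' where "smooth a'" "smooth b'" "partial_derivs is (tensor a b) = tensor a' b'" by blast
    moreover assume "\<And>a' b' x. smooth a' \<Longrightarrow> smooth b' \<Longrightarrow> tensor a' b' differentiable (at x)"
    ultimately show "partial_derivs is (tensor a b) differentiable (at x)" by simp
  qed
qed

section \<open>Bounds for the kernel after a partial Fourier transform\<close>

lemma norm_exp_diff_le:
  fixes a b :: complex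
  assumes "Re a \<le> M" "Re b \<le> M"
  shows "cmod (exp a - exp b) \<le> cmod (a - b) * exp M"
proof -
  have "convex {z. Re z \<le> M}" by (rule convex_halfspace_Re_le)
  then have "norm (exp a - exp b) \<le> exp M * norm (a - b)"
    by (rule field_differentiable_bound[where f' = exp])
      (use assms in \<open>auto intro: DERIV_exp DERIV_subset\<close>)
  then show ?thesis by (simp add: mult.commute)
qed

text \<open>
  The point is \<open>(s - x) (s + x) = - \<nu>\<close> together with \<open>|s + x| \<ge> x\<close>, where the branch \<open>Re s \<ge> 0\<close> is used.
\<close>

lemma sqrt_perturbation:
  fixes s \<nu> :: complex and x :: real
  assumes "s\<^sup>2 = of_real (x\<^sup>2) - \<nu>" "Re s \<ge> 0" "x > 0" "4 * cmod \<nu> \<le> x\<^sup>2"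
  shows "cmod (s - x) \<le> cmod \<nu> / x" "Re s \<ge> 3/4 * x" "cmod s \<ge> 3/4 * x" "cmod s \<le> 5/4 * x"
proof -
  have "(s - x) * (s + x) = - \<nu>" using assms(1) by (simp add: algebra_simps power2_eq_square)
  then have "cmod (s - x) * cmod (s + x) = cmod \<nu>" by (metis norm_minus_cancel norm_mult)
  moreover have "x \<le> cmod (s + x)" using assms(2) complex_Re_le_cmod[of "s + x"] by simp
  ultimately have "cmod (s - x) * x \<le> cmod \<nu>"
    by (metis mult_left_mono norm_ge_zero)
  then show 1: "cmod (s - x) \<le> cmod \<nu> / x" using \<open>x > 0\<close> by (simp add: field_simps)
  also have "\<dots> \<le> x / 4" using assms by (simp add: field_simps power2_eq_square)
  finally have 2: "cmod (s - x) \<le> x / 4" .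
  have "\<bar>Re (s - x)\<bar> \<le> x / 4" using abs_Re_le_cmod[of "s - x"] 2 by linarith
  then have "\<bar>Re s - x\<bar> \<le> x / 4" by simp
  then show 3: "Re s \<ge> 3/4 * x" by linarith
  then show "cmod s \<ge> 3/4 * x" using complex_Re_le_cmod[of s] by linarith
  show "cmod s \<le> 5/4 * x" using norm_triangle_ineq[of "s - x" x] 2 \<open>x > 0\<close> by simp
qed

text \<open>
  In what follows \<open>s\<close> and \<open>r\<close> are the square roots of \<open>x\<^sup>2 - \<mu>\<close> and \<open>x\<^sup>2 + \<mu>\<close> with non-negative real part,
  \<open>x\<close> stands for the modulus of the frequency and \<open>t\<close> for the distance in the second variable.
\<close>

context
  fixes s r \<mu> :: complex and x t :: real
  assumes s: "s\<^sup>2 = of_real (x\<^sup>2) - \<mu>" "Re s \<ge> 0"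
    and r: "r\<^sup>2 = of_real (x\<^sup>2) + \<mu>" "Re r \<ge> 0"
    and t: "t \<ge> 0" and x: "x > 0"
begin

text \<open>
  Here \<open>(s - r) (s + r) = - 2 \<mu>\<close> and \<open>Re (s + r) \<ge> 3/2 x\<close>. The second bound is the mean value estimate
  for the exponential function.
\<close>

lemma high_frequency_pair:
  assumes "4 * cmod \<mu> \<le> x\<^sup>2"
  shows "cmod (s - r) \<le> 4/3 * cmod \<mu> / x"
    "cmod (exp (- s * t) - exp (- r * t)) \<le> 4/3 * cmod \<mu> / x * (t * exp (- (3/4 * x * t)))"
proof -
  have r': "r\<^sup>2 = of_real (x\<^sup>2) - (-\<mu>)" using r by simp
  note S = sqrt_perturbation[OF s x assms]
  note R = sqrt_perturbation[OF r'(1) r(2) x, unfolded norm_minus_cancel, OF assms]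
  have "(s - r) * (s + r) = - (2 * \<mu>)" using s r by (simp add: algebra_simps power2_eq_square)
  then have "cmod (s - r) * cmod (s + r) = 2 * cmod \<mu>"
    by (metis norm_minus_cancel norm_mult norm_numeral)
  moreover have "3/2 * x \<le> cmod (s + r)" using S R complex_Re_le_cmod[of "s + r"] by simp
  ultimately have "cmod (s - r) * (3/2 * x) \<le> 2 * cmod \<mu>"
    by (metis mult_left_mono norm_ge_zero)
  then show sr: "cmod (s - r) \<le> 4/3 * cmod \<mu> / x" using x by (simp add: field_simps)
  have "cmod (exp (- s * t) - exp (- r * t)) \<le> cmod (- s * t - - r * t) * exp (- (3/4 * x * t))"
    by (rule norm_exp_diff_le)
      (use mult_right_mono[OF S(2) t] mult_right_mono[OF R(2) t] in \<open>simp_all add: mult_ac\<close>)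
  also have "- s * t - - r * t = of_real t * (r - s)" by (simp add: algebra_simps)
  also have "cmod \<dots> = t * cmod (s - r)" using t by (simp add: norm_mult norm_minus_commute)
  finally show "cmod (exp (- s * t) - exp (- r * t)) \<le> 4/3 * cmod \<mu> / x * (t * exp (- (3/4 * x * t)))"
    using mult_right_mono[OF sr, of "t * exp (- (3/4 * x * t))"] t by (simp add: mult_ac)
qed

text \<open>
  Each of the two terms is only of order \<open>1 / x\<close>, which is not integrable; their difference gains two
  powers of \<open>x\<close>.
\<close>

lemma high_frequency_even:
  assumes "4 * cmod \<mu> \<le> x\<^sup>2"
  shows "cmod (exp (- s * t) / s - exp (- r * t) / r) \<le> 5 * cmod \<mu> / x ^ 3"
proof -
  have r': "r\<^sup>2 = of_real (x\<^sup>2) - (-\<mu>)" using r by simp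
  note S = sqrt_perturbation[OF s x assms]
  note R = sqrt_perturbation[OF r'(1) r(2) x, unfolded norm_minus_cancel, OF assms]
  note P = high_frequency_pair[OF assms]
  have nz: "s \<noteq> 0" "r \<noteq> 0" using S R x by auto
  have te: "t * exp (- (3/4 * x * t)) \<le> 4 / (3 * x)"
  proof -
    have "3/4 * x * t \<le> exp (3/4 * x * t)" using exp_ge_add_one_self[of "3/4 * x * t"] by linarith
    then show ?thesis using x by (simp add: exp_minus field_simps)
  qed
  have eq: "exp (- s * t) / s - exp (- r * t) / r =
      (exp (- s * t) - exp (- r * t)) / s + exp (- r * t) * (r - s) / (s * r)"
    using nz by (simp add: field_simps)
  have "cmod (exp (- s * t) / s - exp (- r * t) / r) \<le>
      cmod (exp (- s * t) - exp (- r * t)) / cmod s + cmod (exp (- r * t)) * cmod (s - r) / (cmod s * cmod r)"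
    unfolding eq by (rule order_trans[OF norm_triangle_ineq]) (simp add: norm_mult norm_divide norm_minus_commute)
  also have "\<dots> \<le> (4/3 * cmod \<mu> / x * (4 / (3 * x))) / (3/4 * x) + 1 * (4/3 * cmod \<mu> / x) / ((3/4 * x) * (3/4 * x))"
  proof (intro add_mono frac_le mult_mono)
    show "cmod (exp (- s * t) - exp (- r * t)) \<le> 4/3 * cmod \<mu> / x * (4 / (3 * x))"
      using P(2) mult_left_mono[OF te, of "4/3 * cmod \<mu> / x"] x by simp
    show "cmod (exp (- r * t)) \<le> 1" using r t by (simp add: mult_nonneg_nonneg)
  qed (use S R P x in auto)
  also have "\<dots> = 128/27 * cmod \<mu> / x ^ 3" using x by (simp add: field_simps power3_eq_cube)
  also have "\<dots> \<le> 5 * cmod \<mu> / x ^ 3" using x by (intro divide_right_mono mult_right_mono) auto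
  finally show ?thesis .
qed

text \<open>
  For \<open>y = - x\<close> both terms are small, since \<open>y + s\<close> is of order \<open>|\<mu>| / x\<close>. For \<open>y = x\<close> the coefficient
  \<open>(x + s)\<^sup>2 / s = x\<^sup>2 / s + 2 x + s\<close> is of order \<open>x\<close>, but it is nearly stationary at \<open>s = x\<close>:
  its values at \<open>s\<close> and \<open>r\<close> differ by \<open>(s - r) (1 - x\<^sup>2 / (s r))\<close>, a product of two small factors. What remains
  is the difference of the exponentials, whose bound \<open>|\<mu>| t e\<^sup>-\<^sup>3\<^sup>x\<^sup>t\<^sup>/\<^sup>4\<close> has an integral over \<open>x\<close> that does not
  depend on \<open>t\<close>.
\<close>

lemma high_frequency_odd:
  assumes "4 * cmod \<mu> \<le> x\<^sup>2" and y: "y = x \<or> y = - x"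
  shows "cmod (exp (- s * t) * (y + s)\<^sup>2 / s - exp (- r * t) * (y + r)\<^sup>2 / r) \<le>
     9 * cmod \<mu> * (t * exp (- (3/4 * x * t))) + 6 * (cmod \<mu>)\<^sup>2 / x ^ 3"
proof -
  have r': "r\<^sup>2 = of_real (x\<^sup>2) - (-\<mu>)" using r by simp
  note S = sqrt_perturbation[OF s x assms(1)]
  note R = sqrt_perturbation[OF r'(1) r(2) x, unfolded norm_minus_cancel, OF assms(1)]
  note P = high_frequency_pair[OF assms(1)]
  have nz: "s \<noteq> 0" "r \<noteq> 0" using S R x by auto
  have es: "cmod (exp (- s * t)) \<le> 1" and er: "cmod (exp (- r * t)) \<le> 1" using s r t by simp_all
  show ?thesis using y
  proof
    assume [simp]: "y = x"
    have "exp (- s * t) * (y + s)\<^sup>2 / s - exp (- r * t) * (y + r)\<^sup>2 / r =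
      (exp (- s * t) - exp (- r * t)) * (x + s)\<^sup>2 / s
        + exp (- r * t) * (s - r) * (r * (s - x) + x * (r - x)) / (s * r)"
      using nz by (simp add: field_simps power2_eq_square)
    then have "cmod (exp (- s * t) * (y + s)\<^sup>2 / s - exp (- r * t) * (y + r)\<^sup>2 / r) \<le>
      cmod ((exp (- s * t) - exp (- r * t)) * (x + s)\<^sup>2 / s)
        + cmod (exp (- r * t) * (s - r) * (r * (s - x) + x * (r - x)) / (s * r))"
      by (metis norm_triangle_ineq)
    also have "\<dots> = cmod (exp (- s * t) - exp (- r * t)) * (cmod (x + s))\<^sup>2 / cmod s
        + cmod (exp (- r * t)) * cmod (s - r) * cmod (r * (s - x) + x * (r - x)) / (cmod s * cmod r)"
      by (simp add: norm_mult norm_divide norm_power)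
    also have "\<dots> \<le> (4/3 * cmod \<mu> / x * (t * exp (- (3/4 * x * t)))) * (9/4 * x)\<^sup>2 / (3/4 * x)
       + 1 * (4/3 * cmod \<mu> / x) * (9/4 * cmod \<mu>) / ((3/4 * x) * (3/4 * x))"
    proof (intro add_mono frac_le mult_mono power_mono)
      show "cmod (x + s) \<le> 9/4 * x" using S x norm_triangle_ineq[of "of_real x" s] by simp
      have "cmod (r * (s - x) + x * (r - x)) \<le> cmod r * cmod (s - x) + x * cmod (r - x)"
        using norm_triangle_ineq[of "r * (s - x)" "x * (r - x)"] x by (simp add: norm_mult)
      also have "\<dots> \<le> (5/4 * x) * (cmod \<mu> / x) + x * (cmod \<mu> / x)"
        using S R x by (intro add_mono mult_mono) auto
      also have "\<dots> = 9/4 * cmod \<mu>" using x by (simp add: field_simps)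
      finally show "cmod (r * (s - x) + x * (r - x)) \<le> 9/4 * cmod \<mu>" .
    qed (use S R P x er t in auto)
    also have "\<dots> = 9 * cmod \<mu> * (t * exp (- (3/4 * x * t))) + 16/3 * (cmod \<mu>)\<^sup>2 / x ^ 3"
      using x by (simp add: field_simps power3_eq_cube power2_eq_square)
    also have "\<dots> \<le> 9 * cmod \<mu> * (t * exp (- (3/4 * x * t))) + 6 * (cmod \<mu>)\<^sup>2 / x ^ 3"
      using x by (intro add_left_mono divide_right_mono mult_right_mono) auto
    finally show ?thesis .
  next
    assume [simp]: "y = - x"
    have *: "cmod (e * (y + q)\<^sup>2 / q) \<le> 4/3 * (cmod \<mu>)\<^sup>2 / x ^ 3"
      if "cmod e \<le> 1" "cmod (q - x) \<le> cmod \<mu> / x" "3/4 * x \<le> cmod q" for e q :: complex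
    proof -
      have "cmod (e * (y + q)\<^sup>2 / q) = cmod e * (cmod (q - x))\<^sup>2 / cmod q"
        by (simp add: norm_mult norm_divide norm_power)
      also have "\<dots> \<le> 1 * (cmod \<mu> / x)\<^sup>2 / (3/4 * x)"
        using that x by (intro frac_le mult_mono power_mono) auto
      also have "\<dots> = 4/3 * (cmod \<mu>)\<^sup>2 / x ^ 3"
        using x by (simp add: field_simps power3_eq_cube power2_eq_square)
      finally show ?thesis .
    qed
    have "cmod (exp (- s * t) * (y + s)\<^sup>2 / s - exp (- r * t) * (y + r)\<^sup>2 / r) \<le>
      cmod (exp (- s * t) * (y + s)\<^sup>2 / s) + cmod (exp (- r * t) * (y + r)\<^sup>2 / r)"
      by (rule norm_triangle_ineq4)
    also have "\<dots> \<le> 4/3 * (cmod \<mu>)\<^sup>2 / x ^ 3 + 4/3 * (cmod \<mu>)\<^sup>2 / x ^ 3"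
      using *[OF es S(1) S(3)] *[OF er R(1) R(3)] by (rule add_mono)
    also have "\<dots> = 8/3 * (cmod \<mu>)\<^sup>2 / x ^ 3" by simp
    also have "\<dots> \<le> 6 * (cmod \<mu>)\<^sup>2 / x ^ 3"
      using x by (intro divide_right_mono mult_right_mono) auto
    also have "\<dots> \<le> 9 * cmod \<mu> * (t * exp (- (3/4 * x * t))) + 6 * (cmod \<mu>)\<^sup>2 / x ^ 3"
      using t by simp
    finally show ?thesis .
  qed
qed

text \<open>
  Whatever the argument of \<open>\<mu>\<close> is, \<open>|x\<^sup>2 \<minusplus> \<mu>| \<ge> |x\<^sup>2 - |\<mu>||\<close>, so both square roots are bounded below by
  \<open>\<delta>\<close>. The exponentials are bounded by one because of \<open>Re s \<ge> 0\<close> and \<open>Re r \<ge> 0\<close>.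
\<close>

lemma low_frequency:
  assumes "x\<^sup>2 \<le> 4 * cmod \<mu>" "x\<^sup>2 \<noteq> cmod \<mu>" and y: "y = x \<or> y = - x"
  shows "cmod (exp (- s * t) / s - exp (- r * t) / r) \<le> 2 / sqrt \<bar>x\<^sup>2 - cmod \<mu>\<bar>"
    "cmod (exp (- s * t) * (y + s)\<^sup>2 / s - exp (- r * t) * (y + r)\<^sup>2 / r) \<le>
       40 * cmod \<mu> / sqrt \<bar>x\<^sup>2 - cmod \<mu>\<bar>"
proof -
  define \<delta> where "\<delta> = sqrt \<bar>x\<^sup>2 - cmod \<mu>\<bar>"
  have \<delta>: "\<delta> > 0" using assms by (simp add: \<delta>_def)
  have bounds: "\<delta> \<le> cmod q \<and> (x + cmod q)\<^sup>2 \<le> 20 * cmod \<mu> \<and> cmod (exp (- q * t)) \<le> 1"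
    if q: "q\<^sup>2 = of_real (x\<^sup>2) - \<nu>" "cmod \<nu> = cmod \<mu>" "Re q \<ge> 0" for q \<nu>
  proof (intro conjI)
    have "(cmod q)\<^sup>2 = cmod (of_real (x\<^sup>2) - \<nu>)" by (metis norm_power q(1))
    moreover have "cmod (of_real (x\<^sup>2) - \<nu>) \<le> x\<^sup>2 + cmod \<mu>"
      using norm_triangle_ineq4[of "of_real (x\<^sup>2)" \<nu>] q(2) by (simp add: norm_power)
    moreover have "\<bar>x\<^sup>2 - cmod \<mu>\<bar> \<le> cmod (of_real (x\<^sup>2) - \<nu>)"
      using norm_triangle_ineq3[of "of_real (x\<^sup>2)" \<nu>] q(2) by (simp add: norm_power)
    ultimately have q2: "\<bar>x\<^sup>2 - cmod \<mu>\<bar> \<le> (cmod q)\<^sup>2" "(cmod q)\<^sup>2 \<le> x\<^sup>2 + cmod \<mu>" by auto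
    show "\<delta> \<le> cmod q" unfolding \<delta>_def using q2(1) real_le_lsqrt by fastforce
    have "(x + cmod q)\<^sup>2 \<le> 2 * (x\<^sup>2 + (cmod q)\<^sup>2)"
      using zero_le_power2[of "x - cmod q"] by (simp add: power2_eq_square algebra_simps)
    also have "\<dots> \<le> 2 * (4 * cmod \<mu> + (4 * cmod \<mu> + cmod \<mu>))"
      using q2(2) assms(1) by (intro mult_left_mono add_mono) auto
    also have "\<dots> \<le> 20 * cmod \<mu>" by simp
    finally show "(x + cmod q)\<^sup>2 \<le> 20 * cmod \<mu>" .
    show "cmod (exp (- q * t)) \<le> 1" using q t by simp
  qed
  have r': "r\<^sup>2 = of_real (x\<^sup>2) - (-\<mu>)" using r by simp
  note S = bounds[OF s(1) refl s(2)]
  note R = bounds[OF r' norm_minus_cancel r(2)]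
  have one: "cmod (e / q) \<le> 1 / \<delta>" if "\<delta> \<le> cmod q" "cmod e \<le> 1" for e q :: complex
    using that \<delta> by (simp add: norm_divide frac_le)
  have two: "cmod (e * (y + q)\<^sup>2 / q) \<le> 20 * cmod \<mu> / \<delta>"
    if "\<delta> \<le> cmod q \<and> (x + cmod q)\<^sup>2 \<le> 20 * cmod \<mu> \<and> cmod e \<le> 1" for e q :: complex
  proof -
    have "cmod (y + q) \<le> x + cmod q" using norm_triangle_ineq[of "of_real y" q] y x by auto
    then have "(cmod (y + q))\<^sup>2 \<le> 20 * cmod \<mu>" using that power_mono[of "cmod (y + q)" "x + cmod q" 2] by auto
    then have "cmod e * (cmod (y + q))\<^sup>2 / cmod q \<le> 1 * (20 * cmod \<mu>) / \<delta>"
      using that \<delta> by (intro frac_le mult_mono) auto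
    then show ?thesis by (simp add: norm_mult norm_divide norm_power)
  qed
  show "cmod (exp (- s * t) / s - exp (- r * t) / r) \<le> 2 / sqrt \<bar>x\<^sup>2 - cmod \<mu>\<bar>"
    using norm_triangle_ineq4[of "exp (- s * t) / s" "exp (- r * t) / r"] one S R
    unfolding \<delta>_def[symmetric] by (smt (verit) add_divide_distrib)
  show "cmod (exp (- s * t) * (y + s)\<^sup>2 / s - exp (- r * t) * (y + r)\<^sup>2 / r) \<le>
       40 * cmod \<mu> / sqrt \<bar>x\<^sup>2 - cmod \<mu>\<bar>"
    using norm_triangle_ineq4[of "exp (- s * t) * (y + s)\<^sup>2 / s" "exp (- r * t) * (y + r)\<^sup>2 / r"] two[OF S] two[OF R]
    unfolding \<delta>_def[symmetric] by simp
qed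

end

lemma nn_integral_even:
  fixes f :: "real \<Rightarrow> ennreal"
  assumes [measurable]: "f \<in> borel_measurable borel"
  shows "(\<integral>\<^sup>+x. f \<bar>x - a\<bar> \<partial>lborel) \<le> 2 * (\<integral>\<^sup>+x. f x * indicator {0..} x \<partial>lborel)"
proof -
  let ?g = "\<lambda>x. f x * indicator {0..} x"
  have "(\<integral>\<^sup>+x. f \<bar>x - a\<bar> \<partial>lborel) \<le> (\<integral>\<^sup>+x. ?g (x - a) + ?g (a - x) \<partial>lborel)"
    by (intro nn_integral_mono) (auto simp: indicator_def abs_if)
  also have "\<dots> = (\<integral>\<^sup>+x. ?g (x - a) \<partial>lborel) + (\<integral>\<^sup>+x. ?g (a - x) \<partial>lborel)"
    by (rule nn_integral_add) measurable
  also have "(\<integral>\<^sup>+x. ?g (x - a) \<partial>lborel) = (\<integral>\<^sup>+x. ?g x \<partial>lborel)"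
    using nn_integral_real_affine[of "\<lambda>x. ?g (x - a)" 1 a] by simp
  also have "(\<integral>\<^sup>+x. ?g (a - x) \<partial>lborel) = (\<integral>\<^sup>+x. ?g x \<partial>lborel)"
    using nn_integral_real_affine[of "\<lambda>x. ?g (a - x)" "-1" a] by simp
  finally show ?thesis by (simp add: mult_2)
qed

lemma nn_integral_inverse_sqrt:
  fixes \<rho> :: real
  assumes "\<rho> > 0"
  shows "(\<integral>\<^sup>+x. ennreal (indicator {0..\<rho>} x / sqrt (\<rho> * x)) \<partial>lborel) = 2"
proof -
  have "((\<lambda>x. x powr (-1/2)) has_integral \<rho> powr (-1/2 + 1) / (-1/2 + 1)) {0..\<rho>}"
    using has_integral_powr_from_0[of "-1/2" \<rho>] assms by simp
  then have "((\<lambda>x. if x \<in> {0..\<rho>} then x powr (-1/2) else 0) has_integral \<rho> powr (1/2) / (1/2)) UNIV"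
    by (subst has_integral_restrict_UNIV) simp
  then have "((\<lambda>x. (1 / sqrt \<rho>) * (if x \<in> {0..\<rho>} then x powr (-1/2) else 0)) has_integral
      (1 / sqrt \<rho>) * (\<rho> powr (1/2) / (1/2))) UNIV"
    by (rule has_integral_mult_right)
  then have "((\<lambda>x. indicator {0..\<rho>} x / sqrt (\<rho> * x)) has_integral
      (1 / sqrt \<rho>) * (\<rho> powr (1/2) / (1/2))) UNIV"
    by (rule has_integral_eq[rotated])
      (auto simp: indicator_def real_sqrt_mult powr_minus_divide powr_half_sqrt)
  then have "(\<integral>\<^sup>+x. ennreal (indicator {0..\<rho>} x / sqrt (\<rho> * x)) \<partial>lborel) =
      ennreal ((1 / sqrt \<rho>) * (\<rho> powr (1/2) / (1/2)))"
    by (intro nn_integral_has_integral_lborel) (auto simp: indicator_def)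
  then show ?thesis using assms by (simp add: powr_half_sqrt)
qed

text \<open>
  The factorization \<open>\<xi>\<^sup>2 - \<rho>\<^sup>2 = (|\<xi>| + \<rho>) (|\<xi>| - \<rho>)\<close> reduces the integrand to
  \<open>(\<rho> ||\<xi>| - \<rho>|)\<^sup>-\<^sup>1\<^sup>/\<^sup>2\<close>, which is reflected twice: at zero and at \<open>\<rho>\<close>. The bound is independent of \<open>\<rho>\<close>.
\<close>

lemma nn_integral_low_frequency:
  fixes \<rho> :: real
  assumes "\<rho> > 0"
  shows "(\<integral>\<^sup>+\<xi>. ennreal (indicator {..2*\<rho>} \<bar>\<xi>\<bar> / sqrt \<bar>\<xi>\<^sup>2 - \<rho>\<^sup>2\<bar>) \<partial>lborel) \<le> 8"
proof -
  let ?h = "\<lambda>x. ennreal (indicator {0..\<rho>} x / sqrt (\<rho> * x))"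
  let ?f = "\<lambda>x. ?h \<bar>x - \<rho>\<bar>"
  have "(\<integral>\<^sup>+\<xi>. ennreal (indicator {..2*\<rho>} \<bar>\<xi>\<bar> / sqrt \<bar>\<xi>\<^sup>2 - \<rho>\<^sup>2\<bar>) \<partial>lborel) \<le> (\<integral>\<^sup>+\<xi>. ?f \<bar>\<xi> - 0\<bar> \<partial>lborel)"
  proof (intro nn_integral_mono ennreal_leI)
    fix \<xi> :: real
    show "indicator {..2*\<rho>} \<bar>\<xi>\<bar> / sqrt \<bar>\<xi>\<^sup>2 - \<rho>\<^sup>2\<bar> \<le>
       indicator {0..\<rho>} \<bar>\<bar>\<xi> - 0\<bar> - \<rho>\<bar> / sqrt (\<rho> * \<bar>\<bar>\<xi> - 0\<bar> - \<rho>\<bar>)"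
    proof (cases "\<bar>\<xi>\<bar> \<le> 2 * \<rho> \<and> \<bar>\<xi>\<bar> \<noteq> \<rho>")
      case True
      have "\<bar>\<xi>\<^sup>2 - \<rho>\<^sup>2\<bar> = (\<bar>\<xi>\<bar> + \<rho>) * \<bar>\<bar>\<xi>\<bar> - \<rho>\<bar>"
        using assms abs_mult[of "\<bar>\<xi>\<bar> + \<rho>" "\<bar>\<xi>\<bar> - \<rho>"]
        by (simp add: algebra_simps power2_eq_square)
      also have "\<dots> \<ge> \<rho> * \<bar>\<bar>\<xi>\<bar> - \<rho>\<bar>" by (intro mult_right_mono) auto
      finally have "\<rho> * \<bar>\<bar>\<xi>\<bar> - \<rho>\<bar> \<le> \<bar>\<xi>\<^sup>2 - \<rho>\<^sup>2\<bar>" .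
      moreover have "\<rho> * \<bar>\<bar>\<xi>\<bar> - \<rho>\<bar> > 0" using True assms by simp
      ultimately have "1 / sqrt \<bar>\<xi>\<^sup>2 - \<rho>\<^sup>2\<bar> \<le> 1 / sqrt (\<rho> * \<bar>\<bar>\<xi>\<bar> - \<rho>\<bar>)"
        by (intro divide_left_mono mult_pos_pos) auto
      moreover have "\<bar>\<bar>\<xi>\<bar> - \<rho>\<bar> \<le> \<rho>" using True assms by auto
      ultimately show ?thesis using True by (simp add: indicator_def)
    next
      case False
      then show ?thesis using assms by (auto simp: indicator_def power2_eq_square abs_mult abs_if split: if_splits)
    qed
  qed
  also have "\<dots> \<le> 2 * (\<integral>\<^sup>+x. ?f x * indicator {0..} x \<partial>lborel)"
    by (rule nn_integral_even) measurable
  also have "(\<integral>\<^sup>+x. ?f x * indicator {0..} x \<partial>lborel) \<le> (\<integral>\<^sup>+x. ?f x \<partial>lborel)"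
    by (intro nn_integral_mono) (auto simp: indicator_def)
  also have "\<dots> \<le> 2 * (\<integral>\<^sup>+x. ?h x * indicator {0..} x \<partial>lborel)"
    by (rule nn_integral_even) measurable
  also have "(\<integral>\<^sup>+x. ?h x * indicator {0..} x \<partial>lborel) \<le> (\<integral>\<^sup>+x. ?h x \<partial>lborel)"
    by (intro nn_integral_mono) (auto simp: indicator_def)
  also have "\<dots> = 2" by (rule nn_integral_inverse_sqrt) fact
  finally show ?thesis by (simp add: mult_left_mono)
qed

lemma nn_integral_high_frequency:
  fixes \<rho> t :: real
  assumes "\<rho> > 0" "t \<ge> 0"
  shows "(\<integral>\<^sup>+\<xi>. ennreal (indicator {2*\<rho>..} \<bar>\<xi>\<bar> / \<bar>\<xi>\<bar> ^ 3) \<partial>lborel) \<le> ennreal (1 / (4 * \<rho>\<^sup>2))"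
    and "(\<integral>\<^sup>+\<xi>. ennreal (t * exp (- (3/4 * \<bar>\<xi>\<bar> * t))) \<partial>lborel) \<le> 3"
proof -
  have "(\<integral>\<^sup>+\<xi>. ennreal (indicator {2*\<rho>..} \<bar>\<xi> - 0\<bar> / \<bar>\<xi> - 0\<bar> ^ 3) \<partial>lborel) \<le>
      2 * (\<integral>\<^sup>+x. ennreal (indicator {2*\<rho>..} x / x ^ 3) * indicator {0..} x \<partial>lborel)"
    by (rule nn_integral_even) measurable
  also have "(\<integral>\<^sup>+x. ennreal (indicator {2*\<rho>..} x / x ^ 3) * indicator {0..} x \<partial>lborel) =
     (\<integral>\<^sup>+x. ennreal (1 / x ^ 3) * indicator {2*\<rho>..} x \<partial>lborel)"
    by (intro nn_integral_cong) (use assms in \<open>auto simp: indicator_def\<close>)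
  also have "\<dots> = ennreal (0 - (- (1 / (2 * (2*\<rho>)\<^sup>2))))"
  proof (rule nn_integral_FTC_atLeast)
    show "DERIV (\<lambda>x. - (1 / (2 * x\<^sup>2))) x :> 1 / x ^ 3" if "2 * \<rho> \<le> x" for x
      using that assms by (auto intro!: derivative_eq_intros simp: field_simps power2_eq_square power3_eq_cube)
    show "((\<lambda>x::real. - (1 / (2 * x\<^sup>2))) \<longlongrightarrow> 0) at_top"
      by real_asymp
  qed (use assms in auto)
  also have "2 * \<dots> = ennreal (2 * (0 - (- (1 / (2 * (2*\<rho>)\<^sup>2)))))"
    by (subst ennreal_mult') auto
  also have "2 * (0 - (- (1 / (2 * (2*\<rho>)\<^sup>2)))) = 1 / (4 * \<rho>\<^sup>2)"
    by (simp add: power2_eq_square)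
  finally show "(\<integral>\<^sup>+\<xi>. ennreal (indicator {2*\<rho>..} \<bar>\<xi>\<bar> / \<bar>\<xi>\<bar> ^ 3) \<partial>lborel) \<le> ennreal (1 / (4 * \<rho>\<^sup>2))" by simp
next
  show "(\<integral>\<^sup>+\<xi>. ennreal (t * exp (- (3/4 * \<bar>\<xi>\<bar> * t))) \<partial>lborel) \<le> 3"
  proof (cases "t = 0")
    case False
    have "(\<integral>\<^sup>+\<xi>. ennreal (t * exp (- (3/4 * \<bar>\<xi> - 0\<bar> * t))) \<partial>lborel) \<le>
       2 * (\<integral>\<^sup>+x. ennreal (t * exp (- (3/4 * x * t))) * indicator {0..} x \<partial>lborel)"
      by (rule nn_integral_even) measurable
    also have "(\<integral>\<^sup>+x. ennreal (t * exp (- (3/4 * x * t))) * indicator {0..} x \<partial>lborel) =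
       ennreal (0 - (- (4/3 * exp (- (3/4 * 0 * t)))))"
    proof (rule nn_integral_FTC_atLeast)
      show "DERIV (\<lambda>x. - (4/3 * exp (- (3/4 * x * t)))) x :> t * exp (- (3/4 * x * t))" for x
        by (auto intro!: derivative_eq_intros)
      show "((\<lambda>x. - (4/3 * exp (- (3/4 * x * t)))) \<longlongrightarrow> 0) at_top"
        using assms False by real_asymp
    qed (use assms in auto)
    also have "2 * \<dots> = ennreal (2 * (0 - (- (4/3 * exp (- (3/4 * 0 * t))))))"
      by (subst ennreal_mult') auto
    also have "2 * (0 - (- (4/3 * exp (- (3/4 * 0 * t))))) = 8/3" by simp
    also have "\<dots> \<le> ennreal 3" by (rule ennreal_leI) simp
    finally show ?thesis by simp
  qed simp
qed

text \<open>
  The decay rate in the second variable of a solution of \<open>(-\<Delta> - \<nu>) f = 0\<close> with frequency \<open>\<xi>\<close> in the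
  first one.
\<close>

definition wave :: "complex \<Rightarrow> real \<Rightarrow> complex" where
  "wave \<nu> \<xi> = csqrt (of_real (\<xi>\<^sup>2) - \<nu>)"

lemma wave_square: "(wave \<nu> \<xi>)\<^sup>2 = of_real (\<xi>\<^sup>2) - \<nu>"
  by (simp add: wave_def)

lemma Re_wave: "Re (wave \<nu> \<xi>) \<ge> 0"
  using csqrt_principal[of "of_real (\<xi>\<^sup>2) - \<nu>"] unfolding wave_def by linarith

lemma wave_measurable [measurable]: "wave \<nu> \<in> borel_measurable borel"
proof -
  have 1: "(\<lambda>\<xi>. Re (wave \<nu> \<xi>)) \<in> borel_measurable borel"
    unfolding wave_def csqrt.sel by measurable
  have 2: "(\<lambda>\<xi>. Im (wave \<nu> \<xi>)) \<in> borel_measurable borel"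
    unfolding wave_def csqrt.sel by measurable
  show ?thesis using 1 2 by (subst borel_measurable_complex_iff) auto
qed

text \<open>
  The two integrands are, up to constant factors, the partial Fourier transforms of the kernels of
  \<open>\<mu> (\<Delta>\<^sup>2 - \<mu>\<^sup>2)\<^sup>-\<^sup>1\<close> and \<open>\<mu> L\<^sub>\<plusminus>\<^sub>1 (\<Delta>\<^sup>2 - \<mu>\<^sup>2)\<^sup>-\<^sup>1\<close>. Frequencies are split at \<open>2 |\<mu>|\<^sup>1\<^sup>/\<^sup>2\<close>.
  That no constant depends on \<open>t\<close> or on the argument of \<open>\<mu>\<close> is what makes the final estimate uniform.
\<close>

theorem kernel_bounds:
  fixes \<mu> :: complex and t \<sigma> :: real
  assumes "\<mu> \<noteq> 0" "t \<ge> 0" "\<sigma> = 1 \<or> \<sigma> = -1"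
  defines "e \<equiv> \<lambda>\<nu> \<xi>. exp (- wave \<nu> \<xi> * t)"
  shows "(\<integral>\<^sup>+\<xi>. ennreal (cmod (e \<mu> \<xi> / wave \<mu> \<xi> - e (-\<mu>) \<xi> / wave (-\<mu>) \<xi>)) \<partial>lborel) \<le> 20"
    and "(\<integral>\<^sup>+\<xi>. ennreal (cmod (e \<mu> \<xi> * (\<sigma> * \<xi> + wave \<mu> \<xi>)\<^sup>2 / wave \<mu> \<xi>
       - e (-\<mu>) \<xi> * (\<sigma> * \<xi> + wave (-\<mu>) \<xi>)\<^sup>2 / wave (-\<mu>) \<xi>)) \<partial>lborel) \<le> ennreal (400 * cmod \<mu>)"
proof -
  let ?A = "\<lambda>\<xi>. e \<mu> \<xi> / wave \<mu> \<xi> - e (-\<mu>) \<xi> / wave (-\<mu>) \<xi>"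
  let ?B = "\<lambda>\<xi>. e \<mu> \<xi> * (\<sigma> * \<xi> + wave \<mu> \<xi>)\<^sup>2 / wave \<mu> \<xi>
    - e (-\<mu>) \<xi> * (\<sigma> * \<xi> + wave (-\<mu>) \<xi>)\<^sup>2 / wave (-\<mu>) \<xi>"
  define \<rho> where "\<rho> = sqrt (cmod \<mu>)"
  have \<rho>: "\<rho> > 0" "\<rho>\<^sup>2 = cmod \<mu>" using assms by (simp_all add: \<rho>_def)
  let ?lo = "\<lambda>\<xi>::real. indicator {..2*\<rho>} \<bar>\<xi>\<bar> / sqrt \<bar>\<xi>\<^sup>2 - \<rho>\<^sup>2\<bar> :: real"
  let ?hi = "\<lambda>\<xi>::real. indicator {2*\<rho>..} \<bar>\<xi>\<bar> / \<bar>\<xi>\<bar> ^ 3 :: real"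
  let ?ex = "\<lambda>\<xi>::real. t * exp (- (3/4 * \<bar>\<xi>\<bar> * t))"
  have AE: "AE \<xi> in lborel. \<xi> \<noteq> 0 \<and> \<xi> \<noteq> \<rho> \<and> \<xi> \<noteq> - \<rho>"
    by (simp add: AE_lborel_singleton)
  have pointwise:
    "cmod (?A \<xi>) \<le> 2 * ?lo \<xi> + 5 * cmod \<mu> * ?hi \<xi>"
    "cmod (?B \<xi>) \<le>
      40 * cmod \<mu> * ?lo \<xi> + (9 * cmod \<mu> * ?ex \<xi> + 6 * (cmod \<mu>)\<^sup>2 * ?hi \<xi>)"
    if \<xi>: "\<xi> \<noteq> 0 \<and> \<xi> \<noteq> \<rho> \<and> \<xi> \<noteq> - \<rho>" for \<xi>
  proof -
    have sq: "\<bar>\<xi>\<bar> > 2 * \<rho> \<longleftrightarrow> 4 * cmod \<mu> < \<bar>\<xi>\<bar>\<^sup>2"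
      using \<rho> abs_le_square_iff[of \<xi> "2 * \<rho>"] by (auto simp: power_mult_distrib not_le[symmetric])
    have ne: "\<bar>\<xi>\<bar>\<^sup>2 \<noteq> cmod \<mu>" using \<xi> \<rho> by (metis power2_abs power2_eq_iff)
    have y: "\<sigma> * \<xi> = \<bar>\<xi>\<bar> \<or> \<sigma> * \<xi> = - \<bar>\<xi>\<bar>" using assms(3) by auto
    have s: "(wave \<mu> \<xi>)\<^sup>2 = of_real (\<bar>\<xi>\<bar>\<^sup>2) - \<mu>" by (simp add: wave_square)
    have r: "(wave (-\<mu>) \<xi>)\<^sup>2 = of_real (\<bar>\<xi>\<bar>\<^sup>2) + \<mu>" by (simp add: wave_square)
    have x: "\<bar>\<xi>\<bar> > 0" using \<xi> by simp
    note hyps = s Re_wave r Re_wave assms(2) x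
    have nn: "0 \<le> ?lo \<xi>" "0 \<le> ?hi \<xi>" "0 \<le> ?ex \<xi>" using assms(2) by auto
    have "cmod (?A \<xi>) \<le> 2 * ?lo \<xi> + 5 * cmod \<mu> * ?hi \<xi> \<and>
      cmod (?B \<xi>) \<le>
      40 * cmod \<mu> * ?lo \<xi> + (9 * cmod \<mu> * ?ex \<xi> + 6 * (cmod \<mu>)\<^sup>2 * ?hi \<xi>)"
    proof (cases "\<bar>\<xi>\<bar> > 2 * \<rho>")
      case True
      then have "4 * cmod \<mu> \<le> \<bar>\<xi>\<bar>\<^sup>2" using sq by simp
      note H = high_frequency_even[OF hyps this] high_frequency_odd[OF hyps this y]
      then show ?thesis using True unfolding e_def by (simp add: indicator_def)
    next
      case False
      then have "\<bar>\<xi>\<bar>\<^sup>2 \<le> 4 * cmod \<mu>" using sq by linarith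
      note L = low_frequency[OF hyps this ne y]
      have "0 \<le> 5 * cmod \<mu> * ?hi \<xi>" "0 \<le> 9 * cmod \<mu> * ?ex \<xi> + 6 * (cmod \<mu>)\<^sup>2 * ?hi \<xi>"
        using nn by simp_all
      moreover have lo: "?lo \<xi> = 1 / sqrt \<bar>\<bar>\<xi>\<bar>\<^sup>2 - cmod \<mu>\<bar>" using False \<rho>(2) by (simp add: indicator_def)
      have "cmod (?A \<xi>) \<le> 2 * ?lo \<xi>"
        "cmod (?B \<xi>) \<le> 40 * cmod \<mu> * ?lo \<xi>"
        using L unfolding e_def lo by simp_all
      ultimately show ?thesis by linarith
    qed
    then show "cmod (?A \<xi>) \<le> 2 * ?lo \<xi> + 5 * cmod \<mu> * ?hi \<xi>"
    "cmod (?B \<xi>) \<le>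
      40 * cmod \<mu> * ?lo \<xi> + (9 * cmod \<mu> * ?ex \<xi> + 6 * (cmod \<mu>)\<^sup>2 * ?hi \<xi>)" by auto
  qed
  note lo = nn_integral_low_frequency[OF \<rho>(1)]
  note hi = nn_integral_high_frequency(1)[OF \<rho>(1) assms(2)]
  note ex = nn_integral_high_frequency(2)[OF \<rho>(1) assms(2)]
  have "(\<integral>\<^sup>+\<xi>. ennreal (cmod (?A \<xi>)) \<partial>lborel) \<le>
     (\<integral>\<^sup>+\<xi>. 2 * ennreal (?lo \<xi>) + ennreal (5 * cmod \<mu>) * ennreal (?hi \<xi>) \<partial>lborel)"
    by (rule nn_integral_mono_AE, rule AE_mp[OF AE], rule AE_I2)
      (use pointwise(1) in \<open>auto simp: ennreal_mult'[symmetric] ennreal_plus[symmetric] simp flip: ennreal_numeral simp del: ennreal_plus intro!: ennreal_leI\<close>)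
  also have "\<dots> = 2 * (\<integral>\<^sup>+\<xi>. ennreal (?lo \<xi>) \<partial>lborel) + ennreal (5 * cmod \<mu>) * (\<integral>\<^sup>+\<xi>. ennreal (?hi \<xi>) \<partial>lborel)"
    by (subst nn_integral_add) (auto simp: nn_integral_cmult)
  also have "\<dots> \<le> 2 * 8 + ennreal (5 * cmod \<mu>) * ennreal (1 / (4 * \<rho>\<^sup>2))"
    by (intro add_mono mult_left_mono lo hi) auto
  also have "ennreal (5 * cmod \<mu>) * ennreal (1 / (4 * \<rho>\<^sup>2)) = ennreal (5/4)"
    using assms(1) by (simp add: \<rho> ennreal_mult'[symmetric])
  also have "2 * 8 + ennreal (5/4) \<le> ennreal (16 + 5/4)"
    by (subst ennreal_plus) auto
  also have "\<dots> \<le> ennreal 20" by (rule ennreal_leI) simp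
  finally show "(\<integral>\<^sup>+\<xi>. ennreal (cmod (?A \<xi>)) \<partial>lborel) \<le> 20" by simp
  have "(\<integral>\<^sup>+\<xi>. ennreal (cmod (?B \<xi>)) \<partial>lborel) \<le>
     (\<integral>\<^sup>+\<xi>. ennreal (40 * cmod \<mu>) * ennreal (?lo \<xi>) + (ennreal (9 * cmod \<mu>) * ennreal (?ex \<xi>)
        + ennreal (6 * (cmod \<mu>)\<^sup>2) * ennreal (?hi \<xi>)) \<partial>lborel)"
    by (rule nn_integral_mono_AE, rule AE_mp[OF AE], rule AE_I2)
      (use pointwise(2) assms(2) in \<open>auto simp: ennreal_mult'[symmetric] ennreal_plus[symmetric] simp del: ennreal_plus intro!: ennreal_leI\<close>)
  also have "\<dots> = ennreal (40 * cmod \<mu>) * (\<integral>\<^sup>+\<xi>. ennreal (?lo \<xi>) \<partial>lborel) +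
     (ennreal (9 * cmod \<mu>) * (\<integral>\<^sup>+\<xi>. ennreal (?ex \<xi>) \<partial>lborel)
     + ennreal (6 * (cmod \<mu>)\<^sup>2) * (\<integral>\<^sup>+\<xi>. ennreal (?hi \<xi>) \<partial>lborel))"
    by (subst nn_integral_add, simp, simp, subst nn_integral_add) (auto simp: nn_integral_cmult)
  also have "\<dots> \<le> ennreal (40 * cmod \<mu>) * ennreal 8 + (ennreal (9 * cmod \<mu>) * ennreal 3
      + ennreal (6 * (cmod \<mu>)\<^sup>2) * ennreal (1 / (4 * \<rho>\<^sup>2)))"
    by (intro add_mono mult_left_mono) (use lo hi ex in auto)
  also have "\<dots> = ennreal (40 * cmod \<mu> * 8 + (9 * cmod \<mu> * 3 + 6 * (cmod \<mu>)\<^sup>2 * (1 / (4 * \<rho>\<^sup>2))))"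
    by (simp only: ennreal_mult'[symmetric] ennreal_plus[symmetric] norm_ge_zero mult_nonneg_nonneg add_nonneg_nonneg
        zero_le_numeral zero_le_power2 zero_le_divide_1_iff)
  also have "40 * cmod \<mu> * 8 + (9 * cmod \<mu> * 3 + 6 * (cmod \<mu>)\<^sup>2 * (1 / (4 * \<rho>\<^sup>2))) = (347 + 3/2) * cmod \<mu>"
    using assms(1) unfolding \<rho>(2) by (simp add: power2_eq_square field_simps)
  also have "ennreal ((347 + 3/2) * cmod \<mu>) \<le> ennreal (400 * cmod \<mu>)"
    by (intro ennreal_leI mult_right_mono) auto
  finally show "(\<integral>\<^sup>+\<xi>. ennreal (cmod (?B \<xi>)) \<partial>lborel) \<le> ennreal (400 * cmod \<mu>)" .
qed

section \<open>The one-dimensional Green function\<close>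

lemma integrable_compact_support:
  fixes f :: "real \<Rightarrow> complex"
  assumes "continuous_on UNIV f" "\<And>y. \<bar>y\<bar> > l \<Longrightarrow> f y = 0"
  shows "integrable lborel f"
proof -
  have "set_integrable lborel {-l..l} f"
    using assms(1) by (intro borel_integrable_atLeastAtMost') (auto intro: continuous_on_subset)
  moreover have "(\<lambda>x. indicator {-l..l} x *\<^sub>R f x) = f"
    using assms(2) by (intro ext) (force simp: indicator_def)
  ultimately show ?thesis by (simp add: set_integrable_def)
qed

text \<open>
  Beyond the support any antiderivative is constant, so the integral over the half-line is the
  difference of two values of an antiderivative.
\<close>

lemma antiderivative_compact_support:
  fixes f :: "real \<Rightarrow> complex"
  assumes f: "continuous_on UNIV f" and 0: "\<And>y. \<bar>y\<bar> > l \<Longrightarrow> f y = 0"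
  shows "((\<lambda>x. LINT y|lborel. indicator {..x} y *\<^sub>R f y) has_vector_derivative f x) (at x)"
proof -
  have "\<exists>G. \<forall>x. -\<infinity> < ereal x \<longrightarrow> ereal x < \<infinity> \<longrightarrow> (G has_vector_derivative f x) (at x)"
    using f by (intro einterval_antiderivative) (auto simp: continuous_on_eq_continuous_at)
  then obtain G where G: "\<And>x. (G has_vector_derivative f x) (at x)" by auto
  have FTC: "(LINT y|lborel. indicator {a..b} y *\<^sub>R f y) = G b - G a" if "a \<le> b" for a b
    using that f G by (intro integral_FTC_atLeastAtMost)
      (auto intro: continuous_on_subset has_vector_derivative_at_within)
  define m where "m = - \<bar>l\<bar> - 1"
  have "(LINT y|lborel. indicator {..x} y *\<^sub>R f y) = G x - G m" for x
  proof -
    define a where "a = min x m"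
    have "(LINT y|lborel. indicator {..x} y *\<^sub>R f y) = (LINT y|lborel. indicator {a..x} y *\<^sub>R f y)"
      using 0 by (intro Bochner_Integration.integral_cong) (auto simp: indicator_def a_def m_def)
    also have "\<dots> = G x - G a" by (rule FTC) (simp add: a_def)
    also have "G a = G m"
    proof -
      have "(LINT y|lborel. indicator {a..m} y *\<^sub>R f y) = (LINT y::real|lborel. (0::complex))"
        using 0 by (intro Bochner_Integration.integral_cong) (auto simp: indicator_def a_def m_def)
      then show ?thesis using FTC[of a m] by (simp add: a_def)
    qed
    finally show ?thesis .
  qed
  moreover have "((\<lambda>x. G x - G m) has_vector_derivative f x) (at x)"
    using G by (auto intro!: derivative_eq_intros)
  ultimately show ?thesis by simp
qed

text \<open>
  The kernel \<open>e\<^sup>-\<^sup>s\<^sup>|\<^sup>x\<^sup>-\<^sup>y\<^sup>| / (2s)\<close> is the Green function of \<open>- f'' + s\<^sup>2 f\<close>.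
\<close>

definition green :: "complex \<Rightarrow> (real \<Rightarrow> complex) \<Rightarrow> real \<Rightarrow> complex" where
  "green s g x = (LINT y|lborel. exp (- s * of_real \<bar>x - y\<bar>) / (2 * s) * g y)"

definition green_deriv :: "complex \<Rightarrow> (real \<Rightarrow> complex) \<Rightarrow> real \<Rightarrow> complex" where
  "green_deriv s g x = (LINT y|lborel. (if y \<le> x then -1 else 1) / 2 * exp (- s * of_real \<bar>x - y\<bar>) * g y)"

context
  fixes s :: complex and g :: "real \<Rightarrow> complex" and l :: real
  assumes s0: "s \<noteq> 0" and g: "continuous_on UNIV g" and supp: "\<And>y. \<bar>y\<bar> > l \<Longrightarrow> g y = 0"
begin

lemma green_integrable:
  "integrable lborel (\<lambda>y. exp (- s * of_real \<bar>x - y\<bar>) / (2 * s) * g y)"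
  "integrable lborel (\<lambda>y. (if y \<le> x then -1 else 1) / 2 * exp (- s * of_real \<bar>x - y\<bar>) * g y)"
proof -
  have *: "integrable lborel (\<lambda>y. exp (- s * of_real \<bar>x - y\<bar>) * g y)"
    using g supp by (intro integrable_compact_support[of _ l]) (auto intro!: continuous_intros)
  then have "integrable lborel (\<lambda>y. 1 / (2 * s) * (exp (- s * of_real \<bar>x - y\<bar>) * g y))"
    by (rule integrable_mult_right)
  then show "integrable lborel (\<lambda>y. exp (- s * of_real \<bar>x - y\<bar>) / (2 * s) * g y)" by simp
  show "integrable lborel (\<lambda>y. (if y \<le> x then -1 else 1) / 2 * exp (- s * of_real \<bar>x - y\<bar>) * g y)"
  proof (rule Bochner_Integration.integrable_bound[OF *])
    have [measurable]: "g \<in> borel_measurable borel" using g by (rule borel_measurable_continuous_onI)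
    show "(\<lambda>y. (if y \<le> x then -1 else 1) / 2 * exp (- s * of_real \<bar>x - y\<bar>) * g y) \<in> borel_measurable lborel"
      by measurable
  qed (auto simp: norm_mult)
qed

text \<open>
  Splitting the integrals at \<open>y = x\<close> separates the variables: with \<open>P\<close> and \<open>Q\<close> the integrals of
  \<open>e\<^sup>s\<^sup>y g\<close> and \<open>e\<^sup>-\<^sup>s\<^sup>y g\<close> over the half-lines to the left and to the right of \<open>x\<close>, both functions are
  combinations of \<open>e\<^sup>-\<^sup>s\<^sup>x P\<close> and \<open>e\<^sup>s\<^sup>x Q\<close>, and the product rule applies.
\<close>

lemma green_ode:
  "(green s g has_vector_derivative green_deriv s g x) (at x)"
  "(green_deriv s g has_vector_derivative s\<^sup>2 * green s g x - g x) (at x)"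
proof -
  define P where "P x = (LINT y|lborel. indicator {..x} y *\<^sub>R (exp (s * y) * g y))" for x
  define Q where "Q x = (LINT y|lborel. exp (- s * y) * g y) - (LINT y|lborel. indicator {..x} y *\<^sub>R (exp (- s * y) * g y))" for x
  have int: "integrable lborel (\<lambda>y. exp (s' * of_real y) * g y)" for s'
    using g supp by (intro integrable_compact_support[of _ l]) (auto intro!: continuous_intros)
  have int': "integrable lborel (\<lambda>y. indicator {..x} y *\<^sub>R (exp (s' * of_real y) * g y))" for s' x
    using integrable_mult_indicator[OF _ int] by simp
  have P: "(P has_vector_derivative exp (s * x) * g x) (at x)" for x
    unfolding P_def using g supp
    by (intro antiderivative_compact_support[of _ l]) (auto intro!: continuous_intros)
  have Q: "(Q has_vector_derivative - (exp (- s * x) * g x)) (at x)" for x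
    unfolding Q_def using g supp
    by (auto intro!: derivative_eq_intros antiderivative_compact_support[of _ l] continuous_intros)
  have intm: "integrable lborel (\<lambda>y. exp (- s * of_real y) * g y)"
    "integrable lborel (\<lambda>y. indicator {..x} y *\<^sub>R (exp (- s * of_real y) * g y))" for x
    using int[of "-s"] int'[of _ "-s"] by simp_all
  have QI: "Q x = (LINT y|lborel. indicator {x<..} y *\<^sub>R (exp (- s * y) * g y))" for x
    unfolding Q_def Bochner_Integration.integral_diff[OF intm, symmetric]
    by (auto intro!: Bochner_Integration.integral_cong simp: indicator_def)
  have intQ: "integrable lborel (\<lambda>y. indicator {x<..} y *\<^sub>R (exp (- s * y) * g y))" for x
    using integrable_mult_indicator[OF _ int[of "-s"]] by simp
  have combine: "exp (- s * x) * (exp (s * y) * g y) = exp (- s * (x - y)) * g y"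
    "exp (s * x) * (exp (- s * y) * g y) = exp (- s * (y - x)) * g y" for x y
    unfolding mult.assoc[symmetric] mult_exp_exp by (simp_all add: algebra_simps)
  have green: "green s g x = 1 / (2 * s) * (exp (- s * x) * P x + exp (s * x) * Q x)" for x
  proof -
    have "exp (- s * x) * P x + exp (s * x) * Q x =
      (LINT y|lborel. exp (- s * x) * indicator {..x} y *\<^sub>R (exp (s * y) * g y) + exp (s * x) * indicator {x<..} y *\<^sub>R (exp (- s * y) * g y))"
      unfolding P_def QI
      by (subst Bochner_Integration.integral_add[OF integrable_mult_right[OF int'] integrable_mult_right[OF intQ]],
          subst (1 2) integral_mult_right_zero, rule refl)
    also have "\<dots> = (LINT y|lborel. exp (- s * of_real \<bar>x - y\<bar>) * g y)"
    proof (intro Bochner_Integration.integral_cong refl, goal_cases)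
      case (1 y)
      show ?case using combine[of x y] by (cases "y \<le> x") (simp_all add: indicator_def)
    qed
    finally have "1 / (2 * s) * (exp (- s * x) * P x + exp (s * x) * Q x) = (LINT y|lborel. 1 / (2 * s) * (exp (- s * of_real \<bar>x - y\<bar>) * g y))"
      by simp
    then show ?thesis unfolding green_def using s0 by auto
  qed
  have green_deriv: "green_deriv s g x = 1 / 2 * (- exp (- s * x) * P x + exp (s * x) * Q x)" for x
  proof -
    have "- exp (- s * x) * P x + exp (s * x) * Q x =
      (LINT y|lborel. - exp (- s * x) * indicator {..x} y *\<^sub>R (exp (s * y) * g y) + exp (s * x) * indicator {x<..} y *\<^sub>R (exp (- s * y) * g y))"
      unfolding P_def QI
      by (subst Bochner_Integration.integral_add[OF integrable_mult_right[OF int'] integrable_mult_right[OF intQ]],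
          subst (1 2) integral_mult_right_zero, rule refl)
    also have "\<dots> = (LINT y|lborel. 2 * ((if y \<le> x then -1 else 1) / 2 * exp (- s * of_real \<bar>x - y\<bar>) * g y))"
    proof (intro Bochner_Integration.integral_cong refl, goal_cases)
      case (1 y)
      show ?case using combine[of x y] by (cases "y \<le> x") (simp_all add: indicator_def)
    qed
    finally show ?thesis unfolding green_deriv_def by simp
  qed
  have exp_inv: "exp (- s * x) * exp (s * x) = 1" for x :: real
    unfolding mult_exp_exp by simp
  have alg1: "1 / (2 * s) * ((a * (b * w) + (- s * a) * p) + (b * (- (a * w)) + (s * b) * q)) = 1 / 2 * (- a * p + b * q)"
    for a b w p q
    using s0 by (simp add: field_simps)
  have alg2: "1 / 2 * ((- a * (b * w) + (- (- s * a)) * p) + (b * (- (a * w)) + (s * b) * q)) =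
      s\<^sup>2 * (1 / (2 * s) * (a * p + b * q)) - w" if "a * b = 1" for a b w p q
  proof -
    have "1 / 2 * ((- a * (b * w) + (- (- s * a)) * p) + (b * (- (a * w)) + (s * b) * q)) =
      s / 2 * (a * p + b * q) - (a * b) * w" by (simp add: field_simps)
    then show ?thesis using s0 that by (simp add: power2_eq_square)
  qed
  have E: "((\<lambda>x. exp (s' * of_real x)) has_vector_derivative s' * exp (s' * of_real x)) (at x)" for s' :: complex and x :: real
    by (rule has_vector_derivative_real_field) (auto intro!: derivative_eq_intros)
  have "((\<lambda>x. 1 / (2 * s) * (exp (- s * x) * P x + exp (s * x) * Q x)) has_vector_derivative
     1 / (2 * s) * ((exp (- s * x) * (exp (s * x) * g x) + (- s * exp (- s * x)) * P x)
       + (exp (s * x) * (- (exp (- s * x) * g x)) + (s * exp (s * x)) * Q x))) (at x)" for x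
    by (intro has_vector_derivative_mult_right has_vector_derivative_add has_vector_derivative_mult E P Q)
  then show "(green s g has_vector_derivative green_deriv s g x) (at x)"
    unfolding green[abs_def] green_deriv alg1 .
  have "((\<lambda>x. 1 / 2 * (- exp (- s * x) * P x + exp (s * x) * Q x)) has_vector_derivative
     1 / 2 * ((- exp (- s * x) * (exp (s * x) * g x) + (- (- s * exp (- s * x))) * P x)
       + (exp (s * x) * (- (exp (- s * x) * g x)) + (s * exp (s * x)) * Q x))) (at x)" for x
    by (intro has_vector_derivative_mult_right has_vector_derivative_add has_vector_derivative_mult has_vector_derivative_minus E P Q)
  then show "(green_deriv s g has_vector_derivative s\<^sup>2 * green s g x - g x) (at x)"
    unfolding green_deriv[abs_def] green alg2[OF exp_inv] .
qed

lemma green_bounds: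
  assumes "Re s \<ge> 0"
  shows "cmod (green s g x) \<le> (LINT y|lborel. cmod (g y)) / (2 * cmod s)"
    and "cmod (green_deriv s g x) \<le> (LINT y|lborel. cmod (g y)) / 2"
proof -
  have gi: "integrable lborel (\<lambda>y. cmod (g y))"
    using integrable_compact_support[OF g supp] by simp
  have e: "cmod (exp (- s * of_real \<bar>x - y\<bar>)) \<le> 1" for y using assms by simp
  have "cmod (green s g x) \<le> (LINT y|lborel. cmod (g y) / (2 * cmod s))"
    unfolding green_def
  proof (rule Bochner_Integration.integral_norm_bound_integral[OF green_integrable(1)])
    show "cmod (exp (- s * of_real \<bar>x - y\<bar>) / (2 * s) * g y) \<le> cmod (g y) / (2 * cmod s)" for y
      using mult_right_mono[OF e, of "cmod (g y) / (2 * cmod s)" y] by (simp add: norm_mult norm_divide)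
  qed (use gi in simp)
  then show "cmod (green s g x) \<le> (LINT y|lborel. cmod (g y)) / (2 * cmod s)" by simp
  have "cmod (green_deriv s g x) \<le> (LINT y|lborel. cmod (g y) / 2)"
    unfolding green_deriv_def
  proof (rule Bochner_Integration.integral_norm_bound_integral[OF green_integrable(2)])
    show "cmod ((if y \<le> x then -1 else 1) / 2 * exp (- s * of_real \<bar>x - y\<bar>) * g y) \<le> cmod (g y) / 2" for y
      using mult_right_mono[OF e, of "cmod (g y) / 2" y] by (cases "y \<le> x") (simp_all add: norm_mult norm_divide)
  qed (use gi in simp)
  then show "cmod (green_deriv s g x) \<le> (LINT y|lborel. cmod (g y)) / 2" by simp
qed

end

lemma green_measurable [measurable]:
  assumes [measurable]: "g \<in> borel_measurable borel" "f \<in> borel_measurable M" "h \<in> borel_measurable M"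
  shows "(\<lambda>z. green (f z) g (h z)) \<in> borel_measurable M"
    and "(\<lambda>z. green_deriv (f z) g (h z)) \<in> borel_measurable M"
  unfolding green_def green_deriv_def by measurable

section \<open>Fourier inversion for intervals\<close>

lemma (in pair_sigma_finite) integrable_product:
  fixes f g :: "_ \<Rightarrow> real"
  assumes "integrable M1 f" "integrable M2 g"
  shows "integrable (M1 \<Otimes>\<^sub>M M2) (\<lambda>(x, y). f x * g y)"
proof (rule integrableI_bounded)
  have [measurable]: "f \<in> borel_measurable M1" "g \<in> borel_measurable M2" using assms by auto
  show "(\<lambda>(x, y). f x * g y) \<in> borel_measurable (M1 \<Otimes>\<^sub>M M2)" by measurable
  have "(\<integral>\<^sup>+z. ennreal (norm (case z of (x, y) \<Rightarrow> f x * g y)) \<partial>(M1 \<Otimes>\<^sub>M M2)) =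
      (\<integral>\<^sup>+x. \<integral>\<^sup>+y. ennreal (norm (f x)) * ennreal (norm (g y)) \<partial>M2 \<partial>M1)"
    by (subst M2.nn_integral_fst[symmetric])
      (auto simp: abs_mult ennreal_mult split_beta' intro!: nn_integral_cong)
  also have "\<dots> = (\<integral>\<^sup>+x. ennreal (norm (f x)) \<partial>M1) * (\<integral>\<^sup>+y. ennreal (norm (g y)) \<partial>M2)"
    by (simp add: nn_integral_cmult nn_integral_multc)
  also have "\<dots> < \<infinity>"
    using assms by (auto simp: integrable_iff_bounded ennreal_mult_less_top)
  finally show "(\<integral>\<^sup>+z. ennreal (norm (case z of (x, y) \<Rightarrow> f x * g y)) \<partial>(M1 \<Otimes>\<^sub>M M2)) < \<infinity>" .
qed

lemma integrable_exp_abs: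
  fixes \<epsilon> :: real
  assumes "\<epsilon> > 0"
  shows "integrable lborel (\<lambda>\<xi>. exp (- \<epsilon> * \<bar>\<xi>\<bar>))"
proof (rule integrableI_nonneg)
  have "(\<integral>\<^sup>+\<xi>. ennreal (exp (- \<epsilon> * \<bar>\<xi> - 0\<bar>)) \<partial>lborel) \<le>
      2 * (\<integral>\<^sup>+x. ennreal (exp (- \<epsilon> * x)) * indicator {0..} x \<partial>lborel)"
    by (rule nn_integral_even) measurable
  also have "(\<integral>\<^sup>+x. ennreal (exp (- \<epsilon> * x)) * indicator {0..} x \<partial>lborel) =
      ennreal (0 - (- exp (- \<epsilon> * 0) / \<epsilon>))"
  proof (rule nn_integral_FTC_atLeast)
    show "DERIV (\<lambda>x. - exp (- \<epsilon> * x) / \<epsilon>) x :> exp (- \<epsilon> * x)" for x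
      using assms by (auto intro!: derivative_eq_intros)
    show "((\<lambda>x. - exp (- \<epsilon> * x) / \<epsilon>) \<longlongrightarrow> 0) at_top" using assms by real_asymp
  qed auto
  also have "2 * \<dots> < \<infinity>" by (simp add: ennreal_mult_less_top)
  finally show "(\<integral>\<^sup>+\<xi>. ennreal (exp (- \<epsilon> * \<bar>\<xi>\<bar>)) \<partial>lborel) < \<infinity>" by simp
qed auto

text \<open>
  A limit of integrals over bounded intervals, by dominated convergence.
\<close>

lemma has_bochner_integral_exp_half_line:
  fixes z :: complex
  assumes "Re z > 0"
  shows "has_bochner_integral lborel (\<lambda>\<xi>::real. indicator {0..} \<xi> *\<^sub>R exp (- z * of_real \<xi>)) (1 / z)"
proof -
  let ?f = "\<lambda>\<xi>. indicator {0..} \<xi> *\<^sub>R exp (- z * of_real \<xi>)"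
  let ?f' = "\<lambda>n \<xi>. indicator {0..real n} \<xi> *\<^sub>R exp (- z * of_real \<xi>)"
  have z0: "z \<noteq> 0" using assms by auto
  have lim: "(\<lambda>n. ?f' n \<xi>) \<longlonglongrightarrow> ?f \<xi>" for \<xi>
  proof (rule tendsto_eventually)
    show "\<forall>\<^sub>F n in sequentially. ?f' n \<xi> = ?f \<xi>"
      using eventually_ge_at_top[of "nat \<lceil>\<xi>\<rceil>"]
      by eventually_elim (auto simp: indicator_def le_nat_iff ceiling_le_iff nat_le_iff)
  qed
  have bound: "norm (?f' n \<xi>) \<le> exp (- Re z * \<bar>\<xi>\<bar>)" for n \<xi>
    by (auto simp: indicator_def abs_if)
  note DC = lim bound integrable_exp_abs[OF assms]
  have int: "integrable lborel ?f"
    by (rule integrable_dominated_convergence[OF _ _ DC(3), of _ ?f']) (use DC in auto)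
  have "(\<lambda>n. integral\<^sup>L lborel (?f' n)) \<longlonglongrightarrow> integral\<^sup>L lborel ?f"
    by (rule integral_dominated_convergence[OF _ _ DC(3)]) (use DC in auto)
  moreover have "integral\<^sup>L lborel (?f' n) = - exp (- z * of_real (real n)) / z - (- exp (- z * of_real 0) / z)" for n
  proof (rule integral_FTC_atLeastAtMost)
    fix x :: real
    have "((\<lambda>x. - exp (- z * of_real x) / z) has_vector_derivative exp (- z * of_real x)) (at x)"
      by (rule has_vector_derivative_real_field) (use z0 in \<open>auto intro!: derivative_eq_intros\<close>)
    then show "((\<lambda>x. - exp (- z * of_real x) / z) has_vector_derivative exp (- z * of_real x)) (at x within {0..real n})"
      by (rule has_vector_derivative_at_within)
  qed (auto intro!: continuous_intros)
  moreover have "(\<lambda>n. - exp (- z * of_real (real n)) / z - (- exp (- z * of_real 0) / z)) \<longlonglongrightarrow> 1 / z"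
  proof -
    have "(\<lambda>n. exp (- z * of_real (real n))) \<longlonglongrightarrow> 0"
    proof (rule tendsto_norm_zero_cancel)
      show "(\<lambda>n. norm (exp (- z * of_real (real n)))) \<longlonglongrightarrow> 0" using assms unfolding norm_exp_eq_Re by simp real_asymp
    qed
    then have "(\<lambda>n. - exp (- z * of_real (real n)) / z - (- exp (- z * of_real 0) / z)) \<longlonglongrightarrow> - 0 / z - (- exp (- z * of_real 0) / z)"
      by (intro tendsto_intros) (use z0 in auto)
    then show ?thesis by simp
  qed
  ultimately have "integral\<^sup>L lborel ?f = 1 / z" using LIMSEQ_unique by auto
  with int show ?thesis by (simp add: has_bochner_integral_iff)
qed

lemma poisson_kernel:
  fixes \<epsilon> x :: real
  assumes "\<epsilon> > 0"
  shows "(LINT \<xi>|lborel. exp (- \<epsilon> * \<bar>\<xi>\<bar>) * exp (\<i> * \<xi> * x)) = of_real (2 * \<epsilon> / (\<epsilon>\<^sup>2 + x\<^sup>2))"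
proof -
  define f where "f z \<xi> = indicator {0..} \<xi> *\<^sub>R exp (- z * of_real \<xi>)" for z :: complex and \<xi> :: real
  define z where "z = \<epsilon> - \<i> * x"
  define w where "w = \<epsilon> + \<i> * x"
  have re: "Re z > 0" "Re w > 0" using assms by (auto simp: z_def w_def)
  have 1: "has_bochner_integral lborel (f z) (1 / z)"
    unfolding f_def by (rule has_bochner_integral_exp_half_line) fact
  have "has_bochner_integral lborel (f w) (1 / w)"
    unfolding f_def by (rule has_bochner_integral_exp_half_line) fact
  then have 2: "has_bochner_integral lborel (\<lambda>\<xi>. f w (- \<xi>)) (1 / w)"
    using lborel_has_bochner_integral_real_affine_iff[of "-1" "f w" "1 / w" 0] by simp
  have "has_bochner_integral lborel (\<lambda>\<xi>. f z \<xi> + f w (- \<xi>)) (1 / z + 1 / w)"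
    by (rule has_bochner_integral_add[OF 1 2])
  then have "(LINT \<xi>|lborel. f z \<xi> + f w (- \<xi>)) = 1 / z + 1 / w"
    by (rule has_bochner_integral_integral_eq)
  moreover have "(LINT \<xi>|lborel. exp (- \<epsilon> * \<bar>\<xi>\<bar>) * exp (\<i> * \<xi> * x)) = (LINT \<xi>|lborel. f z \<xi> + f w (- \<xi>))"
  proof (rule integral_cong_AE)
    show "AE \<xi> in lborel. exp (- \<epsilon> * \<bar>\<xi>\<bar>) * exp (\<i> * \<xi> * x) = f z \<xi> + f w (- \<xi>)"
      by (rule AE_mp[OF AE_lborel_singleton[of 0]], rule AE_I2)
        (auto simp: f_def z_def w_def indicator_def exp_of_real[symmetric] mult_exp_exp algebra_simps abs_if)
  qed (auto simp: f_def)
  moreover have "1 / z + 1 / w = of_real (2 * \<epsilon> / (\<epsilon>\<^sup>2 + x\<^sup>2))"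
  proof -
    have "z \<noteq> 0" "w \<noteq> 0" using re by auto
    then have "1 / z + 1 / w = (z + w) / (z * w)" by (simp add: field_simps)
    also have "z + w = of_real (2 * \<epsilon>)" by (simp add: z_def w_def)
    also have "z * w = of_real (\<epsilon>\<^sup>2 + x\<^sup>2)"
      by (simp add: z_def w_def algebra_simps power2_eq_square)
    finally show ?thesis by simp
  qed
  ultimately show ?thesis by simp
qed

text \<open>
  The Fourier transform of the indicator of an interval.
\<close>

definition interval_transform :: "real \<Rightarrow> real \<Rightarrow> real \<Rightarrow> complex" where
  "interval_transform a b \<xi> = (LINT x|lborel. indicator {a..b} x *\<^sub>R exp (- \<i> * \<xi> * x))"

lemma interval_transform_measurable [measurable]: "interval_transform a b \<in> borel_measurable borel"
  unfolding interval_transform_def by measurable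

lemma interval_transform_bound:
  assumes "a \<le> b"
  shows "cmod (interval_transform a b \<xi>) \<le> b - a"
proof -
  have "cmod (interval_transform a b \<xi>) \<le> (LINT x|lborel. indicator {a..b} x)"
    unfolding interval_transform_def
  proof (rule Bochner_Integration.integral_norm_bound_integral)
    show "integrable lborel (\<lambda>x. indicator {a..b} x *\<^sub>R exp (- \<i> * \<xi> * x))"
      by (rule borel_integrable_atLeastAtMost'[unfolded set_integrable_def]) (intro continuous_intros)
    show "integrable lborel (\<lambda>x. indicator {a..b} x :: real)" by (rule integrable_real_indicator) (auto simp: emeasure_lborel_Icc_eq)
  qed (auto simp: indicator_def)
  then show ?thesis using assms by simp
qed

text \<open>
  The factor \<open>e\<^sup>-\<^sup>\<epsilon>\<^sup>|\<^sup>\<xi>\<^sup>|\<close> makes the inversion integral absolutely convergent, so that Fubini's theorem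
  turns it into the convolution of the indicator with the Poisson kernel.
\<close>

lemma interval_transform_inversion:
  fixes a b \<epsilon> x :: real
  assumes "a \<le> b" "\<epsilon> > 0"
  shows "(LINT \<xi>|lborel. exp (- \<epsilon> * \<bar>\<xi>\<bar>) * interval_transform a b \<xi> * exp (\<i> * \<xi> * x)) =
    of_real (2 * (arctan ((x - a) / \<epsilon>) - arctan ((x - b) / \<epsilon>)))"
proof -
  let ?F = "\<lambda>\<xi> y. complex_of_real (indicator {a..b} y) * (exp (- \<epsilon> * \<bar>\<xi>\<bar>) * exp (\<i> * \<xi> * of_real (x - y)))"
  have int: "integrable (lborel \<Otimes>\<^sub>M lborel) (\<lambda>(\<xi>, y). ?F \<xi> y)"
  proof (rule Bochner_Integration.integrable_bound)
    show "integrable (lborel \<Otimes>\<^sub>M lborel) (\<lambda>(\<xi>, y). exp (- \<epsilon> * \<bar>\<xi>\<bar>) * indicator {a..b} y)"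
      using integrable_exp_abs[OF assms(2)] assms(1)
      by (intro lborel_pair.integrable_product) auto
  qed (auto simp: indicator_def norm_mult)
  have "(LINT \<xi>|lborel. exp (- \<epsilon> * \<bar>\<xi>\<bar>) * interval_transform a b \<xi> * exp (\<i> * \<xi> * x)) =
     (LINT \<xi>|lborel. LINT y|lborel. ?F \<xi> y)"
    unfolding interval_transform_def
    by (intro Bochner_Integration.integral_cong refl)
      (simp add: integral_mult_right_zero[symmetric] mult_exp_exp algebra_simps scaleR_conv_of_real del: integral_mult_right_zero integral_mult_left_zero)
  also have "\<dots> = (LINT y|lborel. LINT \<xi>|lborel. ?F \<xi> y)"
    by (rule lborel_pair.Fubini_integral[OF int, symmetric])
  also have "\<dots> = (LINT y|lborel. complex_of_real (indicator {a..b} y *\<^sub>R (2 * \<epsilon> / (\<epsilon>\<^sup>2 + (x - y)\<^sup>2))))"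
    by (intro Bochner_Integration.integral_cong refl)
      (simp only: integral_mult_right_zero poisson_kernel[OF assms(2)], simp)
  also have "\<dots> = of_real (LINT y|lborel. indicator {a..b} y *\<^sub>R (2 * \<epsilon> / (\<epsilon>\<^sup>2 + (x - y)\<^sup>2)))"
    by (rule integral_complex_of_real)
  also have "(LINT y|lborel. indicator {a..b} y *\<^sub>R (2 * \<epsilon> / (\<epsilon>\<^sup>2 + (x - y)\<^sup>2))) =
     - 2 * arctan ((x - b) / \<epsilon>) - (- 2 * arctan ((x - a) / \<epsilon>))"
  proof (rule integral_FTC_atLeastAtMost[OF assms(1)])
    fix y
    have "((\<lambda>y. - 2 * arctan ((x - y) / \<epsilon>)) has_real_derivative 2 * \<epsilon> / (\<epsilon>\<^sup>2 + (x - y)\<^sup>2)) (at y)"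
      using assms(2) by (auto intro!: derivative_eq_intros simp: power_divide inverse_eq_divide add_divide_eq_iff divide_simps power2_eq_square)
    then show "((\<lambda>y. - 2 * arctan ((x - y) / \<epsilon>)) has_vector_derivative 2 * \<epsilon> / (\<epsilon>\<^sup>2 + (x - y)\<^sup>2)) (at y within {a..b})"
      by (simp add: has_real_derivative_iff_has_vector_derivative has_vector_derivative_at_within)
  next
    show "continuous_on {a..b} (\<lambda>y. 2 * \<epsilon> / (\<epsilon>\<^sup>2 + (x - y)\<^sup>2))"
      using assms(2) by (auto intro!: continuous_intros simp: add_pos_nonneg pos_add_strict less_imp_neq[symmetric] sum_power2_eq_zero_iff)
  qed
  finally show ?thesis by (simp add: algebra_simps)
qed

section \<open>Testing with truncated plane waves\<close>

definition square :: "real \<Rightarrow> (real^2) set" where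
  "square r = cbox (vector [-r, -r]) (vector [r, r])"

lemma mem_square: "x \<in> square r \<longleftrightarrow> \<bar>x $ 1\<bar> \<le> r \<and> \<bar>x $ 2\<bar> \<le> r"
  by (auto simp: square_def mem_box_cart forall_2)

lemma square_measurable [measurable]: "square r \<in> sets borel" "square r \<in> sets lebesgue"
  by (simp_all add: square_def)

lemma measure_square: "r \<ge> 0 \<Longrightarrow> measure lebesgue (square r) = 4 * r\<^sup>2"
proof -
  assume "r \<ge> 0"
  then have "0 \<in> square r" by (simp add: mem_square)
  then have "cbox (vector [-r, -r]) (vector [r, r]) \<noteq> ({} :: (real^2) set)" by (auto simp: square_def)
  then show ?thesis unfolding square_def
    by (simp add: content_cbox_cart UNIV_2 power2_eq_square)
qed

lemma integrable_indicator_square: "integrable lebesgue (indicator (square r) :: real^2 \<Rightarrow> real)"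
  unfolding square_def using lmeasurable_cbox
  by (intro integrable_real_indicator) (auto simp: fmeasurable_def)

lemma L2_square_integrable:
  fixes p :: "real^2 \<Rightarrow> complex"
  assumes "p \<in> L2"
  shows "integrable lebesgue (\<lambda>x. indicator (square r) x * cmod (p x))"
proof (rule Bochner_Integration.integrable_bound)
  have [measurable]: "p \<in> borel_measurable lebesgue" using assms by (simp add: L2_def)
  show "integrable lebesgue (\<lambda>x. indicator (square r) x + (cmod (p x))\<^sup>2)"
    using assms by (intro Bochner_Integration.integrable_add integrable_indicator_square) (simp add: L2_def)
  show "(\<lambda>x. indicator (square r) x * cmod (p x)) \<in> borel_measurable lebesgue" by measurable
  have "cmod (p x) \<le> 1 + (cmod (p x))\<^sup>2" for x
  proof -
    have "2 * cmod (p x) \<le> 1 + (cmod (p x))\<^sup>2"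
      using zero_le_power2[of "cmod (p x) - 1"] by (simp add: power2_eq_square algebra_simps)
    then show ?thesis using norm_ge_zero[of "p x"] by linarith
  qed
  then show "AE x in lebesgue. norm (indicator (square r) x * cmod (p x)) \<le> norm (indicator (square r) x + (cmod (p x))\<^sup>2)"
    by (intro AE_I2) (auto simp: indicator_def)
qed

lemma L2_locally_integrable:
  fixes p :: "real^2 \<Rightarrow> complex"
  assumes "p \<in> L2"
  shows "locally_integrable p"
  unfolding locally_integrable_def
proof (intro allI impI)
  fix K :: "(real^2) set" assume K: "compact K"
  have [measurable]: "p \<in> borel_measurable lebesgue" using assms by (simp add: L2_def)
  have [measurable]: "K \<in> sets lebesgue" using K by (simp add: compact_imp_closed)
  have "bounded K" using K by (rule compact_imp_bounded)
  then obtain r where r: "\<And>x. x \<in> K \<Longrightarrow> norm x \<le> r" unfolding bounded_iff by blast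
  have sub: "K \<subseteq> square r"
    by (auto simp: mem_square intro: order_trans[OF component_le_norm_cart r])
  show "set_integrable lebesgue K p" unfolding set_integrable_def
  proof (rule Bochner_Integration.integrable_bound[OF L2_square_integrable[OF assms, of r]])
    show "AE x in lebesgue. norm (indicator K x *\<^sub>R p x) \<le> norm (indicator (square r) x * cmod (p x))"
    proof (rule AE_I2)
      fix x
      show "norm (indicator K x *\<^sub>R p x) \<le> norm (indicator (square r) x * cmod (p x))"
        using sub by (cases "x \<in> K") (auto simp: subset_iff)
    qed
  qed measurable
qed

text \<open>
  The square has side length of order \<open>n\<close>, so the Cauchy-Schwarz inequality shows only that the
  quotient is bounded. But \<open>|p| / n\<close> exceeds \<open>h / n\<^sup>2\<close> by at most \<open>|p|\<^sup>2 / (4h)\<close>, an integrable bound, and the excess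
  tends to zero pointwise; the part below \<open>h / n\<^sup>2\<close> contributes at most \<open>36 h\<close>.
\<close>

lemma L2_mass_decay:
  fixes p :: "real^2 \<Rightarrow> complex"
  assumes "p \<in> L2"
  shows "(\<lambda>n. (LINT x|lebesgue. indicator (square (3 * real n)) x * cmod (p x)) / real n) \<longlonglongrightarrow> 0"
proof (rule LIMSEQ_I)
  fix e :: real assume "e > 0"
  \<comment> \<open>The two contributions add up to \<open>37 h = e / 2\<close>.\<close>
  define h where "h = e / 74"
  have h: "h > 0" using \<open>e > 0\<close> by (simp add: h_def)
  have [measurable]: "p \<in> borel_measurable lebesgue" using assms by (simp add: L2_def)
  have p2: "integrable lebesgue (\<lambda>x. (cmod (p x))\<^sup>2)" using assms by (simp add: L2_def)
  let ?g = "\<lambda>n x. max 0 (cmod (p x) / real n - h / (real n)\<^sup>2)"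
  have AG: "?g n x \<le> (cmod (p x))\<^sup>2 / (4 * h)" for n x
  proof (cases "n = 0")
    case False
    have "0 \<le> (cmod (p x) - 2 * h / real n)\<^sup>2" by simp
    then have "4 * h * (cmod (p x) / real n) \<le> (cmod (p x))\<^sup>2 + 4 * h * (h / (real n)\<^sup>2)"
      using False by (simp add: power2_diff power_divide power2_eq_square field_simps)
    then show ?thesis using h by (simp add: field_simps)
  qed (use h in auto)
  have "(\<lambda>n. LINT x|lebesgue. ?g n x) \<longlonglongrightarrow> (LINT x::real^2|lebesgue. 0 :: real)"
  proof (rule integral_dominated_convergence)
    show "integrable lebesgue (\<lambda>x. (cmod (p x))\<^sup>2 / (4 * h))" using p2 by simp
    show "AE x in lebesgue. (\<lambda>n. ?g n x) \<longlonglongrightarrow> 0"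
    proof (rule AE_I2)
      fix x
      have "(\<lambda>n. max 0 (cmod (p x) / real n - h / (real n)\<^sup>2)) \<longlonglongrightarrow> max 0 (0 - 0)"
        by (intro tendsto_max tendsto_diff tendsto_const) real_asymp+
      then show "(\<lambda>n. ?g n x) \<longlonglongrightarrow> 0" by simp
    qed
  qed (use AG in auto)
  then have "\<forall>\<^sub>F n in sequentially. (LINT x|lebesgue. ?g n x) < h"
    using h by (intro order_tendstoD) auto
  moreover have "\<forall>\<^sub>F n in sequentially. n > (0::nat)" by (rule eventually_gt_at_top)
  ultimately have "\<forall>\<^sub>F n in sequentially. norm ((LINT x|lebesgue. indicator (square (3 * real n)) x * cmod (p x)) / real n - 0) < e"
  proof eventually_elim
    case (elim n)
    have ig: "integrable lebesgue (?g n)"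
      by (rule Bochner_Integration.integrable_bound[of _ "\<lambda>x. (cmod (p x))\<^sup>2 / (4 * h)"]) (use p2 AG h in auto)
    have iq: "integrable lebesgue (\<lambda>x. h / (real n)\<^sup>2 * indicator (square (3 * real n)) x)"
      by (intro integrable_mult_right integrable_indicator_square)
    have "(LINT x|lebesgue. indicator (square (3 * real n)) x * cmod (p x)) / real n =
       (LINT x|lebesgue. indicator (square (3 * real n)) x * cmod (p x) / real n)" by simp
    also have "\<dots> \<le> (LINT x|lebesgue. ?g n x + h / (real n)\<^sup>2 * indicator (square (3 * real n)) x)"
      by (rule integral_mono[OF integrable_divide_zero[OF L2_square_integrable[OF assms]] Bochner_Integration.integrable_add[OF ig iq]])
        (auto simp: indicator_def)
    also have "\<dots> = (LINT x|lebesgue. ?g n x) + h / (real n)\<^sup>2 * measure lebesgue (square (3 * real n))"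
      using ig iq by simp
    also have "h / (real n)\<^sup>2 * measure lebesgue (square (3 * real n)) = h * 36"
      using elim measure_square[of "3 * real n"] by (simp add: power2_eq_square)
    also have "(LINT x|lebesgue. ?g n x) + h * 36 \<le> h + h * 36"
      using elim by simp
    also have "\<dots> < e" using \<open>e > 0\<close> by (simp add: h_def)
    finally have "(LINT x|lebesgue. indicator (square (3 * real n)) x * cmod (p x)) / real n < e" .
    moreover have "0 \<le> (LINT x|lebesgue. indicator (square (3 * real n)) x * cmod (p x)) / real n" by simp
    ultimately show ?case by simp
  qed
  then show "\<exists>no. \<forall>n\<ge>no. norm ((LINT x|lebesgue. indicator (square (3 * real n)) x * cmod (p x)) / real n - 0) < e"
    by (simp add: eventually_sequentially)
qed

text \<open>
  The equation \<open>\<kappa> p + L\<^sub>d q = - F\<close> in the sense of distributions, tested with products. Passing the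
  derivatives of the factors as arguments avoids a derivative operator.
\<close>

definition weak_system :: "complex \<Rightarrow> complex \<Rightarrow> (real^2 \<Rightarrow> complex) \<Rightarrow> (real^2 \<Rightarrow> complex) \<Rightarrow> (real^2 \<Rightarrow> complex) \<Rightarrow> bool"
  where "weak_system d \<kappa> p q F \<longleftrightarrow> (\<forall>a a1 a2 b b1 b2 r.
    smooth a \<longrightarrow> smooth b \<longrightarrow>
    (\<forall>t. (a has_vector_derivative a1 t) (at t)) \<longrightarrow> (\<forall>t. (a1 has_vector_derivative a2 t) (at t)) \<longrightarrow>
    (\<forall>t. (b has_vector_derivative b1 t) (at t)) \<longrightarrow> (\<forall>t. (b1 has_vector_derivative b2 t) (at t)) \<longrightarrow>
    (\<forall>t. \<bar>t\<bar> > r \<longrightarrow> a t = 0 \<and> b t = 0) \<longrightarrow>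
    (LINT x|lebesgue. \<kappa> * p x * tensor a b x + q x * (tensor a2 b x + 2 * \<i> * d * tensor a1 b1 x - tensor a b2 x)) =
    - (LINT x|lebesgue. F x * tensor a b x))"

text \<open>
  The left-hand side is \<open>L\<^sub>d\<close> applied to a plane wave with cutoffs \<open>X\<close> and \<open>Y\<close>, minus the same cutoffs
  times \<open>L\<^sub>d\<close> applied to the plane wave. In every remaining term a derivative falls on a cutoff.
\<close>

lemma commutator_algebra:
  fixes X X1 X2 Y Y1 Y2 e \<xi> d h h1 h2 :: complex
  shows "((X2 + 2 * \<i> * \<xi> * X1 - \<xi>\<^sup>2 * X) * e) * (Y * h) + 2 * \<i> * d * (((X1 + \<i> * \<xi> * X) * e) * (Y1 * h + Y * h1))
     - (X * e) * (Y2 * h + 2 * Y1 * h1 + Y * h2) - (X * e) * (Y * (- \<xi>\<^sup>2 * h - 2 * d * \<xi> * h1 - h2)) =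
    e * ((X2 + 2 * \<i> * \<xi> * X1) * Y * h + 2 * \<i> * d * (X1 * Y1 * h + X1 * Y * h1 + \<i> * \<xi> * X * Y1 * h)
      - X * Y2 * h - 2 * X * Y1 * h1)"
proof -
  have "\<i> * (\<i> * z) = - z" for z :: complex by (simp add: mult.assoc[symmetric])
  then show ?thesis by (simp add: algebra_simps power2_eq_square)
qed

lemma commutator_bound:
  fixes X X1 X2 Y Y1 Y2 e d h h1 h2 :: complex and \<xi> m M B :: real
  assumes "cmod X \<le> 1" "cmod Y \<le> 1" "cmod X1 \<le> m" "cmod Y1 \<le> m" "cmod X2 \<le> m" "cmod Y2 \<le> m" "m \<le> M"
    "cmod e = 1" "cmod d = 1" "cmod h \<le> B" "cmod h1 \<le> B"
  shows "cmod (e * ((X2 + 2 * \<i> * \<xi> * X1) * Y * h + 2 * \<i> * d * (X1 * Y1 * h + X1 * Y * h1 + \<i> * \<xi> * X * Y1 * h)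
      - X * Y2 * h - 2 * X * Y1 * h1)) \<le> m * (6 + 4 * \<bar>\<xi>\<bar> + 2 * M) * B"
proof -
  have m: "0 \<le> m" using assms(3) norm_ge_zero order_trans by blast
  have B: "0 \<le> B" using assms(10) norm_ge_zero order_trans by blast
  have prod: "cmod (x * y * z) \<le> k * l * B" if "cmod x \<le> k" "cmod y \<le> l" "cmod z \<le> B" "0 \<le> k" "0 \<le> l" for x y z k l
    unfolding norm_mult using that B by (intro mult_mono) auto
  have 1: "cmod (X2 * Y * h) \<le> m * 1 * B" by (rule prod) (use assms m in auto)
  have 2: "cmod (X1 * Y * h) \<le> m * 1 * B" by (rule prod) (use assms m in auto)
  have 3: "cmod (X1 * Y1 * h) \<le> m * M * B" by (rule prod) (use assms m in auto)
  have 4: "cmod (X1 * Y * h1) \<le> m * 1 * B" by (rule prod) (use assms m in auto)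
  have 5: "cmod (X * Y1 * h) \<le> 1 * m * B" by (rule prod) (use assms m in auto)
  have 6: "cmod (X * Y2 * h) \<le> 1 * m * B" by (rule prod) (use assms m in auto)
  have 7: "cmod (X * Y1 * h1) \<le> 1 * m * B" by (rule prod) (use assms m in auto)
  have "cmod (e * ((X2 + 2 * \<i> * \<xi> * X1) * Y * h + 2 * \<i> * d * (X1 * Y1 * h + X1 * Y * h1 + \<i> * \<xi> * X * Y1 * h)
      - X * Y2 * h - 2 * X * Y1 * h1)) =
    cmod (X2 * Y * h + 2 * \<i> * \<xi> * (X1 * Y * h) + (2 * \<i> * d * (X1 * Y1 * h) + 2 * \<i> * d * (X1 * Y * h1) + 2 * \<i> * d * (\<i> * \<xi> * (X * Y1 * h)))
      - X * Y2 * h - 2 * (X * Y1 * h1))"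
    using assms(8) by (simp add: norm_mult) (simp add: algebra_simps)
  also have "\<dots> \<le> cmod (X2 * Y * h) + cmod (2 * \<i> * \<xi> * (X1 * Y * h)) + (cmod (2 * \<i> * d * (X1 * Y1 * h)) + cmod (2 * \<i> * d * (X1 * Y * h1)) + cmod (2 * \<i> * d * (\<i> * \<xi> * (X * Y1 * h))))
     + cmod (X * Y2 * h) + cmod (2 * (X * Y1 * h1))"
    by (intro order_trans[OF norm_triangle_ineq4] order_trans[OF norm_triangle_ineq] add_mono order_refl)
  also have "\<dots> = cmod (X2 * Y * h) + 2 * \<bar>\<xi>\<bar> * cmod (X1 * Y * h) + (2 * cmod (X1 * Y1 * h) + 2 * cmod (X1 * Y * h1) + 2 * \<bar>\<xi>\<bar> * cmod (X * Y1 * h))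
     + cmod (X * Y2 * h) + 2 * cmod (X * Y1 * h1)"
    using assms(9) by (simp add: norm_mult)
  also have "\<dots> \<le> m * 1 * B + 2 * \<bar>\<xi>\<bar> * (m * 1 * B) + (2 * (m * M * B) + 2 * (m * 1 * B) + 2 * \<bar>\<xi>\<bar> * (1 * m * B)) + 1 * m * B + 2 * (1 * m * B)"
    using 1 2 3 4 5 6 7 by (intro add_mono mult_left_mono) auto
  also have "\<dots> = m * (6 + 4 * \<bar>\<xi>\<bar> + 2 * M) * B" by (simp add: algebra_simps)
  finally show ?thesis .
qed

lemma test_function_tensor_integrable:
  assumes "p \<in> L2 \<or> integrable lebesgue p" "smooth a" "smooth b" "\<And>t. \<bar>t\<bar> > r \<Longrightarrow> a t = 0" "\<And>t. \<bar>t\<bar> > r \<Longrightarrow> b t = 0"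
  shows "integrable lebesgue (\<lambda>x. p x * tensor a b x)"
proof -
  have "locally_integrable p"
  proof (cases "p \<in> L2")
    case False
    with assms(1) have p: "integrable lebesgue p" by simp
    show ?thesis unfolding locally_integrable_def set_integrable_def
      by (intro allI impI integrable_mult_indicator p) (simp add: compact_imp_closed)
  qed (rule L2_locally_integrable)
  then show ?thesis
    by (rule locally_integrable_mult_test_function) (rule test_function_tensor[OF assms(2-5)])
qed

lemma rescaled_derivatives:
  fixes \<zeta> \<zeta>1 \<zeta>2 :: "real \<Rightarrow> complex" and n :: real
  assumes n: "n > 0" and \<zeta>: "\<And>x. (\<zeta> has_vector_derivative \<zeta>1 x) (at x)" "\<And>x. (\<zeta>1 has_vector_derivative \<zeta>2 x) (at x)"
  shows "((\<lambda>t. \<zeta> (t / n)) has_vector_derivative \<zeta>1 (x / n) / n) (at x)"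
    and "((\<lambda>t. \<zeta>1 (t / n) / n) has_vector_derivative \<zeta>2 (x / n) / n\<^sup>2) (at x)"
proof -
  have lin: "((\<lambda>t. t / n) has_vector_derivative 1 / n) (at x)" for x
    using n by (auto intro!: derivative_eq_intros)
  have "((\<zeta> \<circ> (\<lambda>t. t / n)) has_vector_derivative (1 / n) *\<^sub>R \<zeta>1 (x / n)) (at x)"
    by (rule vector_diff_chain_at[OF lin \<zeta>(1)])
  then show "((\<lambda>t. \<zeta> (t / n)) has_vector_derivative \<zeta>1 (x / n) / n) (at x)"
    by (simp add: o_def scaleR_conv_of_real)
  have "((\<zeta>1 \<circ> (\<lambda>t. t / n)) has_vector_derivative (1 / n) *\<^sub>R \<zeta>2 (x / n)) (at x)"
    by (rule vector_diff_chain_at[OF lin \<zeta>(2)])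
  then have "((\<lambda>t. \<zeta>1 (t / n) * (1 / n)) has_vector_derivative ((1 / n) *\<^sub>R \<zeta>2 (x / n)) * (1 / n)) (at x)"
    unfolding o_def by (rule has_vector_derivative_mult_left)
  then show "((\<lambda>t. \<zeta>1 (t / n) / n) has_vector_derivative \<zeta>2 (x / n) / n\<^sup>2) (at x)"
    by (simp add: scaleR_conv_of_real power2_eq_square)
qed

definition cut_wave :: "(real \<Rightarrow> complex) \<Rightarrow> real \<Rightarrow> real \<Rightarrow> (real \<Rightarrow> complex) \<Rightarrow> real^2 \<Rightarrow> complex" where
  "cut_wave \<zeta> n \<xi> g = tensor (\<lambda>t. \<zeta> (t / n) * exp (\<i> * \<xi> * t)) (\<lambda>t. \<zeta> (t / n) * g t)"

lemma cut_wave_norm_le: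
  assumes "\<And>x. cmod (\<zeta> x) \<le> 1"
  shows "cmod (cut_wave \<zeta> n \<xi> g x) \<le> cmod (g (x $ 2))"
proof -
  have "cmod (cut_wave \<zeta> n \<xi> g x) = (cmod (\<zeta> (x $ 1 / n)) * cmod (\<zeta> (x $ 2 / n))) * cmod (g (x $ 2))"
    by (simp add: cut_wave_def tensor_def norm_mult)
  also have "\<dots> \<le> (1 * 1) * cmod (g (x $ 2))"
    using assms by (intro mult_right_mono mult_mono) auto
  finally show ?thesis by simp
qed

text \<open>
  The functions \<open>h\<close> and \<open>k\<close> are such that \<open>e\<^sup>i\<^sup>\<xi>\<^sup>x\<^sub>1 k = L\<^sub>-\<^sub>c (e\<^sup>i\<^sup>\<xi>\<^sup>x\<^sub>1 h)\<close> and
  \<open>L\<^sub>c (e\<^sup>i\<^sup>\<xi>\<^sup>x\<^sub>1 k) = e\<^sup>i\<^sup>\<xi>\<^sup>x\<^sub>1 (\<mu>\<^sup>2 h + g)\<close>. Test the first equation with \<open>- \<beta> e\<^sup>i\<^sup>\<xi>\<^sup>x\<^sub>1 h\<close> and the second one with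
  \<open>e\<^sup>i\<^sup>\<xi>\<^sup>x\<^sub>1 k\<close>, both truncated at scale \<open>n\<close>, and add: the terms with \<open>q\<close> cancel, and since \<open>\<alpha> \<beta> = \<mu>\<^sup>2\<close> the terms
  with \<open>p\<close> reduce to \<open>p e\<^sup>i\<^sup>\<xi>\<^sup>x\<^sub>1 g\<close>. The last line of the bound collects the derivatives of the cutoffs.
\<close>

theorem cutoff_estimate:
  fixes c \<mu> \<alpha> \<beta> :: complex and \<xi> n M B :: real and h h1 h2 k k1 k2 g :: "real \<Rightarrow> complex"
  assumes sys1: "weak_system (- c) \<alpha> p q F" and sys2: "weak_system c \<beta> q p G"
    and p: "p \<in> L2" and q: "q \<in> L2" and F: "integrable lebesgue F" and G: "integrable lebesgue G"
    and \<mu>: "\<alpha> * \<beta> = \<mu>\<^sup>2" and c: "cmod c = 1"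
    and \<zeta>: "smooth \<zeta>" "\<And>x. (\<zeta> has_vector_derivative \<zeta>1 x) (at x)" "\<And>x. (\<zeta>1 has_vector_derivative \<zeta>2 x) (at x)"
    "\<And>x. cmod (\<zeta> x) \<le> 1" "\<And>x. cmod (\<zeta>1 x) \<le> M" "\<And>x. cmod (\<zeta>2 x) \<le> M" "M \<ge> 1"
    "\<And>x. \<bar>x\<bar> > 3 \<Longrightarrow> \<zeta> x = 0"
    and n: "n \<ge> 1"
    and h: "smooth h" "\<And>x. (h has_vector_derivative h1 x) (at x)" "\<And>x. (h1 has_vector_derivative h2 x) (at x)"
    and k: "smooth k" "\<And>x. (k has_vector_derivative k1 x) (at x)" "\<And>x. (k1 has_vector_derivative k2 x) (at x)"
    and g: "smooth g"
    and k_eq: "\<And>x. k x = - \<xi>\<^sup>2 * h x + 2 * c * \<xi> * h1 x - h2 x"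
    and g_eq: "\<And>x. - \<xi>\<^sup>2 * k x - 2 * c * \<xi> * k1 x - k2 x = \<mu>\<^sup>2 * h x + g x"
    and B: "\<And>x. cmod (h x) \<le> B" "\<And>x. cmod (h1 x) \<le> B" "\<And>x. cmod (k x) \<le> B" "\<And>x. cmod (k1 x) \<le> B"
  defines "mass \<equiv> \<lambda>f. (LINT x|lebesgue. indicator (square (3 * n)) x * cmod (f x))"
  shows "ennreal (cmod (LINT x|lebesgue. p x * cut_wave \<zeta> n \<xi> g x)) \<le>
    ennreal (cmod \<beta>) * (\<integral>\<^sup>+x. ennreal (cmod (F x) * cmod (h (x $ 2))) \<partial>lebesgue)
    + (\<integral>\<^sup>+x. ennreal (cmod (G x) * cmod (k (x $ 2))) \<partial>lebesgue)
    + ennreal (M / n * (6 + 4 * \<bar>\<xi>\<bar> + 2 * M) * B * (mass p + cmod \<beta> * mass q))"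
proof -
  let ?K = "M / n * (6 + 4 * \<bar>\<xi>\<bar> + 2 * M) * B"
  define Z where "Z t = \<zeta> (t / n)" for t
  define Z1 where "Z1 t = \<zeta>1 (t / n) / n" for t
  define Z2 where "Z2 t = \<zeta>2 (t / n) / n\<^sup>2" for t
  define e where "e t = exp (\<i> * \<xi> * t)" for t :: real
  have Zd: "(Z has_vector_derivative Z1 x) (at x)" "(Z1 has_vector_derivative Z2 x) (at x)" for x
    unfolding Z_def Z1_def Z2_def using n rescaled_derivatives[of n, OF _ \<zeta>(2,3)] by simp_all
  have Zs: "smooth Z" unfolding Z_def using smooth_affine[OF \<zeta>(1), of "1 / n" 0] by simp
  have Z1s: "smooth Z1" by (rule smooth_derivative[OF Zs Zd(1)])
  have Z2s: "smooth Z2" by (rule smooth_derivative[OF Z1s Zd(2)])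
  have Zsupp: "Z t = 0" if "\<bar>t\<bar> > 3 * n" for t
  proof -
    have "\<bar>t / n\<bar> > 3" using that n by (simp add: field_simps)
    then show ?thesis unfolding Z_def by (rule \<zeta>(8))
  qed
  have Z1supp: "Z1 t = 0" if "\<bar>t\<bar> > 3 * n" for t
    by (rule derivative_zero_outside[OF Zd(1) Zsupp that])
  have Z2supp: "Z2 t = 0" if "\<bar>t\<bar> > 3 * n" for t
    by (rule derivative_zero_outside[OF Zd(2) Z1supp that])
  have Zb: "cmod (Z t) \<le> 1" "cmod (Z1 t) \<le> M / n" "cmod (Z2 t) \<le> M / n" for t
  proof -
    show "cmod (Z t) \<le> 1" unfolding Z_def by (rule \<zeta>(4))
    show "cmod (Z1 t) \<le> M / n" unfolding Z1_def using \<zeta>(5) n by (simp add: norm_divide divide_right_mono)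
    have "cmod (Z2 t) \<le> M / n\<^sup>2" unfolding Z2_def using \<zeta>(6) n by (simp add: norm_divide norm_power divide_right_mono)
    also have "\<dots> \<le> M / n" using n \<zeta>(7) by (intro divide_left_mono) (auto simp: power2_eq_square)
    finally show "cmod (Z2 t) \<le> M / n" .
  qed
  have ed: "(e has_vector_derivative \<i> * \<xi> * e x) (at x)" for x
    unfolding e_def by (rule has_vector_derivative_real_field) (auto intro!: derivative_eq_intros)
  have es: "smooth e" unfolding e_def by (rule smooth_exp)
  define a where "a t = Z t * e t" for t
  define a1 where "a1 t = (Z1 t + \<i> * \<xi> * Z t) * e t" for t
  define a2 where "a2 t = (Z2 t + 2 * \<i> * \<xi> * Z1 t - \<xi>\<^sup>2 * Z t) * e t" for t
  have ad: "(a has_vector_derivative a1 x) (at x)" "(a1 has_vector_derivative a2 x) (at x)" for x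
  proof -
    have "(a has_vector_derivative Z x * (\<i> * \<xi> * e x) + Z1 x * e x) (at x)"
      unfolding a_def by (intro has_vector_derivative_mult Zd ed)
    then show "(a has_vector_derivative a1 x) (at x)" by (simp add: a1_def algebra_simps)
    have "(a1 has_vector_derivative (Z1 x + \<i> * \<xi> * Z x) * (\<i> * \<xi> * e x) + (Z2 x + \<i> * \<xi> * Z1 x) * e x) (at x)"
      unfolding a1_def by (intro has_vector_derivative_mult has_vector_derivative_add has_vector_derivative_mult_right Zd ed)
    moreover have "(Z1 x + \<i> * \<xi> * Z x) * (\<i> * \<xi> * e x) + (Z2 x + \<i> * \<xi> * Z1 x) * e x = a2 x"
    proof -
      have "\<i> * (\<i> * z) = - z" for z :: complex by (simp add: mult.assoc[symmetric])
      then show ?thesis by (simp add: a2_def algebra_simps power2_eq_square)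
    qed
    ultimately show "(a1 has_vector_derivative a2 x) (at x)" by simp
  qed
  have as: "smooth a" unfolding a_def by (intro smooth_mult Zs es)
  have a1s: "smooth a1" by (rule smooth_derivative[OF as ad(1)])
  have a2s: "smooth a2" by (rule smooth_derivative[OF a1s ad(2)])
  have asupp: "a t = 0" "a1 t = 0" "a2 t = 0" if "\<bar>t\<bar> > 3 * n" for t
    using Zsupp[OF that] Z1supp[OF that] Z2supp[OF that] by (simp_all add: a_def a1_def a2_def)
  define cut where "cut f t = Z t * f t" for f t
  define cut1 where "cut1 f f1 t = Z1 t * f t + Z t * f1 t" for f f1 t
  define cut2 where "cut2 f f1 f2 t = Z2 t * f t + 2 * Z1 t * f1 t + Z t * f2 t" for f f1 f2 t
  have cutd: "(cut f has_vector_derivative cut1 f f1 x) (at x)" "(cut1 f f1 has_vector_derivative cut2 f f1 f2 x) (at x)"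
    if f: "\<And>x. (f has_vector_derivative f1 x) (at x)" "\<And>x. (f1 has_vector_derivative f2 x) (at x)" for f f1 f2 x
  proof -
    have "(cut f has_vector_derivative Z x * f1 x + Z1 x * f x) (at x)"
      unfolding cut_def by (intro has_vector_derivative_mult Zd f)
    then show "(cut f has_vector_derivative cut1 f f1 x) (at x)" by (simp add: cut1_def algebra_simps)
    have "(cut1 f f1 has_vector_derivative (Z1 x * f1 x + Z2 x * f x) + (Z x * f2 x + Z1 x * f1 x)) (at x)"
      unfolding cut1_def by (intro has_vector_derivative_mult has_vector_derivative_add Zd f)
    then show "(cut1 f f1 has_vector_derivative cut2 f f1 f2 x) (at x)" by (simp add: cut2_def algebra_simps)
  qed
  have cuts: "smooth (cut f)" if "smooth f" for f
    unfolding cut_def using that Zs by (intro smooth_mult)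
  have cutsupp: "cut f t = 0" "cut1 f f1 t = 0" "cut2 f f1 f2 t = 0" if "\<bar>t\<bar> > 3 * n" for f f1 f2 t
    using Zsupp[OF that] Z1supp[OF that] Z2supp[OF that] by (simp_all add: cut_def cut1_def cut2_def)
  define L where "L d f f1 f2 x = tensor a2 (cut f) x + 2 * \<i> * d * tensor a1 (cut1 f f1) x - tensor a (cut2 f f1 f2) x"
    for d f f1 f2 x
  have commutator: "cmod (L d f f1 f2 x - tensor a (cut (\<lambda>t. - \<xi>\<^sup>2 * f t - 2 * d * \<xi> * f1 t - f2 t)) x)
     \<le> ?K * indicator (square (3 * n)) x"
    if "cmod d = 1" "\<And>x. cmod (f x) \<le> B" "\<And>x. cmod (f1 x) \<le> B"
    for d :: complex and f f1 f2 :: "real \<Rightarrow> complex" and x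
  proof (cases "x \<in> square (3 * n)")
    case True
    have "M / n \<le> M" using n \<zeta>(7) by (simp add: field_simps)
    then show ?thesis
      unfolding L_def tensor_def a_def a1_def a2_def cut_def cut1_def cut2_def of_real_minus of_real_power commutator_algebra
      using commutator_bound[OF Zb(1) Zb(1) Zb(2) Zb(2) Zb(3) Zb(3), of M "e (x $ 1)" d "f (x $ 2)" B "f1 (x $ 2)"] that True
      by (simp add: e_def)
  next
    case False
    then consider "\<bar>x $ 1\<bar> > 3 * n" | "\<bar>x $ 2\<bar> > 3 * n" by (auto simp: mem_square)
    then have "L d f f1 f2 x = 0" "tensor a (cut (\<lambda>t. - \<xi>\<^sup>2 * f t - 2 * d * \<xi> * f1 t - f2 t)) x = 0"
      by (cases; simp add: L_def tensor_def asupp cutsupp)+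
    with False show ?thesis by simp
  qed
  have int: "integrable lebesgue (\<lambda>x. r x * tensor u v x)"
    if "r \<in> L2 \<or> integrable lebesgue r" "smooth u" "smooth v" "\<And>t. \<bar>t\<bar> > 3 * n \<Longrightarrow> u t = 0" "\<And>t. \<bar>t\<bar> > 3 * n \<Longrightarrow> v t = 0"
    for r u v using that by (rule test_function_tensor_integrable)
  have intL: "integrable lebesgue (\<lambda>x. r x * L d f f1 f2 x)"
    if r: "r \<in> L2" and f: "smooth f" "\<And>x. (f has_vector_derivative f1 x) (at x)" "\<And>x. (f1 has_vector_derivative f2 x) (at x)"
    for r d f f1 f2
  proof -
    have c1: "smooth (cut1 f f1)" by (rule smooth_derivative[OF cuts[OF f(1)] cutd(1)[OF f(2,3)]])
    have c2: "smooth (cut2 f f1 f2)" by (rule smooth_derivative[OF c1 cutd(2)[OF f(2,3)]])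
    have "integrable lebesgue (\<lambda>x. r x * tensor a2 (cut f) x + 2 * \<i> * d * (r x * tensor a1 (cut1 f f1) x) - r x * tensor a (cut2 f f1 f2) x)"
      by (intro Bochner_Integration.integrable_diff Bochner_Integration.integrable_add integrable_mult_right int)
        (use r as a1s a2s cuts[OF f(1)] c1 c2 asupp cutsupp in auto)
    then show ?thesis by (simp add: L_def algebra_simps)
  qed
  have inth: "integrable lebesgue (\<lambda>x. r x * tensor a (cut f) x)" if "r \<in> L2 \<or> integrable lebesgue r" "smooth f" for r f
    by (rule int) (use that as cuts asupp cutsupp in auto)
  have eq1: "(LINT x|lebesgue. \<alpha> * p x * tensor a (cut h) x + q x * L (- c) h h1 h2 x) = - (LINT x|lebesgue. F x * tensor a (cut h) x)"
    using sys1[unfolded weak_system_def, rule_format, OF as cuts[OF h(1)] ad(1) ad(2) cutd(1)[OF h(2,3)] cutd(2)[OF h(2,3)], of "3 * n"]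
      asupp(1) cutsupp(1) unfolding L_def by blast
  have eq2: "(LINT x|lebesgue. \<beta> * q x * tensor a (cut k) x + p x * L c k k1 k2 x) = - (LINT x|lebesgue. G x * tensor a (cut k) x)"
    using sys2[unfolded weak_system_def, rule_format, OF as cuts[OF k(1)] ad(1) ad(2) cutd(1)[OF k(2,3)] cutd(2)[OF k(2,3)], of "3 * n"]
      asupp(1) cutsupp(1) unfolding L_def by blast
  \<comment> \<open>The truncation errors in the two equations.\<close>
  define E1 where "E1 x = L (- c) h h1 h2 x - tensor a (cut k) x" for x
  define E2 where "E2 x = L c k k1 k2 x - tensor a (cut (\<lambda>t. \<mu>\<^sup>2 * h t + g t)) x" for x
  have E1b: "cmod (E1 x) \<le> ?K * indicator (square (3 * n)) x" for x
    using commutator[of "- c" h h1 h2 x] c B unfolding E1_def k_eq[abs_def] by simp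
  have E2b: "cmod (E2 x) \<le> ?K * indicator (square (3 * n)) x" for x
    using commutator[of c k k1 k2 x] c B unfolding E2_def g_eq by simp
  have E1i: "integrable lebesgue (\<lambda>x. q x * E1 x)"
    unfolding E1_def right_diff_distrib using intL[OF q h] inth[of q k] q k(1) by simp
  have smg: "smooth (\<lambda>t. \<mu>\<^sup>2 * h t + g t)" using h(1) g by (intro smooth_add smooth_cmult)
  have E2i: "integrable lebesgue (\<lambda>x. p x * E2 x)"
    unfolding E2_def right_diff_distrib using intL[OF p k] inth[OF _ smg, of p] p by simp
  have ident: "(LINT x|lebesgue. p x * tensor a (cut g) x) =
     \<beta> * (LINT x|lebesgue. F x * tensor a (cut h) x) - (LINT x|lebesgue. G x * tensor a (cut k) x)
     - (LINT x|lebesgue. p x * E2 x) + \<beta> * (LINT x|lebesgue. q x * E1 x)"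
  proof -
    have i1: "integrable lebesgue (\<lambda>x. \<alpha> * p x * tensor a (cut h) x + q x * L (- c) h h1 h2 x)"
      using inth[of p h] p h(1) intL[OF q h] by (simp add: mult.assoc)
    have i2: "integrable lebesgue (\<lambda>x. \<beta> * q x * tensor a (cut k) x + p x * L c k k1 k2 x)"
      using inth[of q k] q k(1) intL[OF p k] by (simp add: mult.assoc)
    have linear: "(LINT x|lebesgue. U1 x - \<beta> * U2 x - U3 x + \<beta> * U4 x) =
        (LINT x|lebesgue. U1 x) - \<beta> * (LINT x|lebesgue. U2 x) - (LINT x|lebesgue. U3 x) + \<beta> * (LINT x|lebesgue. U4 x)"
      if "integrable lebesgue U1" "integrable lebesgue U2" "integrable lebesgue U3" "integrable lebesgue U4"
      for U1 U2 U3 U4 :: "real^2 \<Rightarrow> complex" using that by simp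
    have "p x * tensor a (cut g) x = (\<beta> * q x * tensor a (cut k) x + p x * L c k k1 k2 x)
        - \<beta> * (\<alpha> * p x * tensor a (cut h) x + q x * L (- c) h h1 h2 x) - p x * E2 x + \<beta> * (q x * E1 x)" for x
    proof -
      have "tensor a (cut (\<lambda>t. \<mu>\<^sup>2 * h t + g t)) x = \<alpha> * \<beta> * tensor a (cut h) x + tensor a (cut g) x"
        unfolding \<mu> by (simp add: tensor_def cut_def algebra_simps)
      then show ?thesis unfolding E1_def E2_def by (simp add: algebra_simps)
    qed
    then have "(LINT x|lebesgue. p x * tensor a (cut g) x) =
      (LINT x|lebesgue. (\<beta> * q x * tensor a (cut k) x + p x * L c k k1 k2 x)
        - \<beta> * (\<alpha> * p x * tensor a (cut h) x + q x * L (- c) h h1 h2 x) - p x * E2 x + \<beta> * (q x * E1 x))" by simp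
    also have "\<dots> = (LINT x|lebesgue. \<beta> * q x * tensor a (cut k) x + p x * L c k k1 k2 x)
        - \<beta> * (LINT x|lebesgue. \<alpha> * p x * tensor a (cut h) x + q x * L (- c) h h1 h2 x)
        - (LINT x|lebesgue. p x * E2 x) + \<beta> * (LINT x|lebesgue. q x * E1 x)"
      by (rule linear[OF i2 i1 E2i E1i])
    finally show ?thesis unfolding eq1 eq2 by simp
  qed
  have Eint: "cmod (LINT x|lebesgue. r x * E x) \<le> ?K * mass r"
    if r: "r \<in> L2" and E: "integrable lebesgue (\<lambda>x. r x * E x)"
      "\<And>x. cmod (E x) \<le> ?K * indicator (square (3 * n)) x" for r E
  proof -
    have "cmod (LINT x|lebesgue. r x * E x) \<le> (LINT x|lebesgue. ?K * (indicator (square (3 * n)) x * cmod (r x)))"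
    proof (rule Bochner_Integration.integral_norm_bound_integral[OF E(1)])
      show "integrable lebesgue (\<lambda>x. ?K * (indicator (square (3 * n)) x * cmod (r x)))"
        by (intro integrable_mult_right L2_square_integrable r)
      show "cmod (r x * E x) \<le> ?K * (indicator (square (3 * n)) x * cmod (r x))" for x
        using mult_left_mono[OF E(2), of "cmod (r x)" x] by (simp add: norm_mult mult_ac)
    qed
    also have "\<dots> = ?K * mass r"
      unfolding mass_def by (rule integral_mult_right_zero)
    finally show ?thesis .
  qed
  have cw: "tensor a (cut f) = cut_wave \<zeta> n \<xi> f" for f
    unfolding cut_wave_def by (simp add: a_def[abs_def] cut_def[abs_def] Z_def e_def)
  have src: "ennreal (cmod (LINT x|lebesgue. r x * tensor a (cut f) x)) \<le> (\<integral>\<^sup>+x. ennreal (cmod (r x) * cmod (f (x $ 2))) \<partial>lebesgue)"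
    if "integrable lebesgue r" "smooth f" for r f
  proof -
    have "ennreal (cmod (LINT x|lebesgue. r x * tensor a (cut f) x)) \<le> (\<integral>\<^sup>+x. ennreal (cmod (r x * tensor a (cut f) x)) \<partial>lebesgue)"
      by (rule integral_norm_bound_ennreal, rule inth) (use that in auto)
    also have "\<dots> \<le> (\<integral>\<^sup>+x. ennreal (cmod (r x) * cmod (f (x $ 2))) \<partial>lebesgue)"
      unfolding cw norm_mult by (intro nn_integral_mono ennreal_leI mult_left_mono cut_wave_norm_le \<zeta>(4)) simp
    finally show ?thesis .
  qed
  have K0: "?K * mass p \<ge> 0" "?K * mass q \<ge> 0"
    using order_trans[OF norm_ge_zero Eint[OF p E2i E2b]] order_trans[OF norm_ge_zero Eint[OF q E1i E1b]] by auto
  have K1: "0 \<le> ?K * mass p + cmod \<beta> * (?K * mass q)"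
    by (intro add_nonneg_nonneg mult_nonneg_nonneg[OF norm_ge_zero] K0)
  have enn: "ennreal x \<le> ennreal b * ennreal u + ennreal v + ennreal w"
    if "x \<le> b * u + v + w" "0 \<le> b" "0 \<le> u" "0 \<le> v" "0 \<le> w" for x b u v w :: real
  proof -
    have "ennreal b * ennreal u + ennreal v + ennreal w = ennreal (b * u + v + w)"
      using that by (simp add: ennreal_mult)
    then show ?thesis using that(1) by (simp only: ennreal_leI)
  qed
  have "cmod (LINT x|lebesgue. p x * tensor a (cut g) x) \<le>
     cmod \<beta> * cmod (LINT x|lebesgue. F x * tensor a (cut h) x) + cmod (LINT x|lebesgue. G x * tensor a (cut k) x)
     + (?K * mass p + cmod \<beta> * (?K * mass q))"
  proof -
    have "cmod (b * u - v - w + b * z) \<le> cmod b * cmod u + cmod v + (cmod w + cmod b * cmod z)" for b u v w z :: complex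
      by (smt (verit) norm_triangle_ineq norm_triangle_ineq4 norm_mult)
    then have "cmod (LINT x|lebesgue. p x * tensor a (cut g) x) \<le>
     cmod \<beta> * cmod (LINT x|lebesgue. F x * tensor a (cut h) x) + cmod (LINT x|lebesgue. G x * tensor a (cut k) x)
     + (cmod (LINT x|lebesgue. p x * E2 x) + cmod \<beta> * cmod (LINT x|lebesgue. q x * E1 x))"
      unfolding ident .
    also have "\<dots> \<le> cmod \<beta> * cmod (LINT x|lebesgue. F x * tensor a (cut h) x) + cmod (LINT x|lebesgue. G x * tensor a (cut k) x)
     + (?K * mass p + cmod \<beta> * (?K * mass q))"
      by (intro add_mono mult_left_mono order_refl Eint p q E1i E2i E1b E2b) auto
    finally show ?thesis .
  qed
  then have "ennreal (cmod (LINT x|lebesgue. p x * tensor a (cut g) x)) \<le>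
     ennreal (cmod \<beta>) * ennreal (cmod (LINT x|lebesgue. F x * tensor a (cut h) x)) + ennreal (cmod (LINT x|lebesgue. G x * tensor a (cut k) x))
     + ennreal (?K * mass p + cmod \<beta> * (?K * mass q))"
    by (rule enn[OF _ _ _ _ K1]) simp_all
  also have "\<dots> \<le> ennreal (cmod \<beta>) * (\<integral>\<^sup>+x. ennreal (cmod (F x) * cmod (h (x $ 2))) \<partial>lebesgue)
    + (\<integral>\<^sup>+x. ennreal (cmod (G x) * cmod (k (x $ 2))) \<partial>lebesgue)
     + ennreal (?K * mass p + cmod \<beta> * (?K * mass q))"
    by (intro add_mono mult_left_mono src order_refl F G h k) auto
  also have "?K * mass p + cmod \<beta> * (?K * mass q) = ?K * (mass p + cmod \<beta> * mass q)"
    by (simp only: distrib_left mult.left_commute[of "cmod \<beta>"])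
  finally show ?thesis unfolding cw .
qed

section \<open>Solutions at a fixed frequency\<close>

text \<open>
  The partial Fourier transform of \<open>(\<Delta>\<^sup>2 - \<mu>\<^sup>2)\<^sup>-\<^sup>1\<close>, applied to \<open>g\<close>.
\<close>

definition resolvent :: "complex \<Rightarrow> real \<Rightarrow> (real \<Rightarrow> complex) \<Rightarrow> real \<Rightarrow> complex" where
  "resolvent \<mu> \<xi> g y = (green (wave \<mu> \<xi>) g y - green (wave (- \<mu>) \<xi>) g y) / (2 * \<mu>)"

definition resolvent_deriv :: "complex \<Rightarrow> real \<Rightarrow> (real \<Rightarrow> complex) \<Rightarrow> real \<Rightarrow> complex" where
  "resolvent_deriv \<mu> \<xi> g y = (green_deriv (wave \<mu> \<xi>) g y - green_deriv (wave (- \<mu>) \<xi>) g y) / (2 * \<mu>)"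

text \<open>
  If \<open>h\<close> is the function defined first, this is \<open>- \<xi>\<^sup>2 h + 2 c \<xi> h' - h''\<close>, the factor that \<open>L\<^sub>-\<^sub>c\<close>
  produces from \<open>e\<^sup>i\<^sup>\<xi>\<^sup>x\<^sub>1 h\<close>; the second derivative is eliminated by the differential equation of \<open>h\<close>.
\<close>

definition resolvent_d2 :: "complex \<Rightarrow> complex \<Rightarrow> real \<Rightarrow> (real \<Rightarrow> complex) \<Rightarrow> real \<Rightarrow> complex" where
  "resolvent_d2 c \<mu> \<xi> g y = - 2 * \<xi>\<^sup>2 * resolvent \<mu> \<xi> g y + 2 * c * \<xi> * resolvent_deriv \<mu> \<xi> g y
     + (green (wave \<mu> \<xi>) g y + green (wave (- \<mu>) \<xi>) g y) / 2"

lemma resolvent_measurable [measurable]: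
  assumes [measurable]: "g \<in> borel_measurable borel" "f \<in> borel_measurable M" "h \<in> borel_measurable M"
  shows "(\<lambda>z. resolvent \<mu> (f z) g (h z)) \<in> borel_measurable M"
    and "(\<lambda>z. resolvent_d2 c \<mu> (f z) g (h z)) \<in> borel_measurable M"
  unfolding resolvent_def resolvent_deriv_def resolvent_d2_def by measurable

text \<open>
  A crude bound for the size of the solutions and of their first derivatives, which makes the
  truncation errors integrable in \<open>\<xi>\<close>.
\<close>

definition frequency_weight :: "complex \<Rightarrow> real \<Rightarrow> real" where
  "frequency_weight \<mu> \<xi> = (1 + \<bar>\<xi>\<bar>) ^ 3 * (1 + 1 / cmod (wave \<mu> \<xi>) + 1 / cmod (wave (- \<mu>) \<xi>))"

text \<open>
  Let \<open>H\<close> and \<open>I\<close> be the solutions of the two equations of second order. Their equations yield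
  \<open>\<xi>\<^sup>2 h - h'' = (H + I) / 2\<close> and, applied once more, \<open>(\<xi>\<^sup>2 - \<partial>\<^sup>2)\<^sup>2 h = \<mu>\<^sup>2 h + g\<close>. The factorization
  \<open>\<xi>\<^sup>2 - \<partial>\<^sup>2 = (\<xi> + c \<partial>) (\<xi> - c \<partial>)\<close>, valid for \<open>c\<^sup>2 = 1\<close>, produces \<open>k\<close>.
\<close>

lemma resolvent_solves:
  fixes c \<mu> :: complex and \<xi> l :: real and g h k :: "real \<Rightarrow> complex"
  assumes \<mu>: "\<mu> \<noteq> 0" and c: "c\<^sup>2 = 1" "cmod c = 1" and g: "smooth g" "\<And>y. \<bar>y\<bar> > l \<Longrightarrow> g y = 0"
    and nz: "wave \<mu> \<xi> \<noteq> 0" "wave (- \<mu>) \<xi> \<noteq> 0"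
  defines "h \<equiv> resolvent \<mu> \<xi> g" and "k \<equiv> resolvent_d2 c \<mu> \<xi> g"
    and "B \<equiv> 3 * ((LINT y|lborel. cmod (g y)) * (1 + 1 / cmod \<mu>)) * frequency_weight \<mu> \<xi>"
  obtains h1 h2 k1 k2 :: "real \<Rightarrow> complex" where
    "smooth h" "\<And>x. (h has_vector_derivative h1 x) (at x)" "\<And>x. (h1 has_vector_derivative h2 x) (at x)"
    "smooth k" "\<And>x. (k has_vector_derivative k1 x) (at x)" "\<And>x. (k1 has_vector_derivative k2 x) (at x)"
    "\<And>x. k x = - \<xi>\<^sup>2 * h x + 2 * c * \<xi> * h1 x - h2 x"
    "\<And>x. - \<xi>\<^sup>2 * k x - 2 * c * \<xi> * k1 x - k2 x = \<mu>\<^sup>2 * h x + g x"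
    "\<And>x. cmod (h x) \<le> B" "\<And>x. cmod (h1 x) \<le> B" "\<And>x. cmod (k x) \<le> B" "\<And>x. cmod (k1 x) \<le> B"
proof -
  define s r where "s = wave \<mu> \<xi>" and "r = wave (- \<mu>) \<xi>"
  define H I D E where "H = green s g" and "I = green r g" and "D = green_deriv s g" and "E = green_deriv r g"
  have gc: "continuous_on UNIV g" by (rule smooth_continuous) fact
  have s2: "s\<^sup>2 = of_real (\<xi>\<^sup>2) - \<mu>" and r2: "r\<^sup>2 = of_real (\<xi>\<^sup>2) + \<mu>"
    by (simp_all add: s_def r_def wave_square)
  have sr0: "s \<noteq> 0" "r \<noteq> 0" using nz by (simp_all add: s_def r_def)
  have HD: "(H has_vector_derivative D x) (at x)" "(D has_vector_derivative s\<^sup>2 * H x - g x) (at x)" for x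
    unfolding H_def D_def by (rule green_ode[OF sr0(1) gc g(2)]; simp)+
  have IE: "(I has_vector_derivative E x) (at x)" "(E has_vector_derivative r\<^sup>2 * I x - g x) (at x)" for x
    unfolding I_def E_def by (rule green_ode[OF sr0(2) gc g(2)]; simp)+
  have Hs: "smooth H" by (rule smooth_ode[OF HD g(1)])
  have Is: "smooth I" by (rule smooth_ode[OF IE g(1)])
  have h_eq: "h = (\<lambda>x. (1 / (2 * \<mu>)) * (H x - I x))"
    by (simp add: h_def resolvent_def[abs_def] H_def I_def s_def r_def)
  \<comment> \<open>The derivatives of \<open>h\<close> up to order four, with even orders reduced by the differential equations.\<close>
  define h1 where "h1 x = (1 / (2 * \<mu>)) * (D x - E x)" for x
  define h2 where "h2 x = \<xi>\<^sup>2 * h x - (1/2) * (H x + I x)" for x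
  define h3 where "h3 x = \<xi>\<^sup>2 * h1 x - (1/2) * (D x + E x)" for x
  define h4 where "h4 x = \<xi>\<^sup>2 * h2 x - (1/2) * ((s\<^sup>2 * H x - g x) + (r\<^sup>2 * I x - g x))" for x
  define k1 where "k1 x = - \<xi>\<^sup>2 * h1 x + 2 * c * \<xi> * h2 x - h3 x" for x
  define k2 where "k2 x = - \<xi>\<^sup>2 * h2 x + 2 * c * \<xi> * h3 x - h4 x" for x
  have k_eq: "k x = - \<xi>\<^sup>2 * h x + 2 * c * \<xi> * h1 x - h2 x" for x
    unfolding k_def resolvent_d2_def h2_def h1_def resolvent_deriv_def h_def H_def I_def D_def E_def s_def r_def
    by (simp add: field_simps)
  have hd: "(h has_vector_derivative h1 x) (at x)" for x
    unfolding h_eq h1_def by (intro has_vector_derivative_mult_right has_vector_derivative_diff HD IE)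
  have h1d: "(h1 has_vector_derivative h2 x) (at x)" for x
  proof -
    have "(h1 has_vector_derivative (1 / (2 * \<mu>)) * ((s\<^sup>2 * H x - g x) - (r\<^sup>2 * I x - g x))) (at x)"
      unfolding h1_def by (intro has_vector_derivative_mult_right has_vector_derivative_diff HD IE)
    moreover have "(1 / (2 * \<mu>)) * ((s\<^sup>2 * H x - g x) - (r\<^sup>2 * I x - g x)) = h2 x"
    proof -
      have "(1 / (2 * \<mu>)) * (((w - \<mu>) * u - g x) - ((w + \<mu>) * v - g x)) = w * ((1 / (2 * \<mu>)) * (u - v)) - (1/2) * (u + v)"
        for u v w
      proof -
        have eq: "((w - \<mu>) * u - g x) - ((w + \<mu>) * v - g x) = w * (u - v) - \<mu> * (u + v)" by (simp add: algebra_simps)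
        show ?thesis unfolding eq right_diff_distrib[of "1 / (2 * \<mu>)" "w * (u - v)"] using \<mu> by simp
      qed
      then show ?thesis unfolding h2_def h_eq s2 r2 by simp
    qed
    ultimately show ?thesis by simp
  qed
  have h2d: "(h2 has_vector_derivative h3 x) (at x)" for x
    unfolding h2_def h3_def by (intro has_vector_derivative_mult_right has_vector_derivative_diff has_vector_derivative_add HD IE hd)
  have h3d: "(h3 has_vector_derivative h4 x) (at x)" for x
    unfolding h3_def h4_def by (intro has_vector_derivative_mult_right has_vector_derivative_diff has_vector_derivative_add HD IE h1d)
  have kd: "(k has_vector_derivative k1 x) (at x)" for x
    unfolding k_eq[abs_def] k1_def
    by (intro has_vector_derivative_mult_right has_vector_derivative_diff has_vector_derivative_add hd h1d h2d)
  have k1d: "(k1 has_vector_derivative k2 x) (at x)" for x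
    unfolding k1_def k2_def
    by (intro has_vector_derivative_mult_right has_vector_derivative_diff has_vector_derivative_add h1d h2d h3d)
  have hs: "smooth h" unfolding h_eq by (intro smooth_cmult smooth_diff Hs Is)
  have h1s: "smooth h1" by (rule smooth_derivative[OF hs hd])
  have h2s: "smooth h2" by (rule smooth_derivative[OF h1s h1d])
  have ks: "smooth k" unfolding k_eq[abs_def] by (intro smooth_cmult smooth_add smooth_diff hs h1s h2s)
  have g_eq: "- \<xi>\<^sup>2 * k x - 2 * c * \<xi> * k1 x - k2 x = \<mu>\<^sup>2 * h x + g x" for x
  proof -
    define w where "w = complex_of_real \<xi>"
    have "- w\<^sup>2 * k x - 2 * c * w * k1 x - k2 x = w\<^sup>2 * w\<^sup>2 * h x + 2 * w\<^sup>2 * h2 x - 4 * c\<^sup>2 * w\<^sup>2 * h2 x + h4 x"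
      unfolding k_eq k1_def k2_def by (simp add: w_def algebra_simps power2_eq_square)
    also have "\<dots> = w\<^sup>2 * (w\<^sup>2 * h x - 2 * h2 x) + h4 x" unfolding c by (simp add: algebra_simps)
    also have "\<dots> = w\<^sup>2 * (w\<^sup>2 * h x - h2 x - (1/2) * (H x + I x)) + \<mu> * (1/2) * (H x - I x) + g x"
      unfolding h4_def s2 r2 by (simp add: w_def field_simps)
    also have "w\<^sup>2 * h x - h2 x - (1/2) * (H x + I x) = 0" by (simp add: h2_def w_def)
    also have "\<mu> * (1/2) * (H x - I x) = \<mu>\<^sup>2 * h x" unfolding h_eq using \<mu> by (simp add: power2_eq_square)
    finally show ?thesis by (simp add: w_def)
  qed
  define \<Gamma> where "\<Gamma> = (LINT y|lborel. cmod (g y))"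
  define K where "K = \<Gamma> * (1 + 1 / cmod \<mu>)"
  define z where "z = 1 + 1 / cmod s + 1 / cmod r"
  define v where "v = 1 + \<bar>\<xi>\<bar>"
  have B_eq: "B = 3 * K * (v ^ 3 * z)"
    by (simp add: B_def K_def \<Gamma>_def frequency_weight_def v_def z_def s_def r_def)
  have \<Gamma>0: "\<Gamma> \<ge> 0" by (simp add: \<Gamma>_def)
  have v1: "v \<ge> 1" "\<bar>\<xi>\<bar> \<le> v" by (simp_all add: v_def)
  have zs: "1 \<le> z" "1 / cmod s + 1 / cmod r \<le> z" by (simp_all add: z_def)
  have K: "\<Gamma> \<le> K" "\<Gamma> / cmod \<mu> \<le> K" "K \<ge> 0" using \<Gamma>0 by (simp_all add: K_def field_simps)
  have Kz: "K \<le> K * z" using K(3) zs(1) by (simp add: mult_le_cancel_left1)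
  have HI: "cmod (H x) + cmod (I x) \<le> \<Gamma> * z / 2" for x
  proof -
    have "cmod (H x) \<le> \<Gamma> / (2 * cmod s)" unfolding H_def \<Gamma>_def s_def
      by (rule green_bounds(1)[OF nz(1) gc g(2) Re_wave])
    moreover have "cmod (I x) \<le> \<Gamma> / (2 * cmod r)" unfolding I_def \<Gamma>_def r_def
      by (rule green_bounds(1)[OF nz(2) gc g(2) Re_wave])
    ultimately have "cmod (H x) + cmod (I x) \<le> \<Gamma> / 2 * (1 / cmod s + 1 / cmod r)"
      by (simp add: distrib_left)
    also have "\<dots> \<le> \<Gamma> / 2 * z" using zs(2) \<Gamma>0 by (intro mult_left_mono) auto
    finally show ?thesis by simp
  qed
  have DE: "cmod (D x) + cmod (E x) \<le> \<Gamma>" for x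
  proof -
    have "cmod (D x) \<le> \<Gamma> / 2" unfolding D_def \<Gamma>_def s_def
      by (rule green_bounds(2)[OF nz(1) gc g(2) Re_wave])
    moreover have "cmod (E x) \<le> \<Gamma> / 2" unfolding E_def \<Gamma>_def r_def
      by (rule green_bounds(2)[OF nz(2) gc g(2) Re_wave])
    ultimately show ?thesis by simp
  qed
  have v2: "K * z \<le> v\<^sup>2 * (K * z)" "v\<^sup>2 * (K * z) \<le> v ^ 3 * (K * z)" "v * (K * z) \<le> v\<^sup>2 * (K * z)" "0 \<le> K * z"
    using v1(1) Kz K(3) zs(1) by (auto intro!: mult_right_mono simp: mult_le_cancel_right1 one_le_power power_increasing self_le_power)
  have hb: "cmod (h x) \<le> K * z / 4" for x
  proof -
    have "cmod (h x) \<le> (cmod (H x) + cmod (I x)) / (2 * cmod \<mu>)"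
      unfolding h_eq by (simp add: norm_mult norm_divide divide_right_mono norm_triangle_ineq4)
    also have "\<dots> \<le> (\<Gamma> * z / 2) / (2 * cmod \<mu>)" using HI by (intro divide_right_mono) auto
    also have "\<dots> = \<Gamma> / cmod \<mu> * z / 4" by simp
    also have "\<dots> \<le> K * z / 4" using K zs(1) by (intro divide_right_mono mult_right_mono) auto
    finally show ?thesis .
  qed
  have h1b: "cmod (h1 x) \<le> K * z / 2" for x
  proof -
    have "cmod (h1 x) \<le> (cmod (D x) + cmod (E x)) / (2 * cmod \<mu>)"
      unfolding h1_def by (simp add: norm_mult norm_divide divide_right_mono norm_triangle_ineq4)
    also have "\<dots> \<le> \<Gamma> / (2 * cmod \<mu>)" using DE by (intro divide_right_mono) auto
    also have "\<dots> \<le> K / 2" using K by simp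
    also have "\<dots> \<le> K * z / 2" using Kz by simp
    finally show ?thesis .
  qed
  have xi: "cmod (complex_of_real \<xi>) \<le> v" "cmod (complex_of_real (\<xi>\<^sup>2)) \<le> v\<^sup>2"
    using v1(2) power_mono[of "\<bar>\<xi>\<bar>" v 2] by (simp_all add: norm_power)
  have h2b: "cmod (h2 x) \<le> v\<^sup>2 * (K * z) / 2" for x
  proof -
    have "cmod (h2 x) \<le> cmod (complex_of_real (\<xi>\<^sup>2)) * cmod (h x) + (1/2) * (cmod (H x) + cmod (I x))"
      unfolding h2_def
      by (rule order_trans[OF norm_triangle_ineq4])
        (simp add: norm_mult norm_power norm_divide divide_right_mono norm_triangle_ineq)
    also have "\<dots> \<le> v\<^sup>2 * (K * z / 4) + (1/2) * (\<Gamma> * z / 2)"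
      by (intro add_mono mult_mono xi hb HI mult_left_mono) auto
    also have "\<Gamma> * z \<le> K * z" using K zs(1) by (intro mult_right_mono) auto
    finally show ?thesis using v2 by simp
  qed
  have h3b: "cmod (h3 x) \<le> v\<^sup>2 * (K * z)" for x
  proof -
    have "cmod (h3 x) \<le> cmod (complex_of_real (\<xi>\<^sup>2)) * cmod (h1 x) + (1/2) * (cmod (D x) + cmod (E x))"
      unfolding h3_def
      by (rule order_trans[OF norm_triangle_ineq4])
        (simp add: norm_mult norm_power norm_divide divide_right_mono norm_triangle_ineq)
    also have "\<dots> \<le> v\<^sup>2 * (K * z / 2) + (1/2) * \<Gamma>"
      by (intro add_mono mult_mono xi h1b DE mult_left_mono) auto
    finally show ?thesis using v2 K Kz by simp
  qed
  have tri: "cmod (- (complex_of_real \<xi>)\<^sup>2 * x + 2 * c * \<xi> * y - w) \<le> v\<^sup>2 * X + 2 * v * Y + W"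
    if "cmod x \<le> X" "cmod y \<le> Y" "cmod w \<le> W" for x y w X Y W
  proof -
    have "cmod (- (complex_of_real \<xi>)\<^sup>2 * x + 2 * c * \<xi> * y - w) \<le> cmod (- (complex_of_real \<xi>)\<^sup>2 * x) + cmod (2 * c * \<xi> * y) + cmod w"
      by (intro order_trans[OF norm_triangle_ineq4] order_trans[OF norm_triangle_ineq] add_mono order_refl)
    also have "\<dots> = cmod (complex_of_real (\<xi>\<^sup>2)) * cmod x + 2 * cmod (complex_of_real \<xi>) * cmod y + cmod w"
      by (simp add: norm_mult norm_power c)
    also have "\<dots> \<le> v\<^sup>2 * X + 2 * v * Y + W"
      using v1 by (intro add_mono mult_mono that xi) auto
    finally show ?thesis .
  qed
  have kb: "cmod (k x) \<le> 3 * (v ^ 3 * (K * z))" for x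
  proof -
    have "v\<^sup>2 * (K * z / 4) + 2 * v * (K * z / 2) + v\<^sup>2 * (K * z) / 2 \<le> 3 * (v ^ 3 * (K * z))"
      using v2 by (simp add: algebra_simps)
    then show ?thesis using tri[OF hb h1b h2b, of x x x] unfolding k_eq by simp
  qed
  have k1b: "cmod (k1 x) \<le> 3 * (v ^ 3 * (K * z))" for x
  proof -
    have "v\<^sup>2 * (K * z / 2) + 2 * v * (v\<^sup>2 * (K * z) / 2) + v\<^sup>2 * (K * z) = 3/2 * (v\<^sup>2 * (K * z)) + v ^ 3 * (K * z)"
      by (simp add: algebra_simps power3_eq_cube power2_eq_square)
    also have "\<dots> \<le> 3 * (v ^ 3 * (K * z))" using v2 by linarith
    finally have "v\<^sup>2 * (K * z / 2) + 2 * v * (v\<^sup>2 * (K * z) / 2) + v\<^sup>2 * (K * z) \<le> 3 * (v ^ 3 * (K * z))" .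
    with tri[OF h1b h2b h3b, of x x x] show ?thesis unfolding k1_def by simp
  qed
  show thesis
  proof (rule that[OF hs hd h1d ks kd k1d k_eq g_eq])
    show "cmod (h x) \<le> B" "cmod (h1 x) \<le> B" "cmod (k x) \<le> B" "cmod (k1 x) \<le> B" for x
      using hb[of x] h1b[of x] kb[of x] k1b[of x] v2 unfolding B_eq by (simp_all add: mult_ac)
  qed
qed

text \<open>
  At most two frequencies are excluded.
\<close>

lemma AE_wave_nonzero: "AE \<xi> in lborel. wave \<mu> \<xi> \<noteq> 0"
proof -
  have "wave \<mu> \<xi> \<noteq> 0" if "\<xi> \<noteq> Re (csqrt \<mu>) \<and> \<xi> \<noteq> - Re (csqrt \<mu>)" for \<xi>
  proof
    assume "wave \<mu> \<xi> = 0"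
    then have "(complex_of_real \<xi>)\<^sup>2 = (csqrt \<mu>)\<^sup>2" by (simp add: wave_def)
    then have "complex_of_real \<xi> = csqrt \<mu> \<or> complex_of_real \<xi> = - csqrt \<mu>"
      using power2_eq_iff[of "complex_of_real \<xi>" "csqrt \<mu>"] by blast
    then show False using that by (metis Re_complex_of_real uminus_complex.sel(1))
  qed
  moreover have "AE \<xi> in lborel. \<xi> \<noteq> Re (csqrt \<mu>) \<and> \<xi> \<noteq> - Re (csqrt \<mu>)"
    using AE_lborel_singleton by (intro AE_conjI)
  ultimately show ?thesis by (auto elim: AE_mp)
qed

text \<open>
  Both functions are integrals of \<open>g\<close> against the kernels of \<open>kernel_bounds\<close>, so Tonelli's theorem moves
  the integral over \<open>\<xi>\<close> onto the kernel. For the second one, the numerator \<open>(\<sigma> \<xi> + s)\<^sup>2\<close> arises from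
  \<open>2 \<xi>\<^sup>2 - \<mu> + 2 \<sigma> \<xi> s\<close> by \<open>s\<^sup>2 = \<xi>\<^sup>2 - \<mu>\<close>, and the sign \<open>\<sigma>\<close> from the derivative of the Green function.
\<close>

lemma resolvent_integral_bounds:
  fixes c :: real and \<mu> :: complex and l y :: real and g :: "real \<Rightarrow> complex"
  assumes \<mu>: "\<mu> \<noteq> 0" and c: "c = 1 \<or> c = -1" and g: "continuous_on UNIV g" "\<And>y. \<bar>y\<bar> > l \<Longrightarrow> g y = 0"
  defines "\<Gamma> \<equiv> (LINT y|lborel. cmod (g y))"
  shows "(\<integral>\<^sup>+\<xi>. ennreal (cmod (resolvent \<mu> \<xi> g y)) \<partial>lborel) \<le> ennreal (5 / cmod \<mu> * \<Gamma>)"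
    and "(\<integral>\<^sup>+\<xi>. ennreal (cmod (resolvent_d2 c \<mu> \<xi> g y)) \<partial>lborel) \<le> ennreal (100 * \<Gamma>)"
proof -
  define e where "e \<nu> \<xi> t = exp (- wave \<nu> \<xi> * of_real \<bar>y - t\<bar>)" for \<nu> \<xi> t
  define S where "S t = (if t \<le> y then c else - c)" for t
  have [measurable]: "g \<in> borel_measurable borel" using g(1) by (rule borel_measurable_continuous_onI)
  have [measurable]: "(\<lambda>(\<xi>, t). e \<nu> \<xi> t) \<in> borel_measurable (borel \<Otimes>\<^sub>M borel)" for \<nu>
    unfolding e_def by measurable
  have [measurable]: "S \<in> borel_measurable borel" unfolding S_def by measurable
  have gi: "integrable lborel (\<lambda>t. cmod (g t))" using integrable_compact_support[OF g] by simp
  have g\<Gamma>: "(\<integral>\<^sup>+t. ennreal (cmod (g t)) \<partial>lborel) = ennreal \<Gamma>"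
    unfolding \<Gamma>_def by (rule nn_integral_eq_integral[OF gi]) simp
  \<comment> \<open>The common part: a kernel with bounded integral over the frequency, and a constant of modulus \<open>a\<close>.\<close>
  have general: "(\<integral>\<^sup>+\<xi>. ennreal (cmod (r \<xi>)) \<partial>lborel) \<le> ennreal (a * C * \<Gamma>)"
    if r: "\<And>\<xi>. wave \<mu> \<xi> \<noteq> 0 \<Longrightarrow> wave (- \<mu>) \<xi> \<noteq> 0 \<Longrightarrow>
        integrable lborel (\<lambda>t. \<kappa> \<xi> t * g t) \<and> r \<xi> = of_real a * w * (LINT t|lborel. \<kappa> \<xi> t * g t)"
      and w: "cmod w = 1" and a: "a \<ge> 0" and C: "C \<ge> 0"
      and \<kappa>: "(\<lambda>(\<xi>, t). \<kappa> \<xi> t) \<in> borel_measurable (borel \<Otimes>\<^sub>M borel)"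
      and bound: "\<And>t. (\<integral>\<^sup>+\<xi>. ennreal (cmod (\<kappa> \<xi> t)) \<partial>lborel) \<le> ennreal C"
    for r \<kappa> a C and w :: complex
  proof -
    note [measurable] = \<kappa>
    have "(\<integral>\<^sup>+\<xi>. ennreal (cmod (r \<xi>)) \<partial>lborel) \<le>
       (\<integral>\<^sup>+\<xi>. ennreal a * (\<integral>\<^sup>+t. ennreal (cmod (\<kappa> \<xi> t)) * ennreal (cmod (g t)) \<partial>lborel) \<partial>lborel)"
    proof (rule nn_integral_mono_AE)
      show "AE \<xi> in lborel. ennreal (cmod (r \<xi>)) \<le> ennreal a * (\<integral>\<^sup>+t. ennreal (cmod (\<kappa> \<xi> t)) * ennreal (cmod (g t)) \<partial>lborel)"
        using AE_wave_nonzero[of \<mu>] AE_wave_nonzero[of "- \<mu>"]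
      proof eventually_elim
        case (elim \<xi>)
        note R = r[OF elim]
        have "ennreal (cmod (r \<xi>)) = ennreal a * ennreal (cmod (LINT t|lborel. \<kappa> \<xi> t * g t))"
          using R w a by (simp add: norm_mult ennreal_mult')
        also have "\<dots> \<le> ennreal a * (\<integral>\<^sup>+t. ennreal (cmod (\<kappa> \<xi> t * g t)) \<partial>lborel)"
          using R by (intro mult_left_mono integral_norm_bound_ennreal) auto
        finally show ?case by (simp add: norm_mult ennreal_mult')
      qed
    qed
    also have "\<dots> = ennreal a * (\<integral>\<^sup>+\<xi>. (\<integral>\<^sup>+t. ennreal (cmod (\<kappa> \<xi> t)) * ennreal (cmod (g t)) \<partial>lborel) \<partial>lborel)"
      by (rule nn_integral_cmult) measurable
    also have "(\<integral>\<^sup>+\<xi>. (\<integral>\<^sup>+t. ennreal (cmod (\<kappa> \<xi> t)) * ennreal (cmod (g t)) \<partial>lborel) \<partial>lborel) =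
       (\<integral>\<^sup>+t. (\<integral>\<^sup>+\<xi>. ennreal (cmod (\<kappa> \<xi> t)) * ennreal (cmod (g t)) \<partial>lborel) \<partial>lborel)"
      by (rule lborel_pair.Fubini'[symmetric]) measurable
    also have "\<dots> \<le> (\<integral>\<^sup>+t. ennreal C * ennreal (cmod (g t)) \<partial>lborel)"
      using bound by (intro nn_integral_mono) (simp add: nn_integral_multc mult_right_mono)
    also have "\<dots> = ennreal C * ennreal \<Gamma>" by (simp add: nn_integral_cmult g\<Gamma>)
    finally show ?thesis using a C by (simp add: ennreal_mult' mult.assoc mult_left_mono)
  qed
  note gint = green_integrable[OF _ g]
  have "(\<integral>\<^sup>+\<xi>. ennreal (cmod (resolvent \<mu> \<xi> g y)) \<partial>lborel) \<le> ennreal (1 / (4 * cmod \<mu>) * 20 * \<Gamma>)"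
  proof (rule general[where w = "of_real (cmod \<mu>) / \<mu>" and \<kappa> = "\<lambda>\<xi> t. e \<mu> \<xi> t / wave \<mu> \<xi> - e (- \<mu>) \<xi> t / wave (- \<mu>) \<xi>"])
    fix \<xi> assume nz: "wave \<mu> \<xi> \<noteq> 0" "wave (- \<mu>) \<xi> \<noteq> 0"
    let ?P = "\<lambda>t. exp (- wave \<mu> \<xi> * of_real \<bar>y - t\<bar>) / (2 * wave \<mu> \<xi>) * g t"
    let ?Q = "\<lambda>t. exp (- wave (- \<mu>) \<xi> * of_real \<bar>y - t\<bar>) / (2 * wave (- \<mu>) \<xi>) * g t"
    have eq: "(\<lambda>t. (e \<mu> \<xi> t / wave \<mu> \<xi> - e (- \<mu>) \<xi> t / wave (- \<mu>) \<xi>) * g t) = (\<lambda>t. 2 * ?P t - 2 * ?Q t)"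
      by (auto simp: e_def algebra_simps)
    have i: "integrable lborel ?P" "integrable lborel ?Q" using gint(1) nz by blast+
    show "integrable lborel (\<lambda>t. (e \<mu> \<xi> t / wave \<mu> \<xi> - e (- \<mu>) \<xi> t / wave (- \<mu>) \<xi>) * g t) \<and>
      resolvent \<mu> \<xi> g y = of_real (1 / (4 * cmod \<mu>)) * (of_real (cmod \<mu>) / \<mu>) * (LINT t|lborel. (e \<mu> \<xi> t / wave \<mu> \<xi> - e (- \<mu>) \<xi> t / wave (- \<mu>) \<xi>) * g t)"
    proof
      show "integrable lborel (\<lambda>t. (e \<mu> \<xi> t / wave \<mu> \<xi> - e (- \<mu>) \<xi> t / wave (- \<mu>) \<xi>) * g t)"
        unfolding eq by (intro Bochner_Integration.integrable_diff integrable_mult_right i)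
      have "(LINT t|lborel. 2 * ?P t - 2 * ?Q t) = 2 * integral\<^sup>L lborel ?P - 2 * integral\<^sup>L lborel ?Q"
        by (subst Bochner_Integration.integral_diff[OF integrable_mult_right[OF i(1)] integrable_mult_right[OF i(2)]])
          (simp only: integral_mult_right_zero)
      moreover have "(u - v) / (2 * \<mu>) = of_real (1 / (4 * cmod \<mu>)) * (of_real (cmod \<mu>) / \<mu>) * (2 * u - 2 * v)" for u v
        using \<mu> by (simp add: field_simps)
      ultimately show "resolvent \<mu> \<xi> g y = of_real (1 / (4 * cmod \<mu>)) * (of_real (cmod \<mu>) / \<mu>) * (LINT t|lborel. (e \<mu> \<xi> t / wave \<mu> \<xi> - e (- \<mu>) \<xi> t / wave (- \<mu>) \<xi>) * g t)"
        unfolding eq resolvent_def green_def by (simp only:)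
    qed
  next
    show "(\<integral>\<^sup>+\<xi>. ennreal (cmod (e \<mu> \<xi> t / wave \<mu> \<xi> - e (- \<mu>) \<xi> t / wave (- \<mu>) \<xi>)) \<partial>lborel) \<le> ennreal 20" for t
      unfolding e_def using kernel_bounds(1)[OF \<mu>, of "\<bar>y - t\<bar>" 1] by simp
  qed (use \<mu> in \<open>simp_all add: norm_divide\<close>)
  then show "(\<integral>\<^sup>+\<xi>. ennreal (cmod (resolvent \<mu> \<xi> g y)) \<partial>lborel) \<le> ennreal (5 / cmod \<mu> * \<Gamma>)" by simp
  let ?k = "\<lambda>\<xi> t. e \<mu> \<xi> t * (S t * \<xi> + wave \<mu> \<xi>)\<^sup>2 / wave \<mu> \<xi> - e (- \<mu>) \<xi> t * (S t * \<xi> + wave (- \<mu>) \<xi>)\<^sup>2 / wave (- \<mu>) \<xi>"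
  have "(\<integral>\<^sup>+\<xi>. ennreal (cmod (resolvent_d2 c \<mu> \<xi> g y)) \<partial>lborel) \<le> ennreal (1 / (4 * cmod \<mu>) * (400 * cmod \<mu>) * \<Gamma>)"
  proof (rule general[where w = "- of_real (cmod \<mu>) / \<mu>" and \<kappa> = ?k])
    fix \<xi> assume nz: "wave \<mu> \<xi> \<noteq> 0" "wave (- \<mu>) \<xi> \<noteq> 0"
    define s r where "s = wave \<mu> \<xi>" and "r = wave (- \<mu>) \<xi>"
    have sr: "s\<^sup>2 = of_real (\<xi>\<^sup>2) - \<mu>" "r\<^sup>2 = of_real (\<xi>\<^sup>2) + \<mu>" "s \<noteq> 0" "r \<noteq> 0"
      using nz by (simp_all add: s_def r_def wave_square)
    let ?P = "\<lambda>q t. exp (- q * of_real \<bar>y - t\<bar>) / (2 * q) * g t"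
    let ?Q = "\<lambda>q t. (if t \<le> y then -1 else 1) / 2 * exp (- q * of_real \<bar>y - t\<bar>) * g t"
    have i: "integrable lborel (?P s)" "integrable lborel (?P r)" "integrable lborel (?Q s)" "integrable lborel (?Q r)"
      using gint sr(3,4) by blast+
    define u where "u = complex_of_real \<xi>"
    have sq: "s * s = u * u - \<mu>" "r * r = u * u + \<mu>" using sr by (simp_all add: u_def power2_eq_square)
    have eq: "?k \<xi> t * g t = (4 * u\<^sup>2 - 2 * \<mu>) * ?P s t - (4 * u\<^sup>2 + 2 * \<mu>) * ?P r t - 4 * c * u * ?Q s t + 4 * c * u * ?Q r t" for t
    proof -
      have cc: "c * c = 1" using c by auto
      have id: "(\<sigma> * u + q)\<^sup>2 / q = (2 * u\<^sup>2 - \<nu>) / q + 2 * \<sigma> * u" if "q * q = u * u - \<nu>" "q \<noteq> 0" "\<sigma> * \<sigma> = 1" for \<sigma> q \<nu> :: complex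
      proof -
        have "(\<sigma> * u + q)\<^sup>2 = (\<sigma> * \<sigma>) * (u * u) + q * q + 2 * \<sigma> * u * q" by (simp add: power2_eq_square algebra_simps)
        also have "\<dots> = (2 * u\<^sup>2 - \<nu>) + 2 * \<sigma> * u * q" using that by (simp add: power2_eq_square)
        finally show ?thesis using that(2) by (simp add: add_divide_distrib)
      qed
      have SS: "complex_of_real (S t) * complex_of_real (S t) = 1"
        using cc by (simp add: S_def flip: of_real_mult)
      have "?k \<xi> t = e \<mu> \<xi> t * ((S t * u + s)\<^sup>2 / s) - e (- \<mu>) \<xi> t * ((S t * u + r)\<^sup>2 / r)"
        by (simp add: s_def r_def u_def)
      also have "\<dots> = exp (- s * of_real \<bar>y - t\<bar>) * ((2 * u\<^sup>2 - \<mu>) / s + 2 * S t * u) - exp (- r * of_real \<bar>y - t\<bar>) * ((2 * u\<^sup>2 + \<mu>) / r + 2 * S t * u)"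
        using id[OF sq(1) sr(3) SS] id[of r "- \<mu>" "S t"] sq(2) sr(4) SS by (simp add: e_def s_def r_def)
      finally have k: "?k \<xi> t = exp (- s * of_real \<bar>y - t\<bar>) * ((2 * u\<^sup>2 - \<mu>) / s + 2 * S t * u) - exp (- r * of_real \<bar>y - t\<bar>) * ((2 * u\<^sup>2 + \<mu>) / r + 2 * S t * u)" .
      show ?thesis unfolding k using sr(3,4)
        by (cases "t \<le> y") (simp_all add: S_def field_simps)
    qed
    have ie: "integrable lborel (\<lambda>t. (4 * u\<^sup>2 - 2 * \<mu>) * ?P s t - (4 * u\<^sup>2 + 2 * \<mu>) * ?P r t - 4 * c * u * ?Q s t + 4 * c * u * ?Q r t)"
      by (intro Bochner_Integration.integrable_diff Bochner_Integration.integrable_add integrable_mult_right i)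
    have lin: "(LINT t|lborel. a * U1 t - b * U2 t - d * U3 t + d * U4 t) = a * integral\<^sup>L lborel U1 - b * integral\<^sup>L lborel U2 - d * integral\<^sup>L lborel U3 + d * integral\<^sup>L lborel U4"
      if "integrable lborel U1" "integrable lborel U2" "integrable lborel U3" "integrable lborel U4" for a b d :: complex and U1 U2 U3 U4 :: "real \<Rightarrow> complex"
      using that by simp
    have "(LINT t|lborel. ?k \<xi> t * g t) = (4 * u\<^sup>2 - 2 * \<mu>) * green s g y - (4 * u\<^sup>2 + 2 * \<mu>) * green r g y - 4 * c * u * green_deriv s g y + 4 * c * u * green_deriv r g y"
      unfolding eq green_def green_deriv_def by (rule lin[OF i])
    also have "\<dots> = - (4 * \<mu>) * resolvent_d2 c \<mu> \<xi> g y"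
      unfolding resolvent_d2_def resolvent_def resolvent_deriv_def s_def[symmetric] r_def[symmetric] u_def
      using \<mu> by (simp add: field_simps)
    finally have "resolvent_d2 c \<mu> \<xi> g y = - (1 / (4 * \<mu>)) * (LINT t|lborel. ?k \<xi> t * g t)"
      using \<mu> by simp
    then show "integrable lborel (\<lambda>t. ?k \<xi> t * g t) \<and>
      resolvent_d2 c \<mu> \<xi> g y = of_real (1 / (4 * cmod \<mu>)) * (- of_real (cmod \<mu>) / \<mu>) * (LINT t|lborel. ?k \<xi> t * g t)"
      using ie \<mu> unfolding eq by simp
  next
    show "(\<integral>\<^sup>+\<xi>. ennreal (cmod (?k \<xi> t)) \<partial>lborel) \<le> ennreal (400 * cmod \<mu>)" for t
      unfolding e_def by (rule kernel_bounds(2)[OF \<mu>]) (use c in \<open>auto simp: S_def\<close>)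
  qed (use \<mu> in \<open>simp_all add: norm_divide\<close>)
  then show "(\<integral>\<^sup>+\<xi>. ennreal (cmod (resolvent_d2 c \<mu> \<xi> g y)) \<partial>lborel) \<le> ennreal (100 * \<Gamma>)" using \<mu> by simp
qed

section \<open>Integration over the frequency\<close>

text \<open>
  Below \<open>2 \<rho>\<close> the inverse square root singularity is kept; above, \<open>|\<xi>\<^sup>2 - \<nu>| \<ge> \<rho>\<^sup>2\<close>.
\<close>

lemma inverse_wave_bound:
  fixes \<rho> \<xi> :: real
  assumes "\<rho> > 0" "cmod \<nu> = \<rho>\<^sup>2" "\<bar>\<xi>\<bar> \<noteq> \<rho>"
  shows "1 / cmod (wave \<nu> \<xi>) \<le> indicator {..2*\<rho>} \<bar>\<xi>\<bar> / sqrt \<bar>\<xi>\<^sup>2 - \<rho>\<^sup>2\<bar> + 1 / \<rho>"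
proof -
  have "(cmod (wave \<nu> \<xi>))\<^sup>2 = cmod (of_real (\<xi>\<^sup>2) - \<nu>)"
    by (simp add: norm_power[symmetric] wave_square)
  also have "\<dots> \<ge> \<bar>\<xi>\<^sup>2 - \<rho>\<^sup>2\<bar>"
    using norm_triangle_ineq3[of "of_real (\<xi>\<^sup>2)" \<nu>] assms(2) by (simp add: norm_power)
  finally have w: "sqrt \<bar>\<xi>\<^sup>2 - \<rho>\<^sup>2\<bar> \<le> cmod (wave \<nu> \<xi>)" by (simp add: real_le_rsqrt real_sqrt_le_iff' real_le_lsqrt)
  have "\<xi>\<^sup>2 \<noteq> \<rho>\<^sup>2" using assms(1,3) by (metis abs_of_pos power2_eq_iff abs_minus_cancel)
  then have pos: "sqrt \<bar>\<xi>\<^sup>2 - \<rho>\<^sup>2\<bar> > 0" by simp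
  have 1: "1 / cmod (wave \<nu> \<xi>) \<le> 1 / sqrt \<bar>\<xi>\<^sup>2 - \<rho>\<^sup>2\<bar>"
    using w pos less_le_trans[OF pos w] by (intro divide_left_mono mult_pos_pos) auto
  show ?thesis
  proof (cases "\<bar>\<xi>\<bar> \<le> 2 * \<rho>")
    case True
    then show ?thesis using 1 assms(1) by (simp add: indicator_def add_increasing2)
  next
    case False
    then have "(2 * \<rho>)\<^sup>2 \<le> \<bar>\<xi>\<bar>\<^sup>2" using assms(1) by (intro power_mono) auto
    then have "\<rho>\<^sup>2 \<le> \<bar>\<xi>\<^sup>2 - \<rho>\<^sup>2\<bar>" using zero_le_power2[of \<rho>] by (simp add: power_mult_distrib)
    then have "\<rho> \<le> sqrt \<bar>\<xi>\<^sup>2 - \<rho>\<^sup>2\<bar>" by (rule real_le_rsqrt)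
    then have "1 / cmod (wave \<nu> \<xi>) \<le> 1 / \<rho>"
      using w assms(1) less_le_trans[OF pos w] by (intro divide_left_mono mult_pos_pos) auto
    then show ?thesis using False by (simp add: indicator_def)
  qed
qed

lemma frequency_weight_measurable [measurable]: "frequency_weight \<mu> \<in> borel_measurable borel"
  unfolding frequency_weight_def by measurable

text \<open>
  Half of the exponential decay absorbs the polynomial factor; the singularities are those of
  \<open>nn_integral_low_frequency\<close>.
\<close>

lemma frequency_weight_finite:
  fixes \<epsilon> :: real
  assumes "\<epsilon> > 0" "\<mu> \<noteq> 0"
  shows "(\<integral>\<^sup>+\<xi>. ennreal (exp (- \<epsilon> * \<bar>\<xi>\<bar>) * ((1 + \<bar>\<xi>\<bar>) * frequency_weight \<mu> \<xi>)) \<partial>lborel) < \<infinity>"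
proof -
  define \<rho> where "\<rho> = sqrt (cmod \<mu>)"
  have \<rho>: "\<rho> > 0" "cmod \<mu> = \<rho>\<^sup>2" "cmod (- \<mu>) = \<rho>\<^sup>2" using assms by (simp_all add: \<rho>_def)
  \<comment> \<open>From \<open>y ^ 4 \<le> 4! e\<^sup>y\<close> with \<open>y = \<epsilon> / 2 * (1 + |\<xi>|)\<close>.\<close>
  define K where "K = (2 / \<epsilon>) ^ 4 * (24 * exp (\<epsilon> / 2))"
  have K: "K \<ge> 0" using assms by (simp add: K_def)
  let ?lo = "\<lambda>\<xi>::real. indicator {..2*\<rho>} \<bar>\<xi>\<bar> / sqrt \<bar>\<xi>\<^sup>2 - \<rho>\<^sup>2\<bar> :: real"
  have poly: "exp (- \<epsilon> * \<bar>\<xi>\<bar>) * (1 + \<bar>\<xi>\<bar>) ^ 4 \<le> K * exp (- (\<epsilon> / 2) * \<bar>\<xi>\<bar>)" for \<xi> :: real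
  proof -
    have "(\<epsilon> / 2 * (1 + \<bar>\<xi>\<bar>)) ^ 4 \<le> 24 * exp (\<epsilon> / 2 * (1 + \<bar>\<xi>\<bar>))"
      using power_le_fact_exp[of "\<epsilon> / 2 * (1 + \<bar>\<xi>\<bar>)" 4] assms by (simp add: fact_numeral)
    then have "(2 / \<epsilon>) ^ 4 * ((\<epsilon> / 2 * (1 + \<bar>\<xi>\<bar>)) ^ 4) \<le> (2 / \<epsilon>) ^ 4 * (24 * exp (\<epsilon> / 2 * (1 + \<bar>\<xi>\<bar>)))"
      using assms by (intro mult_left_mono) auto
    also have "(2 / \<epsilon>) ^ 4 * ((\<epsilon> / 2 * (1 + \<bar>\<xi>\<bar>)) ^ 4) = (1 + \<bar>\<xi>\<bar>) ^ 4"
    proof -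
      have "(2 / \<epsilon>) * (\<epsilon> / 2 * (1 + \<bar>\<xi>\<bar>)) = 1 + \<bar>\<xi>\<bar>" using assms by simp
      then show ?thesis by (metis power_mult_distrib)
    qed
    also have "(2 / \<epsilon>) ^ 4 * (24 * exp (\<epsilon> / 2 * (1 + \<bar>\<xi>\<bar>))) = K * exp (\<epsilon> / 2 * \<bar>\<xi>\<bar>)"
      by (simp add: K_def distrib_left exp_add)
    finally have "exp (- \<epsilon> * \<bar>\<xi>\<bar>) * (1 + \<bar>\<xi>\<bar>) ^ 4 \<le> exp (- \<epsilon> * \<bar>\<xi>\<bar>) * (K * exp (\<epsilon> / 2 * \<bar>\<xi>\<bar>))"
      by (rule mult_left_mono) simp
    also have "\<dots> = K * exp (- (\<epsilon> / 2) * \<bar>\<xi>\<bar>)"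
      by (simp add: mult.left_commute mult_exp_exp)
    finally show ?thesis .
  qed
  have "(\<integral>\<^sup>+\<xi>. ennreal (exp (- \<epsilon> * \<bar>\<xi>\<bar>) * ((1 + \<bar>\<xi>\<bar>) * frequency_weight \<mu> \<xi>)) \<partial>lborel) \<le>
    (\<integral>\<^sup>+\<xi>. ennreal (K * (1 + 2 / \<rho>)) * ennreal (exp (- (\<epsilon> / 2) * \<bar>\<xi>\<bar>)) + ennreal (2 * K) * ennreal (?lo \<xi>) \<partial>lborel)"
  proof (rule nn_integral_mono_AE)
    have "AE \<xi> in lborel. \<xi> \<noteq> \<rho> \<and> \<xi> \<noteq> - \<rho>" using AE_lborel_singleton by (intro AE_conjI)
    then show "AE \<xi> in lborel. ennreal (exp (- \<epsilon> * \<bar>\<xi>\<bar>) * ((1 + \<bar>\<xi>\<bar>) * frequency_weight \<mu> \<xi>)) \<le>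
      ennreal (K * (1 + 2 / \<rho>)) * ennreal (exp (- (\<epsilon> / 2) * \<bar>\<xi>\<bar>)) + ennreal (2 * K) * ennreal (?lo \<xi>)"
    proof eventually_elim
      case (elim \<xi>)
      then have ne: "\<bar>\<xi>\<bar> \<noteq> \<rho>" by auto
      have lo0: "0 \<le> ?lo \<xi>" by simp
      have "1 + 1 / cmod (wave \<mu> \<xi>) + 1 / cmod (wave (- \<mu>) \<xi>) \<le> 1 + 2 / \<rho> + 2 * ?lo \<xi>"
        using inverse_wave_bound[OF \<rho>(1,2) ne] inverse_wave_bound[OF \<rho>(1,3) ne] by simp
      moreover have "0 \<le> 1 + 1 / cmod (wave \<mu> \<xi>) + 1 / cmod (wave (- \<mu>) \<xi>)" by simp
      ultimately have "(exp (- \<epsilon> * \<bar>\<xi>\<bar>) * (1 + \<bar>\<xi>\<bar>) ^ 4) * (1 + 1 / cmod (wave \<mu> \<xi>) + 1 / cmod (wave (- \<mu>) \<xi>))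
        \<le> (K * exp (- (\<epsilon> / 2) * \<bar>\<xi>\<bar>)) * (1 + 2 / \<rho> + 2 * ?lo \<xi>)"
        using K by (intro mult_mono[OF poly]) auto
      also have "\<dots> = K * (1 + 2 / \<rho>) * exp (- (\<epsilon> / 2) * \<bar>\<xi>\<bar>) + exp (- (\<epsilon> / 2) * \<bar>\<xi>\<bar>) * (2 * K * ?lo \<xi>)"
        by (simp add: algebra_simps)
      also have "\<dots> \<le> K * (1 + 2 / \<rho>) * exp (- (\<epsilon> / 2) * \<bar>\<xi>\<bar>) + 1 * (2 * K * ?lo \<xi>)"
        using K lo0 assms by (intro add_left_mono mult_right_mono mult_nonneg_nonneg) auto
      finally have "exp (- \<epsilon> * \<bar>\<xi>\<bar>) * ((1 + \<bar>\<xi>\<bar>) * frequency_weight \<mu> \<xi>) \<le> K * (1 + 2 / \<rho>) * exp (- (\<epsilon> / 2) * \<bar>\<xi>\<bar>) + 2 * K * ?lo \<xi>"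
        by (simp add: frequency_weight_def power3_eq_cube power4_eq_xxxx mult_ac)
      then have "ennreal (exp (- \<epsilon> * \<bar>\<xi>\<bar>) * ((1 + \<bar>\<xi>\<bar>) * frequency_weight \<mu> \<xi>)) \<le> ennreal (K * (1 + 2 / \<rho>) * exp (- (\<epsilon> / 2) * \<bar>\<xi>\<bar>) + 2 * K * ?lo \<xi>)"
        by (rule ennreal_leI)
      also have "\<dots> = ennreal (K * (1 + 2 / \<rho>)) * ennreal (exp (- (\<epsilon> / 2) * \<bar>\<xi>\<bar>)) + ennreal (2 * K) * ennreal (?lo \<xi>)"
      proof -
        have "ennreal (a * b + a' * b') = ennreal a * ennreal b + ennreal a' * ennreal b'"
          if "0 \<le> a" "0 \<le> b" "0 \<le> a'" "0 \<le> b'" for a b a' b' :: real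
          using that by (simp add: ennreal_mult)
        then show ?thesis by (rule) (use K lo0 \<rho>(1) in simp_all)
      qed
      finally show ?case .
    qed
  qed
  also have "\<dots> = ennreal (K * (1 + 2 / \<rho>)) * (\<integral>\<^sup>+\<xi>. ennreal (exp (- (\<epsilon> / 2) * \<bar>\<xi>\<bar>)) \<partial>lborel) + ennreal (2 * K) * (\<integral>\<^sup>+\<xi>. ennreal (?lo \<xi>) \<partial>lborel)"
    by (subst nn_integral_add) (auto simp: nn_integral_cmult)
  also have "\<dots> < \<infinity>"
  proof -
    have "(\<integral>\<^sup>+\<xi>. ennreal (exp (- (\<epsilon> / 2) * \<bar>\<xi>\<bar>)) \<partial>lborel) < \<infinity>"
      using integrable_exp_abs[of "\<epsilon> / 2"] assms(1) by (auto simp: integrable_iff_bounded)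
    moreover have "(\<integral>\<^sup>+\<xi>. ennreal (?lo \<xi>) \<partial>lborel) < \<infinity>"
      using nn_integral_low_frequency[OF \<rho>(1)] by (rule le_less_trans) simp
    ultimately show ?thesis by (auto simp: ennreal_mult_less_top)
  qed
  finally show ?thesis .
qed

interpretation lebesgue_plane: sigma_finite_measure "lebesgue :: (real^2) measure"
proof
  obtain A :: "(real^2) set set" where A: "countable A" "A \<subseteq> sets lborel" "\<Union>A = space lborel" "\<forall>a\<in>A. emeasure lborel a \<noteq> \<infinity>"
    using lborel.sigma_finite_countable by blast
  then show "\<exists>A. countable A \<and> A \<subseteq> sets (lebesgue :: (real^2) measure) \<and> \<Union>A = space lebesgue \<and> (\<forall>a\<in>A. emeasure lebesgue a \<noteq> \<infinity>)"
    by (intro exI[of _ A]) (auto simp: subset_iff)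
qed

interpretation frequency_plane: pair_sigma_finite lborel "lebesgue :: (real^2) measure"
  by unfold_locales

lemma nth_measurable [measurable]:
  "(\<lambda>x::real^2. x $ i) \<in> borel_measurable lebesgue" "(\<lambda>x::real^2. x $ i) \<in> borel_measurable borel"
proof -
  show "(\<lambda>x::real^2. x $ i) \<in> borel_measurable borel"
    by (intro borel_measurable_continuous_onI continuous_intros)
  then show "(\<lambda>x::real^2. x $ i) \<in> borel_measurable lebesgue"
    by (intro measurable_completion) simp
qed

lemma vector_measurable:
  "(\<lambda>(s, t). vector [s, t] :: real^2) \<in> borel_measurable (lborel \<Otimes>\<^sub>M lborel)"
  proof -
    have eq: "(\<lambda>(s, t). vector [s, t] :: real^2) = (\<lambda>z. fst z *\<^sub>R axis 1 1 + snd z *\<^sub>R axis 2 1)"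
      by (auto simp: vec_eq_iff forall_2 axis_def)
    show ?thesis unfolding eq by measurable
  qed

lemma lborel_plane:
  "(lborel :: (real^2) measure) = distr (lborel \<Otimes>\<^sub>M lborel) borel (\<lambda>(s, t). vector [s, t])"
proof (rule lborel_eqI)
  note [measurable] = vector_measurable
  fix l u :: "real^2" assume le: "\<And>b. b \<in> Basis \<Longrightarrow> l \<bullet> b \<le> u \<bullet> b"
  have le': "l $ i \<le> u $ i" for i using le[of "axis i 1"] by (simp add: inner_axis)
  have pre: "(\<lambda>(s, t). vector [s, t] :: real^2) -` box l u \<inter> space (lborel \<Otimes>\<^sub>M lborel) = {l $ 1<..<u $ 1} \<times> {l $ 2<..<u $ 2}"
    by (auto simp: mem_box_cart forall_2 space_pair_measure)
  show "emeasure (distr (lborel \<Otimes>\<^sub>M lborel) borel (\<lambda>(s, t). vector [s, t])) (box l u) = (\<Prod>b\<in>Basis. (u - l) \<bullet> b)"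
    using le' by (subst emeasure_distr)
      (auto simp: pre lborel.emeasure_pair_measure_Times Basis_vec_def inner_axis axis_eq_axis prod.UNION_disjoint UNIV_2 ennreal_mult'' mult.commute)
qed simp

lemma integrable_plane_product:
  fixes u v :: "real \<Rightarrow> real"
  assumes "integrable lborel u" "integrable lborel v"
  shows "integrable lebesgue (\<lambda>x::real^2. u (x $ 1) * v (x $ 2))"
proof -
  have [measurable]: "u \<in> borel_measurable borel" "v \<in> borel_measurable borel" using assms by auto
  have "integrable lborel (\<lambda>x::real^2. u (x $ 1) * v (x $ 2))"
    unfolding lborel_plane
  proof (subst integrable_distr_eq[OF vector_measurable], goal_cases)
    case 2
    show ?case using lborel_pair.integrable_product[OF assms] by (simp add: split_beta')
  qed measurable
  then show ?thesis by (subst integrable_completion) auto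
qed

text \<open>
  The convolution of the indicator of \<open>{a..b}\<close> with \<open>2 \<epsilon> / (\<epsilon>\<^sup>2 + x\<^sup>2)\<close>, see \<open>interval_transform_inversion\<close>.
\<close>

definition box_weight :: "real \<Rightarrow> real \<Rightarrow> real \<Rightarrow> real \<Rightarrow> real" where
  "box_weight a b \<epsilon> x = 2 * (arctan ((x - a) / \<epsilon>) - arctan ((x - b) / \<epsilon>))"

lemma box_weight_measurable [measurable]: "box_weight a b \<epsilon> \<in> borel_measurable borel"
  unfolding box_weight_def by measurable

text \<open>
  The bound has to be uniform in \<open>\<epsilon>\<close> and square integrable in \<open>x\<close>, in order to serve as a majorant next to
  a square integrable function. Far from the interval the mean value theorem turns the difference into
  a value of the Poisson kernel.
\<close>

lemma box_weight_bounds: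
  fixes a b :: real
  assumes "a < b"
  obtains K where "K \<ge> 0" "\<And>\<epsilon> x. 0 < \<epsilon> \<Longrightarrow> \<epsilon> \<le> 1 \<Longrightarrow> \<bar>box_weight a b \<epsilon> x\<bar> \<le> K / (1 + x\<^sup>2)"
proof -
  define r where "r = 2 * (\<bar>a\<bar> + \<bar>b\<bar>) + 1"
  define K where "K = 2 * pi * (1 + r\<^sup>2) + 16 * (b - a)"
  show thesis
  proof
    show "K \<ge> 0" using assms by (simp add: K_def)
    fix \<epsilon> x :: real assume \<epsilon>: "0 < \<epsilon>" "\<epsilon> \<le> 1"
    have pos: "1 + x\<^sup>2 > 0" by (simp add: add_pos_nonneg)
    show "\<bar>box_weight a b \<epsilon> x\<bar> \<le> K / (1 + x\<^sup>2)"
    proof (cases "\<bar>x\<bar> \<le> r")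
      case True
      have "\<bar>box_weight a b \<epsilon> x\<bar> \<le> 2 * pi"
        using arctan_bounded[of "(x - a) / \<epsilon>"] arctan_bounded[of "(x - b) / \<epsilon>"] by (auto simp: box_weight_def abs_if)
      moreover have "x\<^sup>2 \<le> r\<^sup>2" using True by (metis abs_ge_zero power2_abs power_mono)
      then have "2 * pi * (1 + x\<^sup>2) \<le> K" using assms by (simp add: K_def add_increasing2)
      ultimately show ?thesis using pos
        by (metis dual_order.trans mult.commute mult_le_cancel_right_pos pos_le_divide_eq)
    next
      case False
      have "\<exists>z. z > a \<and> z < b \<and> - 2 * arctan ((x - b) / \<epsilon>) - (- 2 * arctan ((x - a) / \<epsilon>)) = (b - a) * (2 * \<epsilon> / (\<epsilon>\<^sup>2 + (x - z)\<^sup>2))"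
      proof (rule MVT2[OF assms])
        fix y
        show "DERIV (\<lambda>y. - 2 * arctan ((x - y) / \<epsilon>)) y :> 2 * \<epsilon> / (\<epsilon>\<^sup>2 + (x - y)\<^sup>2)"
          using \<epsilon> by (auto intro!: derivative_eq_intros simp: power_divide inverse_eq_divide add_divide_eq_iff divide_simps power2_eq_square)
      qed
      then obtain z where z: "a < z" "z < b" "box_weight a b \<epsilon> x = (b - a) * (2 * \<epsilon> / (\<epsilon>\<^sup>2 + (x - z)\<^sup>2))"
        by (auto simp: box_weight_def algebra_simps)
      have xz: "\<bar>x\<bar> / 2 \<le> \<bar>x - z\<bar>"
      proof -
        have "\<bar>z\<bar> \<le> \<bar>a\<bar> + \<bar>b\<bar>" using z(1,2) by linarith
        then show ?thesis using False abs_triangle_ineq[of "x - z" z] by (simp add: r_def)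
      qed
      have x4: "x\<^sup>2 / 4 \<le> (x - z)\<^sup>2" using power_mono[OF xz, of 2] by (simp add: power_divide)
      have "1 \<le> \<bar>x\<bar>" using False by (simp add: r_def)
      then have x1: "1 \<le> x\<^sup>2" by (metis one_le_power power2_abs)
      have "(1 + X) / 8 \<le> E + Q" if "X / 4 \<le> Q" "1 \<le> X" "0 \<le> E" for X Q E :: real
        using that by (simp add: field_simps)
      from this[OF x4 x1 zero_le_power2] have "(1 + x\<^sup>2) / 8 \<le> \<epsilon>\<^sup>2 + (x - z)\<^sup>2" .
      then have "2 * \<epsilon> / (\<epsilon>\<^sup>2 + (x - z)\<^sup>2) \<le> 2 * 1 / ((1 + x\<^sup>2) / 8)"
        using \<epsilon> pos by (intro frac_le) auto
      then have "box_weight a b \<epsilon> x \<le> (b - a) * (16 / (1 + x\<^sup>2))"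
        unfolding z(3) using assms by (intro mult_left_mono) auto
      moreover have "0 \<le> box_weight a b \<epsilon> x"
        unfolding z(3) using assms \<epsilon> by (intro mult_nonneg_nonneg divide_nonneg_nonneg) auto
      ultimately have "\<bar>box_weight a b \<epsilon> x\<bar> \<le> 16 * (b - a) / (1 + x\<^sup>2)" by (simp add: mult.commute)
      also have "\<dots> \<le> K / (1 + x\<^sup>2)" using pos by (intro divide_right_mono) (auto simp: K_def)
      finally show ?thesis .
    qed
  qed
qed

lemma integrable_inverse_quadratic: "integrable lborel (\<lambda>x::real. 1 / (1 + x\<^sup>2))"
proof (rule integrableI_nonneg)
  have "(\<integral>\<^sup>+x. ennreal (1 / (1 + \<bar>x - 0\<bar>\<^sup>2)) \<partial>(lborel :: real measure)) \<le> 2 * (\<integral>\<^sup>+x. ennreal (1 / (1 + x\<^sup>2)) * indicator {0..} x \<partial>lborel)"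
    by (rule nn_integral_even) measurable
  also have "(\<integral>\<^sup>+x. ennreal (1 / (1 + x\<^sup>2)) * indicator {0..} x \<partial>lborel) = ennreal (pi / 2 - arctan 0)"
  proof (rule nn_integral_FTC_atLeast)
    show "(arctan \<longlongrightarrow> pi / 2) at_top" by (rule tendsto_arctan_at_top)
  qed (auto intro!: derivative_eq_intros simp: inverse_eq_divide)
  also have "2 * \<dots> < \<infinity>" by (simp add: ennreal_mult_less_top)
  finally show "(\<integral>\<^sup>+x. ennreal (1 / (1 + x\<^sup>2)) \<partial>(lborel :: real measure)) < \<infinity>" by simp
qed auto

text \<open>
  By \<open>a b \<le> a\<^sup>2 + b\<^sup>2\<close>, since the weight is square integrable.
\<close>

lemma L2_strip_integrable:
  fixes p :: "real^2 \<Rightarrow> complex" and K l :: real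
  assumes p: "p \<in> L2" and K: "K \<ge> 0"
  shows "integrable lebesgue (\<lambda>x. cmod (p x) * (K / (1 + (x $ 1)\<^sup>2) * indicator {-l..l} (x $ 2)))"
proof (rule Bochner_Integration.integrable_bound)
  have [measurable]: "p \<in> borel_measurable lebesgue" using p by (simp add: L2_def)
  show "integrable lebesgue (\<lambda>x. (cmod (p x))\<^sup>2 + (K\<^sup>2 * (1 / (1 + (x $ 1)\<^sup>2))) * indicator {-l..l} (x $ 2))"
  proof (rule Bochner_Integration.integrable_add)
    show "integrable lebesgue (\<lambda>x. (cmod (p x))\<^sup>2)" using p by (simp add: L2_def)
    show "integrable lebesgue (\<lambda>x::real^2. (K\<^sup>2 * (1 / (1 + (x $ 1)\<^sup>2))) * indicator {-l..l} (x $ 2))"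
      by (intro integrable_plane_product integrable_mult_right integrable_inverse_quadratic integrable_real_indicator)
        (auto simp: emeasure_lborel_Icc_eq)
  qed
  show "(\<lambda>x. cmod (p x) * (K / (1 + (x $ 1)\<^sup>2) * indicator {-l..l} (x $ 2))) \<in> borel_measurable lebesgue"
    by measurable
  show "AE x in lebesgue. norm (cmod (p x) * (K / (1 + (x $ 1)\<^sup>2) * indicator {-l..l} (x $ 2))) \<le>
     norm ((cmod (p x))\<^sup>2 + (K\<^sup>2 * (1 / (1 + (x $ 1)\<^sup>2))) * indicator {-l..l} (x $ 2))"
  proof (rule AE_I2)
    fix x :: "real^2"
    define u where "u = 1 / (1 + (x $ 1)\<^sup>2)"
    define i :: real where "i = indicator {-l..l} (x $ 2)"
    have "1 + (x $ 1)\<^sup>2 > 0" by (simp add: add_pos_nonneg)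
    then have u: "0 \<le> u" "u \<le> 1" by (simp_all add: u_def pos_divide_le_eq)
    have i: "0 \<le> i" "i * i = i" by (auto simp: i_def indicator_def)
    have "2 * (cmod (p x) * (K * u * i)) \<le> (cmod (p x))\<^sup>2 + (K * u * i)\<^sup>2"
      using zero_le_power2[of "cmod (p x) - K * u * i"] by (simp add: power2_diff)
    also have "(K * u * i)\<^sup>2 = K\<^sup>2 * (u * u) * (i * i)" by (simp add: power2_eq_square mult_ac)
    also have "\<dots> = (K\<^sup>2 * i) * (u * u)" unfolding i(2) by (simp add: mult_ac)
    also have "\<dots> \<le> (K\<^sup>2 * i) * (u * 1)" using u i by (intro mult_left_mono) auto
    finally have "2 * (cmod (p x) * (K * u * i)) \<le> (cmod (p x))\<^sup>2 + K\<^sup>2 * u * i" by (simp add: mult_ac)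
    moreover have "0 \<le> cmod (p x) * (K * u * i)" using K u i by simp
    ultimately have "cmod (p x) * (K * u * i) \<le> (cmod (p x))\<^sup>2 + K\<^sup>2 * u * i" by linarith
    then show "norm (cmod (p x) * (K / (1 + (x $ 1)\<^sup>2) * indicator {-l..l} (x $ 2))) \<le>
     norm ((cmod (p x))\<^sup>2 + (K\<^sup>2 * (1 / (1 + (x $ 1)\<^sup>2))) * indicator {-l..l} (x $ 2))"
      unfolding u_def[symmetric] i_def[symmetric] using \<open>0 \<le> cmod (p x) * (K * u * i)\<close> K u i
      by (simp add: u_def[symmetric] divide_inverse[of K] inverse_eq_divide)
  qed
qed

lemma integral_norm_nn: "integrable M f \<Longrightarrow> (\<integral>\<^sup>+x. ennreal (cmod (f x)) \<partial>M) = ennreal (LINT x|M. cmod (f x))"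
  by (rule nn_integral_eq_integral) auto

text \<open>
  Multiply \<open>cutoff_estimate\<close> by \<open>e\<^sup>-\<^sup>\<epsilon>\<^sup>|\<^sup>\<xi>\<^sup>|\<close> times the transform of the indicator of \<open>{a..b}\<close> and integrate over
  \<open>\<xi>\<close>. On the left, Fubini's theorem and \<open>interval_transform_inversion\<close> produce \<open>box_weight\<close>. On the right,
  the transform is at most \<open>b - a\<close>, and \<open>resolvent_integral_bounds\<close> handles the first two terms after an
  exchange of the integrals; the third one is a finite constant times a quantity that tends to zero with \<open>n\<close>.
\<close>

theorem averaged_bound:
  fixes c :: real and \<mu> \<alpha> \<beta> :: complex and a b \<epsilon> l :: real and g :: "real \<Rightarrow> complex"
  assumes sys1: "weak_system (- c) \<alpha> p q F" and sys2: "weak_system c \<beta> q p G"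
    and p: "p \<in> L2" and q: "q \<in> L2" and F: "integrable lebesgue F" and G: "integrable lebesgue G"
    and \<mu>: "\<alpha> * \<beta> = \<mu>\<^sup>2" "\<mu> \<noteq> 0" and c: "c = 1 \<or> c = -1"
    and ab: "a < b" and \<epsilon>: "0 < \<epsilon>" "\<epsilon> \<le> 1"
    and g: "smooth g" "\<And>y. \<bar>y\<bar> > l \<Longrightarrow> g y = 0" "\<And>y. cmod (g y) \<le> 1"
  defines "\<Gamma> \<equiv> (LINT y|lborel. cmod (g y))"
  shows "cmod (LINT x|lebesgue. p x * (of_real (box_weight a b \<epsilon> (x $ 1)) * g (x $ 2))) \<le>
    (b - a) * \<Gamma> * (5 * cmod \<beta> / cmod \<mu> * (LINT x|lebesgue. cmod (F x)) + 100 * (LINT x|lebesgue. cmod (G x)))"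
proof -
  let ?T = "\<lambda>x. p x * (of_real (box_weight a b \<epsilon> (x $ 1)) * g (x $ 2))"
  let ?W = "\<lambda>\<xi>. exp (- \<epsilon> * \<bar>\<xi>\<bar>) * ((1 + \<bar>\<xi>\<bar>) * frequency_weight \<mu> \<xi>)"
  obtain \<zeta> \<zeta>1 \<zeta>2 :: "real \<Rightarrow> complex" and M :: real
    where \<zeta>: "smooth \<zeta>" "\<And>x. (\<zeta> has_vector_derivative \<zeta>1 x) (at x)" "\<And>x. (\<zeta>1 has_vector_derivative \<zeta>2 x) (at x)"
    "\<And>x. cmod (\<zeta> x) \<le> 1" "\<And>x. cmod (\<zeta>1 x) \<le> M" "\<And>x. cmod (\<zeta>2 x) \<le> M" "M \<ge> 1"
    "\<And>x. \<bar>x\<bar> > 3 \<Longrightarrow> \<zeta> x = 0" "\<And>x. \<bar>x\<bar> \<le> 1 \<Longrightarrow> \<zeta> x = 1"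
    by (rule cutoff_with_derivatives) (rule that; assumption)
  have gc: "continuous_on UNIV g" by (rule smooth_continuous) fact
  have [measurable]: "g \<in> borel_measurable borel" "\<zeta> \<in> borel_measurable borel"
    using gc smooth_continuous[OF \<zeta>(1)] by (auto intro: borel_measurable_continuous_onI)
  have [measurable]: "p \<in> borel_measurable lebesgue" using p by (simp add: L2_def)
  have [measurable]: "F \<in> borel_measurable lebesgue" "G \<in> borel_measurable lebesgue" using F G by auto
  have \<Gamma>0: "\<Gamma> \<ge> 0" by (simp add: \<Gamma>_def)
  define mass where "mass n f = (LINT x|lebesgue. indicator (square (3 * real n)) x * cmod (f x))" for n and f :: "real^2 \<Rightarrow> complex"
  define \<omega> where "\<omega> \<xi> = exp (- \<epsilon> * \<bar>\<xi>\<bar>) * interval_transform a b \<xi>" for \<xi>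
  have [measurable]: "\<omega> \<in> borel_measurable borel" unfolding \<omega>_def by measurable
  have \<omega>b: "cmod (\<omega> \<xi>) \<le> (b - a) * exp (- \<epsilon> * \<bar>\<xi>\<bar>)" for \<xi>
    using mult_left_mono[OF interval_transform_bound[of a b \<xi>], of "exp (- \<epsilon> * \<bar>\<xi>\<bar>)"] ab
    by (simp add: \<omega>_def norm_mult mult.commute)
  have \<omega>b': "cmod (\<omega> \<xi>) \<le> b - a" for \<xi>
  proof -
    have "(b - a) * exp (- \<epsilon> * \<bar>\<xi>\<bar>) \<le> (b - a) * 1" using ab \<epsilon> by (intro mult_left_mono) auto
    with \<omega>b[of \<xi>] show ?thesis by simp
  qed
  define \<phi> where "\<phi> n x = \<zeta> (x $ 1 / real n) * (\<zeta> (x $ 2 / real n) * g (x $ 2))" for n and x :: "real^2"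
  have [measurable]: "\<phi> n \<in> borel_measurable lebesgue" for n unfolding \<phi>_def by measurable
  have cw: "cut_wave \<zeta> (real n) \<xi> g x = \<phi> n x * exp (\<i> * \<xi> * (x $ 1))" for n \<xi> x
    by (simp add: cut_wave_def tensor_def \<phi>_def)
  have \<phi>b: "cmod (\<phi> n x) \<le> cmod (g (x $ 2))" for n x
  proof -
    have "cmod (\<phi> n x) = (cmod (\<zeta> (x $ 1 / real n)) * cmod (\<zeta> (x $ 2 / real n))) * cmod (g (x $ 2))"
      by (simp add: \<phi>_def norm_mult)
    also have "\<dots> \<le> (1 * 1) * cmod (g (x $ 2))" using \<zeta>(4) by (intro mult_right_mono mult_mono) auto
    finally show ?thesis by simp
  qed
  let ?T' = "\<lambda>n x. p x * \<phi> n x * of_real (box_weight a b \<epsilon> (x $ 1))"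
  \<comment> \<open>The left-hand side with the cutoffs at scale \<open>n\<close> still in place.\<close>
  define J where "J n = (LINT x|lebesgue. ?T' n x)" for n
  define \<Phi> where "\<Phi> n \<xi> = (LINT x|lebesgue. p x * cut_wave \<zeta> (real n) \<xi> g x)" for n \<xi>
  have J_eq: "J n = (LINT \<xi>|lborel. \<omega> \<xi> * \<Phi> n \<xi>)" if "n \<ge> 1" for n
  proof -
    let ?f = "\<lambda>\<xi> x. \<omega> \<xi> * (p x * (\<phi> n x * exp (\<i> * \<xi> * (x $ 1))))"
    have p\<phi>: "integrable lebesgue (\<lambda>x. cmod (p x * \<phi> n x))"
    proof (rule Bochner_Integration.integrable_bound[OF L2_square_integrable[OF p, of "3 * real n"]])
      show "(\<lambda>x. cmod (p x * \<phi> n x)) \<in> borel_measurable lebesgue" by measurable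
      show "AE x in lebesgue. norm (cmod (p x * \<phi> n x)) \<le> norm (indicator (square (3 * real n)) x * cmod (p x))"
      proof (rule AE_I2)
        fix x
        show "norm (cmod (p x * \<phi> n x)) \<le> norm (indicator (square (3 * real n)) x * cmod (p x))"
        proof (cases "x \<in> square (3 * real n)")
          case True
          have "cmod (\<phi> n x) \<le> 1" using \<phi>b[of n x] g(3)[of "x $ 2"] by simp
          then show ?thesis using True mult_left_mono[of "cmod (\<phi> n x)" 1 "cmod (p x)"] by (simp add: norm_mult)
        next
          case False
          have "3 < \<bar>y / real n\<bar> \<longleftrightarrow> 3 * real n < \<bar>y\<bar>" for y using that by (simp add: pos_less_divide_eq)
          then have "3 < \<bar>x $ 1 / real n\<bar> \<or> 3 < \<bar>x $ 2 / real n\<bar>" using False by (auto simp only: mem_square not_le de_Morgan_conj)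
          then have "\<phi> n x = 0" using \<zeta>(8) unfolding \<phi>_def by (elim disjE) simp_all
          then show ?thesis by simp
        qed
      qed
    qed
    have "integrable (lborel \<Otimes>\<^sub>M lebesgue) (\<lambda>(\<xi>, x). ?f \<xi> x)"
    proof (rule Bochner_Integration.integrable_bound)
      show "integrable (lborel \<Otimes>\<^sub>M lebesgue) (\<lambda>(\<xi>, x). ((b - a) * exp (- \<epsilon> * \<bar>\<xi>\<bar>)) * cmod (p x * \<phi> n x))"
        by (intro frequency_plane.integrable_product integrable_mult_right integrable_exp_abs \<epsilon> p\<phi>)
      show "AE z in lborel \<Otimes>\<^sub>M lebesgue. norm (case z of (\<xi>, x) \<Rightarrow> ?f \<xi> x) \<le>
         norm (case z of (\<xi>, x) \<Rightarrow> ((b - a) * exp (- \<epsilon> * \<bar>\<xi>\<bar>)) * cmod (p x * \<phi> n x))"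
      proof (rule AE_I2, clarify)
        fix \<xi> :: real and x :: "real^2"
        have "norm (?f \<xi> x) = cmod (\<omega> \<xi>) * cmod (p x * \<phi> n x)" by (simp add: norm_mult)
        also have "\<dots> \<le> ((b - a) * exp (- \<epsilon> * \<bar>\<xi>\<bar>)) * cmod (p x * \<phi> n x)"
          using \<omega>b by (intro mult_right_mono) auto
        finally show "norm (?f \<xi> x) \<le> norm (((b - a) * exp (- \<epsilon> * \<bar>\<xi>\<bar>)) * cmod (p x * \<phi> n x))" by simp
      qed
    qed measurable
    then have "(LINT x|lebesgue. LINT \<xi>|lborel. ?f \<xi> x) = (LINT \<xi>|lborel. LINT x|lebesgue. ?f \<xi> x)"
      by (rule frequency_plane.Fubini_integral)
    moreover have "(LINT \<xi>|lborel. LINT x|lebesgue. ?f \<xi> x) = (LINT \<xi>|lborel. \<omega> \<xi> * \<Phi> n \<xi>)"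
      unfolding \<Phi>_def cw by (simp only: integral_mult_right_zero)
    moreover have "(LINT \<xi>|lborel. ?f \<xi> x) = ?T' n x" for x
    proof -
      have "(LINT \<xi>|lborel. ?f \<xi> x) = (LINT \<xi>|lborel. (p x * \<phi> n x) * (exp (- \<epsilon> * \<bar>\<xi>\<bar>) * interval_transform a b \<xi> * exp (\<i> * \<xi> * (x $ 1))))"
        by (intro Bochner_Integration.integral_cong refl) (simp add: \<omega>_def)
      also have "\<dots> = (p x * \<phi> n x) * of_real (box_weight a b \<epsilon> (x $ 1))"
        unfolding integral_mult_right_zero box_weight_def
        by (subst interval_transform_inversion) (use ab \<epsilon> in auto)
      finally show ?thesis .
    qed
    ultimately show ?thesis by (simp add: J_def)
  qed
  define nF where "nF = (LINT x|lebesgue. cmod (F x))"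
  define nG where "nG = (LINT x|lebesgue. cmod (G x))"
  have nFG: "nF \<ge> 0" "nG \<ge> 0" by (simp_all add: nF_def nG_def)
  define A where "A \<xi> = (\<integral>\<^sup>+x. ennreal (cmod (F x) * cmod (resolvent \<mu> \<xi> g (x $ 2))) \<partial>lebesgue)" for \<xi>
  define A' where "A' \<xi> = (\<integral>\<^sup>+x. ennreal (cmod (G x) * cmod (resolvent_d2 c \<mu> \<xi> g (x $ 2))) \<partial>lebesgue)" for \<xi>
  have Am [measurable]: "A \<in> borel_measurable borel" "A' \<in> borel_measurable borel"
  proof -
    have "(\<lambda>\<xi>. (\<integral>\<^sup>+x. ennreal (cmod (F x) * cmod (resolvent \<mu> \<xi> g (x $ 2))) \<partial>lebesgue)) \<in> borel_measurable lborel"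
      by (intro lebesgue_plane.borel_measurable_nn_integral) measurable
    then show "A \<in> borel_measurable borel" by (simp add: A_def[abs_def])
    have "(\<lambda>\<xi>. (\<integral>\<^sup>+x. ennreal (cmod (G x) * cmod (resolvent_d2 c \<mu> \<xi> g (x $ 2))) \<partial>lebesgue)) \<in> borel_measurable lborel"
      by (intro lebesgue_plane.borel_measurable_nn_integral) measurable
    then show "A' \<in> borel_measurable borel" by (simp add: A'_def[abs_def])
  qed
  have tonelli: "(\<integral>\<^sup>+\<xi>. (\<integral>\<^sup>+x. ennreal (cmod (f x) * cmod (r \<xi> (x $ 2))) \<partial>lebesgue) \<partial>lborel) \<le> ennreal (C * (LINT x|lebesgue. cmod (f x)))"
    if f: "integrable lebesgue f" and C: "C \<ge> 0" and r: "(\<lambda>(\<xi>, y). r \<xi> y) \<in> borel_measurable (borel \<Otimes>\<^sub>M borel)"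
      and bound: "\<And>y. (\<integral>\<^sup>+\<xi>. ennreal (cmod (r \<xi> y)) \<partial>lborel) \<le> ennreal C"
    for f :: "real^2 \<Rightarrow> complex" and C and r :: "real \<Rightarrow> real \<Rightarrow> complex"
  proof -
    have [measurable]: "f \<in> borel_measurable lebesgue" using f by auto
    note [measurable] = r
    have "(\<integral>\<^sup>+\<xi>. (\<integral>\<^sup>+x. ennreal (cmod (f x) * cmod (r \<xi> (x $ 2))) \<partial>lebesgue) \<partial>lborel) =
       (\<integral>\<^sup>+x. (\<integral>\<^sup>+\<xi>. ennreal (cmod (f x) * cmod (r \<xi> (x $ 2))) \<partial>lborel) \<partial>lebesgue)"
      by (rule frequency_plane.Fubini'[symmetric]) measurable
    also have "\<dots> = (\<integral>\<^sup>+x. ennreal (cmod (f x)) * (\<integral>\<^sup>+\<xi>. ennreal (cmod (r \<xi> (x $ 2))) \<partial>lborel) \<partial>lebesgue)"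
      by (simp add: ennreal_mult nn_integral_cmult)
    also have "\<dots> \<le> (\<integral>\<^sup>+x. ennreal (cmod (f x)) * ennreal C \<partial>lebesgue)"
      using bound by (intro nn_integral_mono mult_left_mono) auto
    also have "\<dots> = (\<integral>\<^sup>+x. ennreal (cmod (f x)) \<partial>lebesgue) * ennreal C"
      by (rule nn_integral_multc) measurable
    also have "\<dots> = ennreal (C * (LINT x|lebesgue. cmod (f x)))"
      using C by (simp add: integral_norm_nn[OF f] ennreal_mult' mult.commute)
    finally show ?thesis .
  qed
  have AI: "(\<integral>\<^sup>+\<xi>. A \<xi> \<partial>lborel) \<le> ennreal (5 / cmod \<mu> * \<Gamma> * nF)"
    unfolding A_def nF_def
  proof (rule tonelli[OF F])
    show "(\<integral>\<^sup>+\<xi>. ennreal (cmod (resolvent \<mu> \<xi> g y)) \<partial>lborel) \<le> ennreal (5 / cmod \<mu> * \<Gamma>)" for y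
      unfolding \<Gamma>_def by (rule resolvent_integral_bounds(1)[OF \<mu>(2) c gc g(2)])
  qed (use \<Gamma>0 in simp, measurable)
  have A'I: "(\<integral>\<^sup>+\<xi>. A' \<xi> \<partial>lborel) \<le> ennreal (100 * \<Gamma> * nG)"
    unfolding A'_def nG_def
  proof (rule tonelli[OF G])
    show "(\<integral>\<^sup>+\<xi>. ennreal (cmod (resolvent_d2 c \<mu> \<xi> g y)) \<partial>lborel) \<le> ennreal (100 * \<Gamma>)" for y
      unfolding \<Gamma>_def by (rule resolvent_integral_bounds(2)[OF \<mu>(2) c gc g(2)])
  qed (use \<Gamma>0 in simp, measurable)
  define K where "K = 3 * (\<Gamma> * (1 + 1 / cmod \<mu>))"
  have K: "K \<ge> 0" using \<Gamma>0 by (simp add: K_def)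
  define W where "W = (\<integral>\<^sup>+\<xi>. ennreal (?W \<xi>) \<partial>lborel)"
  have Wfin: "W < \<infinity>" unfolding W_def by (rule frequency_weight_finite[OF \<epsilon>(1) \<mu>(2)])
  define w where "w = (b - a) * (M * (6 + 2 * M) * K) * enn2real W"
  \<comment> \<open>The size of the truncation error at scale \<open>n\<close>, up to a constant.\<close>
  define \<delta> where "\<delta> n = (mass n p + cmod \<beta> * mass n q) / real n" for n
  have mass0: "mass n f \<ge> 0" for n f by (simp add: mass_def)
  have \<delta>0: "\<delta> n \<ge> 0" for n using mass0 by (simp add: \<delta>_def)
  define R where "R = (b - a) * \<Gamma> * (5 * cmod \<beta> / cmod \<mu> * nF + 100 * nG)"
  have R0: "R \<ge> 0" using ab \<Gamma>0 nFG by (simp add: R_def)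
  let ?err = "\<lambda>n \<xi>. ennreal ((b - a) * (M * (6 + 2 * M) * K) * \<delta> n) * ennreal (?W \<xi>)"
  let ?bd = "\<lambda>n \<xi>. ennreal ((b - a) * cmod \<beta>) * A \<xi> + (ennreal (b - a) * A' \<xi> + ?err n \<xi>)"
  let ?E = "\<lambda>(n::nat) \<xi>. M / n * (6 + 4 * \<bar>\<xi>\<bar> + 2 * M) * (K * frequency_weight \<mu> \<xi>)"
  have Jb: "cmod (J n) \<le> R + \<delta> n * w" if n: "n \<ge> 1" for n
  proof -
    have pointwise: "ennreal (cmod (\<omega> \<xi> * \<Phi> n \<xi>)) \<le> ?bd n \<xi>"
      if nz: "wave \<mu> \<xi> \<noteq> 0" "wave (- \<mu>) \<xi> \<noteq> 0" for \<xi>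
    proof -
      have cc: "(complex_of_real c)\<^sup>2 = 1" "cmod (complex_of_real c) = 1" using c by auto
      obtain h1 h2 k1 k2 :: "real \<Rightarrow> complex" where hk:
        "smooth (resolvent \<mu> \<xi> g)" "\<And>x. (resolvent \<mu> \<xi> g has_vector_derivative h1 x) (at x)" "\<And>x. (h1 has_vector_derivative h2 x) (at x)"
        "smooth (resolvent_d2 c \<mu> \<xi> g)" "\<And>x. (resolvent_d2 c \<mu> \<xi> g has_vector_derivative k1 x) (at x)" "\<And>x. (k1 has_vector_derivative k2 x) (at x)"
        "\<And>x. resolvent_d2 c \<mu> \<xi> g x = - \<xi>\<^sup>2 * resolvent \<mu> \<xi> g x + 2 * complex_of_real c * \<xi> * h1 x - h2 x"
        "\<And>x. - \<xi>\<^sup>2 * resolvent_d2 c \<mu> \<xi> g x - 2 * complex_of_real c * \<xi> * k1 x - k2 x = \<mu>\<^sup>2 * resolvent \<mu> \<xi> g x + g x"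
        "\<And>x. cmod (resolvent \<mu> \<xi> g x) \<le> K * frequency_weight \<mu> \<xi>" "\<And>x. cmod (h1 x) \<le> K * frequency_weight \<mu> \<xi>"
        "\<And>x. cmod (resolvent_d2 c \<mu> \<xi> g x) \<le> K * frequency_weight \<mu> \<xi>" "\<And>x. cmod (k1 x) \<le> K * frequency_weight \<mu> \<xi>"
        by (rule resolvent_solves[where l = l, OF \<mu>(2) cc g(1,2) nz, folded \<Gamma>_def, folded K_def]) (assumption, (rule that; assumption))
      have sys1': "weak_system (- complex_of_real c) \<alpha> p q F" using sys1 by simp
      note est = cutoff_estimate[OF sys1' sys2 p q F G \<mu>(1) cc(2) \<zeta>(1-8) _ hk(1-6) g(1) hk(7-12), of "real n"]
      have fw0: "frequency_weight \<mu> \<xi> \<ge> 0" by (simp add: frequency_weight_def)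
      have E: "ennreal (cmod (\<Phi> n \<xi>)) \<le> ennreal (cmod \<beta>) * A \<xi> + A' \<xi>
          + ennreal (M / n * (6 + 4 * \<bar>\<xi>\<bar> + 2 * M) * (K * frequency_weight \<mu> \<xi>) * (mass n p + cmod \<beta> * mass n q))"
        using est n unfolding \<Phi>_def A_def A'_def mass_def by simp
      define m where "m = mass n p + cmod \<beta> * mass n q"
      have m0: "m \<ge> 0" using mass0 by (simp add: m_def)
      have err: "cmod (\<omega> \<xi>) * (?E n \<xi> * m)
          \<le> (b - a) * (M * (6 + 2 * M) * K) * \<delta> n * (?W \<xi>)"
      proof -
        have poly: "6 + 4 * \<bar>\<xi>\<bar> + 2 * M \<le> (6 + 2 * M) * (1 + \<bar>\<xi>\<bar>)"
        proof -
          have "0 \<le> 2 * \<bar>\<xi>\<bar> + 2 * M * \<bar>\<xi>\<bar>" using \<zeta>(7) by simp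
          then show ?thesis by (simp add: algebra_simps)
        qed
        have "cmod (\<omega> \<xi>) * (?E n \<xi> * m) \<le>
          ((b - a) * exp (- \<epsilon> * \<bar>\<xi>\<bar>)) * (M / n * ((6 + 2 * M) * (1 + \<bar>\<xi>\<bar>)) * (K * frequency_weight \<mu> \<xi>) * m)"
          using \<zeta>(7) K fw0 m0 ab by (intro mult_mono[OF \<omega>b] mult_right_mono mult_left_mono poly) auto
        also have "\<dots> = (b - a) * (M * (6 + 2 * M) * K) * \<delta> n * (?W \<xi>)"
          unfolding \<delta>_def m_def[symmetric] by simp
        finally show ?thesis .
      qed
      have "ennreal (cmod (\<omega> \<xi> * \<Phi> n \<xi>)) = ennreal (cmod (\<omega> \<xi>)) * ennreal (cmod (\<Phi> n \<xi>))"
        by (simp add: norm_mult ennreal_mult)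
      also have "\<dots> \<le> ennreal (cmod (\<omega> \<xi>)) * (ennreal (cmod \<beta>) * A \<xi> + A' \<xi>
          + ennreal (?E n \<xi> * m))"
        unfolding m_def by (intro mult_left_mono E) simp
      also have "\<dots> = ennreal (cmod (\<omega> \<xi>)) * (ennreal (cmod \<beta>) * A \<xi>) + (ennreal (cmod (\<omega> \<xi>)) * A' \<xi>
          + ennreal (cmod (\<omega> \<xi>)) * ennreal (?E n \<xi> * m))"
        by (simp add: distrib_left add.assoc)
      also have "\<dots> \<le> ennreal (b - a) * (ennreal (cmod \<beta>) * A \<xi>) + (ennreal (b - a) * A' \<xi>
       + ?err n \<xi>)"
      proof (intro add_mono mult_right_mono)
        show "ennreal (cmod (\<omega> \<xi>)) * ennreal (?E n \<xi> * m)
           \<le> ?err n \<xi>"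
          unfolding ennreal_mult'[OF norm_ge_zero, symmetric]
          by (subst ennreal_mult''[symmetric]) (use err fw0 in \<open>auto intro!: ennreal_leI mult_nonneg_nonneg\<close>)
      qed (use \<omega>b' in \<open>auto intro: ennreal_leI\<close>)
      also have "ennreal (b - a) * (ennreal (cmod \<beta>) * A \<xi>) = ennreal ((b - a) * cmod \<beta>) * A \<xi>"
        using ab by (simp add: ennreal_mult mult.assoc)
      finally show ?thesis .
    qed
    have "ennreal (cmod (J n)) \<le> (\<integral>\<^sup>+\<xi>. ennreal (cmod (\<omega> \<xi> * \<Phi> n \<xi>)) \<partial>lborel)"
      unfolding J_eq[OF n]
    proof (cases "integrable lborel (\<lambda>\<xi>. \<omega> \<xi> * \<Phi> n \<xi>)")
      case True
      then show "ennreal (cmod (LINT \<xi>|lborel. \<omega> \<xi> * \<Phi> n \<xi>)) \<le> (\<integral>\<^sup>+\<xi>. ennreal (cmod (\<omega> \<xi> * \<Phi> n \<xi>)) \<partial>lborel)"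
        by (rule integral_norm_bound_ennreal)
    qed (simp add: not_integrable_integral_eq)
    also have "\<dots> \<le> (\<integral>\<^sup>+\<xi>. ?bd n \<xi> \<partial>lborel)"
    proof (rule nn_integral_mono_AE)
      show "AE \<xi> in lborel. ennreal (cmod (\<omega> \<xi> * \<Phi> n \<xi>)) \<le> ?bd n \<xi>"
        using AE_wave_nonzero[of \<mu>] AE_wave_nonzero[of "- \<mu>"] by eventually_elim (rule pointwise)
    qed
    also have "\<dots> = ennreal ((b - a) * cmod \<beta>) * (\<integral>\<^sup>+\<xi>. A \<xi> \<partial>lborel) + (ennreal (b - a) * (\<integral>\<^sup>+\<xi>. A' \<xi> \<partial>lborel)
       + ennreal ((b - a) * (M * (6 + 2 * M) * K) * \<delta> n) * W)"
      unfolding W_def by (simp add: nn_integral_add nn_integral_cmult)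
    also have "\<dots> \<le> ennreal ((b - a) * cmod \<beta>) * ennreal (5 / cmod \<mu> * \<Gamma> * nF) + (ennreal (b - a) * ennreal (100 * \<Gamma> * nG)
       + ennreal ((b - a) * (M * (6 + 2 * M) * K) * \<delta> n) * ennreal (enn2real W))"
      using Wfin by (intro add_mono mult_left_mono AI A'I) auto
    also have "\<dots> = ennreal ((b - a) * cmod \<beta> * (5 / cmod \<mu> * \<Gamma> * nF) + ((b - a) * (100 * \<Gamma> * nG) + (b - a) * (M * (6 + 2 * M) * K) * \<delta> n * enn2real W))"
    proof -
      have "ennreal x1 * ennreal y1 + (ennreal x2 * ennreal y2 + ennreal x3 * ennreal y3) = ennreal (x1 * y1 + (x2 * y2 + x3 * y3))"
        if "0 \<le> x1" "0 \<le> x2" "0 \<le> x3" "0 \<le> y1" "0 \<le> y2" "0 \<le> y3" for x1 x2 x3 y1 y2 y3 :: real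
        using that by (simp add: ennreal_mult)
      then show ?thesis by (rule) (use ab \<Gamma>0 nFG K \<zeta>(7) \<delta>0 in \<open>auto intro!: mult_nonneg_nonneg\<close>)
    qed
    also have "(b - a) * cmod \<beta> * (5 / cmod \<mu> * \<Gamma> * nF) + ((b - a) * (100 * \<Gamma> * nG) + (b - a) * (M * (6 + 2 * M) * K) * \<delta> n * enn2real W) = R + \<delta> n * w"
      by (simp add: R_def w_def algebra_simps)
    finally have "ennreal (cmod (J n)) \<le> ennreal (R + \<delta> n * w)" .
    moreover have "0 \<le> R + \<delta> n * w" using R0 \<delta>0 ab K \<zeta>(7) by (auto simp: w_def intro!: add_nonneg_nonneg mult_nonneg_nonneg)
    ultimately show ?thesis by (simp add: ennreal_le_iff)
  qed
  have \<delta>lim: "\<delta> \<longlonglongrightarrow> 0"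
  proof -
    have "(\<lambda>n. mass n p / real n + cmod \<beta> * (mass n q / real n)) \<longlonglongrightarrow> 0 + cmod \<beta> * 0"
      unfolding mass_def by (intro tendsto_intros L2_mass_decay p q)
    then show ?thesis by (simp add: \<delta>_def[abs_def] add_divide_distrib)
  qed
  obtain D where D: "D \<ge> 0" "\<And>\<epsilon> x. 0 < \<epsilon> \<Longrightarrow> \<epsilon> \<le> 1 \<Longrightarrow> \<bar>box_weight a b \<epsilon> x\<bar> \<le> D / (1 + x\<^sup>2)"
    using box_weight_bounds[OF ab] by blast
  let ?dom = "\<lambda>x. cmod (p x) * (D / (1 + (x $ 1)\<^sup>2) * indicator {-l..l} (x $ 2))"
  have "J \<longlonglongrightarrow> (LINT x|lebesgue. ?T x)"
    unfolding J_def
  proof (rule integral_dominated_convergence)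
    show "integrable lebesgue (\<lambda>x. ?dom x)"
      by (rule L2_strip_integrable[OF p D(1)])
    show "AE x in lebesgue. (\<lambda>n. ?T' n x) \<longlonglongrightarrow> ?T x"
    proof (rule AE_I2)
      fix x :: "real^2"
      have "\<forall>\<^sub>F n in sequentially. ?T' n x = ?T x"
        using eventually_ge_at_top[of "nat \<lceil>\<bar>x $ 1\<bar>\<rceil> + nat \<lceil>\<bar>x $ 2\<bar>\<rceil> + 1"]
      proof eventually_elim
        case (elim n)
        then have "\<bar>x $ 1\<bar> \<le> real n" "\<bar>x $ 2\<bar> \<le> real n" "real n > 0" by linarith+
        then have "\<bar>x $ 1 / real n\<bar> \<le> 1" "\<bar>x $ 2 / real n\<bar> \<le> 1" by (simp_all add: field_simps)
        then show ?case by (simp add: \<phi>_def \<zeta>(9))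
      qed
      then show "(\<lambda>n. ?T' n x) \<longlonglongrightarrow> ?T x"
        by (rule tendsto_eventually)
    qed
    show "AE x in lebesgue. norm (?T' n x) \<le> ?dom x" for n
    proof (rule AE_I2)
      fix x :: "real^2"
      have "cmod (\<phi> n x) \<le> indicator {-l..l} (x $ 2)"
      proof (cases "\<bar>x $ 2\<bar> > l")
        case True
        then show ?thesis using \<phi>b[of n x] g(2) by simp
      next
        case False
        then have "x $ 2 \<in> {-l..l}" by auto
        then show ?thesis using \<phi>b[of n x] g(3)[of "x $ 2"] by simp
      qed
      then have "cmod (p x) * (\<bar>box_weight a b \<epsilon> (x $ 1)\<bar> * cmod (\<phi> n x)) \<le> ?dom x"
        using D(2)[OF \<epsilon>] D(1) by (intro mult_left_mono mult_mono) (auto intro!: divide_nonneg_nonneg)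
      then show "norm (?T' n x) \<le> ?dom x"
        by (simp add: norm_mult mult_ac)
    qed
  qed measurable
  then have "(\<lambda>n. cmod (J n)) \<longlonglongrightarrow> cmod (LINT x|lebesgue. ?T x)"
    by (rule tendsto_norm)
  moreover have "(\<lambda>n. R + \<delta> n * w) \<longlonglongrightarrow> R + 0 * w" by (intro tendsto_intros \<delta>lim)
  ultimately have "cmod (LINT x|lebesgue. ?T x) \<le> R + 0 * w"
    by (rule LIMSEQ_le) (use Jb in blast)
  then show ?thesis by (simp add: R_def nF_def nG_def)
qed

section \<open>Pointwise bounds\<close>

lemma AE_nth_neq: "AE x in lebesgue. (x::real^2) $ i \<noteq> a"
proof -
  have "negligible {x::real^2. x $ i = a}"
    using negligible_standard_hyperplane[of "axis i (1::real)" a] by (simp add: cart_eq_inner_axis)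
  then have "{x::real^2. x $ i = a} \<in> null_sets lebesgue" by (simp add: negligible_iff_null_sets)
  from AE_not_in[OF this] show ?thesis by simp
qed

lemma box_weight_tendsto:
  assumes "a < b" "t \<noteq> a" "t \<noteq> b"
  shows "(\<lambda>n. box_weight a b (1 / (real n + 1)) t) \<longlonglongrightarrow> 2 * pi * indicator {a..b} t"
proof -
  have lim: "(\<lambda>n. arctan ((t - r) * (real n + 1))) \<longlonglongrightarrow> (if t > r then pi / 2 else - (pi / 2))" if "t \<noteq> r" for r
  proof (cases "t > r")
    case True
    have "filterlim (\<lambda>n. (t - r) * (real n + 1)) at_top sequentially"
      using True by real_asymp
    from filterlim_compose[OF tendsto_arctan_at_top this] True show ?thesis by simp
  next
    case False
    then have "t - r < 0" using that by simp
    then have "filterlim (\<lambda>n. (t - r) * (real n + 1)) at_bot sequentially"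
      by real_asymp
    from filterlim_compose[OF tendsto_arctan_at_bot this] False show ?thesis by simp
  qed
  have "(\<lambda>n. 2 * (arctan ((t - a) * (real n + 1)) - arctan ((t - b) * (real n + 1)))) \<longlonglongrightarrow>
     2 * ((if t > a then pi / 2 else - (pi / 2)) - (if t > b then pi / 2 else - (pi / 2)))"
    using assms by (intro tendsto_intros lim)
  also have "2 * ((if t > a then pi / 2 else - (pi / 2)) - (if t > b then pi / 2 else - (pi / 2))) = 2 * pi * indicator {a..b} t"
    using assms by (auto simp: indicator_def)
  finally show ?thesis by (simp add: box_weight_def)
qed

text \<open>
  The bound that the equations \<open>\<alpha> p + L\<^sub>-\<^sub>c q = - F\<close> and \<open>\<beta> q + L\<^sub>c p = - G\<close> with \<open>\<alpha> \<beta> = \<mu>\<^sup>2\<close> impose on \<open>p\<close>.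
\<close>

definition source_size :: "complex \<Rightarrow> complex \<Rightarrow> (real^2 \<Rightarrow> complex) \<Rightarrow> (real^2 \<Rightarrow> complex) \<Rightarrow> real" where
  "source_size \<mu> \<beta> F G =
     5 * cmod \<beta> / cmod \<mu> * (LINT x|lebesgue. cmod (F x)) + 100 * (LINT x|lebesgue. cmod (G x))"

lemma source_size_nonneg: "source_size \<mu> \<beta> F G \<ge> 0"
  by (simp add: source_size_def)

context
  fixes c :: real and \<mu> \<alpha> \<beta> :: complex and p q F G :: "real^2 \<Rightarrow> complex"
  assumes sys1: "weak_system (- c) \<alpha> p q F" and sys2: "weak_system c \<beta> q p G"
    and p: "p \<in> L2" and q: "q \<in> L2" and F: "integrable lebesgue F" and G: "integrable lebesgue G"
    and \<mu>: "\<alpha> * \<beta> = \<mu>\<^sup>2" "\<mu> \<noteq> 0" and c: "c = 1 \<or> c = -1"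
begin

text \<open>
  In \<open>averaged_bound\<close> let \<open>\<epsilon>\<close> tend to zero while \<open>g\<close> runs through smooth approximations of the indicator of
  \<open>{d..e}\<close>. The weights tend to \<open>2 \<pi>\<close> times the indicator of the box.
\<close>

lemma box_integral_bound:
  fixes a b d e :: real
  assumes ab: "a < b" and de: "d < e"
  shows "cmod (LINT x|lebesgue. p x * of_real (indicator {a..b} (x $ 1) * indicator {d..e} (x $ 2))) \<le> (b - a) * (e - d) * source_size \<mu> \<beta> F G"
proof -
  obtain \<theta> :: "real \<Rightarrow> real" where \<theta>: "smooth (\<lambda>x. of_real (\<theta> x))" "mono \<theta>"
    "\<And>x. x \<le> -1 \<Longrightarrow> \<theta> x = 0" "\<And>x. x \<ge> 1 \<Longrightarrow> \<theta> x = 1" using smooth_step_exists by blast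
  have \<theta>01: "0 \<le> \<theta> x" "\<theta> x \<le> 1" for x
  proof -
    have "\<theta> (min x (-1)) \<le> \<theta> x" "\<theta> x \<le> \<theta> (max x 1)" using \<theta>(2) by (auto intro: monoD)
    then show "0 \<le> \<theta> x" "\<theta> x \<le> 1" using \<theta>(3)[of "min x (-1)"] \<theta>(4)[of "max x 1"] by simp_all
  qed
  define N where "N n = real n + 1" for n
  have N: "N n \<ge> 1" "N n > 0" for n by (simp_all add: N_def)
  define \<gamma> where "\<gamma> n t = \<theta> (N n * (t - d)) - \<theta> (N n * (t - e))" for n t
  define g where "g n t = complex_of_real (\<gamma> n t)" for n t
  have \<gamma>0: "0 \<le> \<gamma> n t" for n t
    unfolding \<gamma>_def using de N(2)[of n] by (auto intro!: monoD[OF \<theta>(2)] mult_left_mono)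
  have \<gamma>1: "\<gamma> n t \<le> 1" for n t
    unfolding \<gamma>_def using \<theta>01(2)[of "N n * (t - d)"] \<theta>01(1)[of "N n * (t - e)"] by linarith
  have gs: "smooth (g n)" for n
  proof -
    have "smooth (\<lambda>t. of_real (\<theta> (N n * t + (- N n * d))) - of_real (\<theta> (N n * t + (- N n * e))))"
      by (intro smooth_diff smooth_affine[OF \<theta>(1)])
    then show ?thesis by (simp add: g_def[abs_def] \<gamma>_def algebra_simps)
  qed
  have \<gamma>supp: "\<gamma> n t = 0" if "t < d - 1 / N n \<or> t > e + 1 / N n" for n t
    using that
  proof
    assume "t < d - 1 / N n"
    then have 1: "N n * (t - d) \<le> -1" using N(2)[of n] by (simp add: field_simps)
    have "N n * (t - e) \<le> N n * (t - d)" using de N(2)[of n] by (intro mult_left_mono) auto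
    with 1 show ?thesis by (simp add: \<gamma>_def \<theta>(3))
  next
    assume "t > e + 1 / N n"
    then have 1: "N n * (t - e) \<ge> 1" using N(2)[of n] by (simp add: field_simps)
    have "N n * (t - e) \<le> N n * (t - d)" using de N(2)[of n] by (intro mult_left_mono) auto
    with 1 show ?thesis by (simp add: \<gamma>_def \<theta>(4))
  qed
  have N1: "1 / N n \<le> 1" for n using N(1)[of n] by simp
  define l where "l = \<bar>d\<bar> + \<bar>e\<bar> + 1"
  have gsupp: "g n t = 0" if "\<bar>t\<bar> > l" for n t
  proof -
    have "t < d - 1 / N n \<or> t > e + 1 / N n" using that N1[of n] unfolding l_def by linarith
    then show ?thesis using \<gamma>supp by (simp add: g_def)
  qed
  have gb: "cmod (g n t) \<le> indicator {d - 1 / N n..e + 1 / N n} t" for n t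
    using \<gamma>supp[of t n] \<gamma>0[of n t] \<gamma>1[of n t] by (auto simp: g_def indicator_def not_le)
  have gb1: "cmod (g n t) \<le> 1" for n t using \<gamma>0 \<gamma>1 by (simp add: g_def)
  have mass: "(LINT t|lborel. cmod (g n t)) \<le> (e - d) + 2 / N n" for n
  proof -
    have "(LINT t|lborel. cmod (g n t)) \<le> (LINT t|lborel. indicator {d - 1 / N n..e + 1 / N n} t)"
    proof (rule integral_mono[OF _ _ gb])
      show "integrable lborel (\<lambda>t. cmod (g n t))"
        by (intro integrable_norm integrable_compact_support[OF smooth_continuous[OF gs] gsupp])
    qed (auto intro!: integrable_real_indicator simp: emeasure_lborel_Icc_eq)
    also have "\<dots> = (e - d) + 2 / N n"
    proof -
      have "0 < 1 / N n" using N(2)[of n] by simp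
      then have "d - 1 / N n \<le> e + 1 / N n" using de by linarith
      then show ?thesis by (simp add: divide_inverse)
    qed
    finally show ?thesis .
  qed
  have glim: "(\<lambda>n. g n t) \<longlonglongrightarrow> of_real (indicator {d..e} t)" if t: "t \<noteq> d" "t \<noteq> e" for t
  proof (rule tendsto_eventually)
    have big: "\<forall>\<^sub>F n in sequentially. 1 / r < N n" for r :: real
      unfolding N_def by real_asymp
    show "\<forall>\<^sub>F n in sequentially. g n t = of_real (indicator {d..e} t)"
      using big[of "\<bar>t - d\<bar>"] big[of "\<bar>t - e\<bar>"]
    proof eventually_elim
      case (elim n)
      have 1: "1 < N n * \<bar>t - d\<bar>" "1 < N n * \<bar>t - e\<bar>" using elim t by (simp_all add: pos_divide_less_eq)
      consider "t < d" | "d < t" "t < e" | "t > e" using t by linarith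
      then have "\<gamma> n t = indicator {d..e} t"
      proof cases
        case 1
        then have "N n * (t - d) \<le> -1" "N n * (t - e) \<le> -1"
          using \<open>1 < N n * \<bar>t - d\<bar>\<close> \<open>1 < N n * \<bar>t - e\<bar>\<close> de by (simp_all add: abs_if algebra_simps)
        then show ?thesis using 1 by (simp add: \<gamma>_def \<theta>(3))
      next
        case 2
        then have "N n * (t - d) \<ge> 1" "N n * (t - e) \<le> -1"
          using \<open>1 < N n * \<bar>t - d\<bar>\<close> \<open>1 < N n * \<bar>t - e\<bar>\<close> by (simp_all add: abs_if algebra_simps)
        then show ?thesis using 2 by (simp add: \<gamma>_def \<theta>(3,4))
      next
        case 3
        then have "N n * (t - d) \<ge> 1" "N n * (t - e) \<ge> 1"
          using \<open>1 < N n * \<bar>t - d\<bar>\<close> \<open>1 < N n * \<bar>t - e\<bar>\<close> de by (simp_all add: abs_if algebra_simps)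
        then show ?thesis using 3 by (simp add: \<gamma>_def \<theta>(4))
      qed
      then show ?case by (simp add: g_def)
    qed
  qed
  have gm [measurable]: "g n \<in> borel_measurable borel" for n
    using smooth_continuous[OF gs] by (rule borel_measurable_continuous_onI)
  have pm [measurable]: "p \<in> borel_measurable lebesgue" using p by (simp add: L2_def)
  obtain D where D: "D \<ge> 0" "\<And>\<epsilon> x. 0 < \<epsilon> \<Longrightarrow> \<epsilon> \<le> 1 \<Longrightarrow> \<bar>box_weight a b \<epsilon> x\<bar> \<le> D / (1 + x\<^sup>2)"
    using box_weight_bounds[OF ab] by blast
  let ?T = "\<lambda>n x. p x * (of_real (box_weight a b (1 / N n) (x $ 1)) * g n (x $ 2))"
  let ?L = "\<lambda>x. p x * (of_real (2 * pi * indicator {a..b} (x $ 1)) * of_real (indicator {d..e} (x $ 2)))"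
  let ?I = "LINT x|lebesgue. p x * of_real (indicator {a..b} (x $ 1) * indicator {d..e} (x $ 2))"
  let ?dom = "\<lambda>x. cmod (p x) * (D / (1 + (x $ 1)\<^sup>2) * indicator {-l..l} (x $ 2))"
  define J where "J n = (LINT x|lebesgue. ?T n x)" for n
  have "J \<longlonglongrightarrow> (LINT x|lebesgue. ?L x)"
    unfolding J_def
  proof (rule integral_dominated_convergence)
    show "integrable lebesgue (\<lambda>x. ?dom x)"
      by (rule L2_strip_integrable[OF p D(1)])
    show "AE x in lebesgue. (\<lambda>n. ?T n x) \<longlonglongrightarrow>
       ?L x"
      using AE_nth_neq[of 1 a] AE_nth_neq[of 1 b] AE_nth_neq[of 2 d] AE_nth_neq[of 2 e]
      by eventually_elim (unfold N_def, intro tendsto_intros box_weight_tendsto ab glim[unfolded N_def])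
    show "AE x in lebesgue. norm (?T n x) \<le>
       ?dom x" for n
    proof (rule AE_I2)
      fix x :: "real^2"
      have "cmod (g n (x $ 2)) \<le> indicator {-l..l} (x $ 2)"
      proof (cases "\<bar>x $ 2\<bar> > l")
        case False
        then have "x $ 2 \<in> {-l..l}" by auto
        then show ?thesis using gb1 by simp
      qed (use gsupp in simp)
      then have "cmod (p x) * (\<bar>box_weight a b (1 / N n) (x $ 1)\<bar> * cmod (g n (x $ 2))) \<le> ?dom x"
        using D(2)[of "1 / N n"] N(2)[of n] N1 D(1) by (intro mult_left_mono mult_mono) (auto intro!: divide_nonneg_nonneg)
      then show "norm (?T n x) \<le> ?dom x"
        by (simp add: norm_mult mult_ac)
    qed
  qed measurable
  then have "(\<lambda>n. cmod (J n)) \<longlonglongrightarrow> cmod (LINT x|lebesgue. ?L x)"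
    by (rule tendsto_norm)
  also have "(LINT x|lebesgue. ?L x) =
     of_real (2 * pi) * ?I"
    by (subst integral_mult_right_zero[symmetric]) (rule Bochner_Integration.integral_cong, simp_all)
  finally have lim: "(\<lambda>n. cmod (J n)) \<longlonglongrightarrow> 2 * pi * cmod ?I"
    by (simp add: norm_mult)
  have Jb: "cmod (J n) \<le> (b - a) * ((e - d) + 2 / N n) * source_size \<mu> \<beta> F G" for n
  proof -
    have "cmod (J n) \<le> (b - a) * (LINT t|lborel. cmod (g n t)) * source_size \<mu> \<beta> F G"
      unfolding J_def source_size_def
      by (rule averaged_bound[OF sys1 sys2 p q F G \<mu> c ab _ N1 gs gsupp gb1]) (use N(2)[of n] in simp_all)
    also have "\<dots> \<le> (b - a) * ((e - d) + 2 / N n) * source_size \<mu> \<beta> F G"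
      using ab mass source_size_nonneg by (intro mult_right_mono mult_left_mono) auto
    finally show ?thesis .
  qed
  have "(\<lambda>n. 2 / N n) \<longlonglongrightarrow> 0" unfolding N_def by real_asymp
  then have "(\<lambda>n. (b - a) * ((e - d) + 2 / N n) * source_size \<mu> \<beta> F G) \<longlonglongrightarrow> (b - a) * ((e - d) + 0) * source_size \<mu> \<beta> F G"
    by (intro tendsto_intros)
  from LIMSEQ_le[OF lim this] Jb
  have le: "2 * pi * cmod ?I \<le> (b - a) * (e - d) * source_size \<mu> \<beta> F G"
    by auto
  have "1 * cmod ?I \<le>
    2 * pi * cmod ?I"
    using pi_ge_two by (intro mult_right_mono) auto
  with le show ?thesis by simp
qed

text \<open>
  Lebesgue's differentiation theorem, for squares with lower left corner \<open>x\<close>.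
\<close>

theorem pointwise_bound: "AE x in lebesgue. cmod (p x) \<le> source_size \<mu> \<beta> F G"
proof -
  have loc: "set_integrable lebesgue (cbox y z) p" for y z
    using L2_locally_integrable[OF p] compact_cbox unfolding locally_integrable_def by blast
  have int: "p integrable_on cbox y z" "(LINT x:cbox y z|lebesgue. p x) = integral (cbox y z) p" for y z
    using set_lebesgue_integral_eq_integral[OF loc] by auto
  obtain N where N: "negligible N" "\<And>x e. \<lbrakk>x \<notin> N; 0 < e\<rbrakk> \<Longrightarrow>
      \<exists>d>0. \<forall>h. 0 < h \<and> h < d \<longrightarrow> norm (integral (cbox x (x + h *\<^sub>R One)) p /\<^sub>R h ^ DIM(real^2) - p x) < e"
    using integrable_ccontinuous_explicit[OF int(1)] by blast
  have bound: "cmod (p x) \<le> source_size \<mu> \<beta> F G" if x: "x \<notin> N" for x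
  proof (rule field_le_epsilon)
    fix e :: real assume e: "e > 0"
    then obtain d where d: "d > 0" "\<And>h. 0 < h \<Longrightarrow> h < d \<Longrightarrow> norm (integral (cbox x (x + h *\<^sub>R One)) p /\<^sub>R h ^ DIM(real^2) - p x) < e"
      using N(2)[OF x e] by blast
    define h where "h = d / 2"
    have h: "0 < h" "h < d" using d(1) by (simp_all add: h_def)
    have One: "(One :: real^2) $ i = 1" for i
      by (simp add: cart_eq_inner_axis inner_sum_left_Basis)
    have mem: "y \<in> cbox x (x + h *\<^sub>R One) \<longleftrightarrow> y $ 1 \<in> {x $ 1..x $ 1 + h} \<and> y $ 2 \<in> {x $ 2..x $ 2 + h}" for y
      using One[unfolded sum_component] by (auto simp: mem_box_cart forall_2)
    have ind: "indicator (cbox x (x + h *\<^sub>R One)) y = (indicator {x $ 1..x $ 1 + h} (y $ 1) * indicator {x $ 2..x $ 2 + h} (y $ 2) :: real)" for y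
      unfolding indicator_def mem by auto
    have "integral (cbox x (x + h *\<^sub>R One)) p = (LINT y|lebesgue. p y * of_real (indicator {x $ 1..x $ 1 + h} (y $ 1) * indicator {x $ 2..x $ 2 + h} (y $ 2)))"
      unfolding int(2)[symmetric] set_lebesgue_integral_def
      unfolding ind by (intro Bochner_Integration.integral_cong refl) (simp add: scaleR_conv_of_real mult.commute)
    also have "cmod \<dots> \<le> (x $ 1 + h - x $ 1) * (x $ 2 + h - x $ 2) * source_size \<mu> \<beta> F G"
      by (rule box_integral_bound) (use h in auto)
    finally have "cmod (integral (cbox x (x + h *\<^sub>R One)) p) \<le> h\<^sup>2 * source_size \<mu> \<beta> F G" by (simp add: power2_eq_square)
    then have "cmod (integral (cbox x (x + h *\<^sub>R One)) p) / h\<^sup>2 \<le> source_size \<mu> \<beta> F G"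
      using h by (simp add: pos_divide_le_eq mult.commute)
    moreover have "norm (integral (cbox x (x + h *\<^sub>R One)) p /\<^sub>R h ^ DIM(real^2)) = cmod (integral (cbox x (x + h *\<^sub>R One)) p) / h\<^sup>2"
      using h by (simp add: divide_inverse mult.commute)
    ultimately show "cmod (p x) \<le> source_size \<mu> \<beta> F G + e"
      using d(2)[OF h] norm_triangle_ineq2[of "p x" "integral (cbox x (x + h *\<^sub>R One)) p /\<^sub>R h ^ DIM(real^2)"]
      by (simp add: norm_minus_commute)
  qed
  have "N \<in> null_sets lebesgue" using N(1) by (simp add: negligible_iff_null_sets)
  then show ?thesis by (rule AE_mp[OF AE_not_in]) (use bound in auto)
qed

end

section \<open>The operators\<close>

lemma partial_derivs_tensor:
  assumes "\<And>t. (a has_vector_derivative a1 t) (at t)" "\<And>t. (a1 has_vector_derivative a2 t) (at t)"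
    "\<And>t. (b has_vector_derivative b1 t) (at t)" "\<And>t. (b1 has_vector_derivative b2 t) (at t)"
  shows "partial_derivs [1,1] (tensor a b) = tensor a2 b" "partial_derivs [2,1] (tensor a b) = tensor a1 b1"
    "partial_derivs [1,2] (tensor a b) = tensor a1 b1" "partial_derivs [2,2] (tensor a b) = tensor a b2"
  using partial_deriv_tensor[of a a1 b b1] partial_deriv_tensor[of a1 a2 b b1] partial_deriv_tensor[of a a1 b1 b2] assms
  by (simp_all add: partial_derivs_def)

text \<open>
  For \<open>d\<^sup>2 = 1\<close> the operator \<open>4 (1/2 (\<partial>\<^sub>1 + i d \<partial>\<^sub>2))\<^sup>2\<close> is \<open>L\<^sub>d\<close>.
\<close>

lemma weak_systemI:
  fixes u v f :: "real^2 \<Rightarrow> complex" and d \<kappa> :: complex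
  assumes d: "d\<^sup>2 = 1" and u: "u \<in> L2" and v: "v \<in> sobolev 2" and f: "integrable lebesgue f"
    and eq: "AE x in lebesgue. \<kappa> * u x + 4 * wirtinger (\<i> * d) (wirtinger (\<i> * d) v) x = - f x"
  shows "weak_system d \<kappa> u v f"
  unfolding weak_system_def
proof (intro allI impI)
  fix a a1 a2 b b1 b2 r
  assume a: "smooth a" and b: "smooth b" and derivs: "\<forall>t. (a has_vector_derivative a1 t) (at t)" "\<forall>t. (a1 has_vector_derivative a2 t) (at t)"
    "\<forall>t. (b has_vector_derivative b1 t) (at t)" "\<forall>t. (b1 has_vector_derivative b2 t) (at t)"
    and supp: "\<forall>t. \<bar>t\<bar> > r \<longrightarrow> a t = 0 \<and> b t = 0"
  have \<phi>: "test_function (tensor a b)"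
    by (rule test_function_tensor[of _ _ r]) (use a b supp in auto)
  let ?D = "wirtinger (\<i> * d)"
  note wk = weak_second_order[OF v \<phi>, of "\<i> * d"]
  note pd = partial_derivs_tensor[OF derivs[THEN spec]]
  have vi: "integrable lebesgue (\<lambda>x. 4 * (?D (?D v) x * tensor a b x))"
    by (intro integrable_mult_right locally_integrable_mult_test_function wk(1) \<phi>)
  have ui: "integrable lebesgue (\<lambda>x. \<kappa> * (u x * tensor a b x))"
    by (intro integrable_mult_right locally_integrable_mult_test_function L2_locally_integrable u \<phi>)
  have fi: "integrable lebesgue (\<lambda>x. f x * tensor a b x)"
    by (rule test_function_tensor_integrable[of _ _ _ r]) (use f a b supp in auto)
  have v_loc: "locally_integrable v" using v by (intro L2_locally_integrable) (simp add: sobolev_def)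
  have a1: "smooth a1" by (rule smooth_derivative[OF a derivs(1)[THEN spec]])
  have a2: "smooth a2" by (rule smooth_derivative[OF a1 derivs(2)[THEN spec]])
  have b1: "smooth b1" by (rule smooth_derivative[OF b derivs(3)[THEN spec]])
  have b2: "smooth b2" by (rule smooth_derivative[OF b1 derivs(4)[THEN spec]])
  have a1s: "a1 t = 0" if "\<bar>t\<bar> > r" for t by (rule derivative_zero_outside[OF derivs(1)[THEN spec] _ that]) (use supp in auto)
  have a2s: "a2 t = 0" if "\<bar>t\<bar> > r" for t by (rule derivative_zero_outside[OF derivs(2)[THEN spec] _ that]) (use a1s in auto)
  have b1s: "b1 t = 0" if "\<bar>t\<bar> > r" for t by (rule derivative_zero_outside[OF derivs(3)[THEN spec] _ that]) (use supp in auto)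
  have b2s: "b2 t = 0" if "\<bar>t\<bar> > r" for t by (rule derivative_zero_outside[OF derivs(4)[THEN spec] _ that]) (use b1s in auto)
  have "integrable lebesgue (\<lambda>x. v x * tensor a2 b x + 2 * \<i> * d * (v x * tensor a1 b1 x) - v x * tensor a b2 x)"
    by (intro Bochner_Integration.integrable_diff Bochner_Integration.integrable_add integrable_mult_right
        locally_integrable_mult_test_function[OF v_loc] test_function_tensor[of _ _ r])
      (use a b a1 a2 b1 b2 supp a1s a2s b1s b2s in auto)
  then have vLi: "integrable lebesgue (\<lambda>x. v x * (tensor a2 b x + 2 * \<i> * d * tensor a1 b1 x - tensor a b2 x))"
    by (simp add: algebra_simps)
  have sq: "(\<i> * d)\<^sup>2 = -1" using d by (simp add: power_mult_distrib)
  have "4 * (LINT x|lebesgue. ?D (?D v) x * tensor a b x) = (LINT x|lebesgue. v x * (tensor a2 b x + 2 * \<i> * d * tensor a1 b1 x - tensor a b2 x))"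
    unfolding wk(2) pd sq by (simp add: algebra_simps)
  then have L: "(LINT x|lebesgue. v x * (tensor a2 b x + 2 * \<i> * d * tensor a1 b1 x - tensor a b2 x)) = (LINT x|lebesgue. 4 * (?D (?D v) x * tensor a b x))"
    by (simp only: integral_mult_right_zero)
  have ui': "integrable lebesgue (\<lambda>x. \<kappa> * u x * tensor a b x)" using ui by (simp add: mult.assoc)
  have "(LINT x|lebesgue. \<kappa> * u x * tensor a b x + v x * (tensor a2 b x + 2 * \<i> * d * tensor a1 b1 x - tensor a b2 x)) =
     (LINT x|lebesgue. \<kappa> * u x * tensor a b x) + (LINT x|lebesgue. 4 * (?D (?D v) x * tensor a b x))"
    unfolding L[symmetric] by (rule Bochner_Integration.integral_add[OF ui' vLi])
  also have "\<dots> = (LINT x|lebesgue. \<kappa> * u x * tensor a b x + 4 * (?D (?D v) x * tensor a b x))"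
    by (rule Bochner_Integration.integral_add[OF ui' vi, symmetric])
  also have "\<dots> = (LINT x|lebesgue. - (f x * tensor a b x))"
  proof (rule integral_cong_AE)
    show "AE x in lebesgue. \<kappa> * u x * tensor a b x + 4 * (?D (?D v) x * tensor a b x) = - (f x * tensor a b x)"
      using eq
    proof eventually_elim
      case (elim x)
      have "\<kappa> * u x * tensor a b x + 4 * (?D (?D v) x * tensor a b x) = (\<kappa> * u x + 4 * ?D (?D v) x) * tensor a b x"
        by (simp add: algebra_simps)
      then show ?case using elim by simp
    qed
  qed (use ui' vi fi in auto)
  finally show "(LINT x|lebesgue. \<kappa> * u x * tensor a b x + v x * (tensor a2 b x + 2 * \<i> * d * tensor a1 b1 x - tensor a b2 x)) =
     - (LINT x|lebesgue. f x * tensor a b x)" by simp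
qed

text \<open>
  The equation is \<open>L\<^sub>d v = f\<close> with \<open>f\<close> the indicator of a square of area four. Test it with a cutoff \<open>\<zeta>\<close>
  at scale \<open>n\<close>: the right-hand side stays equal to four, while the second derivatives of the cutoff are of
  order \<open>1 / n\<^sup>2\<close> and live on a square of size \<open>n\<close>, so the left-hand side tends to zero by
  \<open>L2_mass_decay\<close>.
\<close>

lemma no_L2_solution:
  fixes v :: "real^2 \<Rightarrow> complex"
  assumes sys: "weak_system d 0 u v (\<lambda>x. - of_real (indicator (square 1) x))" and v: "v \<in> L2" and d: "cmod d = 1"
  shows False
proof -
  obtain \<zeta> \<zeta>1 \<zeta>2 :: "real \<Rightarrow> complex" and M :: real
    where \<zeta>: "smooth \<zeta>" "\<And>x. (\<zeta> has_vector_derivative \<zeta>1 x) (at x)" "\<And>x. (\<zeta>1 has_vector_derivative \<zeta>2 x) (at x)"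
    "\<And>x. cmod (\<zeta> x) \<le> 1" "\<And>x. cmod (\<zeta>1 x) \<le> M" "\<And>x. cmod (\<zeta>2 x) \<le> M" "M \<ge> 1"
    "\<And>x. \<bar>x\<bar> > 3 \<Longrightarrow> \<zeta> x = 0" "\<And>x. \<bar>x\<bar> \<le> 1 \<Longrightarrow> \<zeta> x = 1"
    by (rule cutoff_with_derivatives) (rule that; assumption)
  have \<zeta>1s: "\<zeta>1 t = 0" if "\<bar>t\<bar> > 3" for t by (rule derivative_zero_outside[OF \<zeta>(2) \<zeta>(8) that])
  have \<zeta>2s: "\<zeta>2 t = 0" if "\<bar>t\<bar> > 3" for t by (rule derivative_zero_outside[OF \<zeta>(3) \<zeta>1s that])
  define mass where "mass n = (LINT x|lebesgue. indicator (square (3 * real n)) x * cmod (v x))" for n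
  have vm: "v \<in> borel_measurable lebesgue" using v by (simp add: L2_def)
  \<comment> \<open>The derivatives are of order \<open>1 / n\<close>, which is what makes \<open>L2_mass_decay\<close> applicable.\<close>
  have bound: "4 \<le> 4 * M\<^sup>2 * (mass n / real n)" if n: "n \<ge> 1" for n
  proof -
    define Z where "Z t = \<zeta> (t / n)" for t
    define Z1 where "Z1 t = \<zeta>1 (t / n) / n" for t
    define Z2 where "Z2 t = \<zeta>2 (t / n) / n\<^sup>2" for t
    have Zd: "(Z has_vector_derivative Z1 x) (at x)" "(Z1 has_vector_derivative Z2 x) (at x)" for x
      unfolding Z_def Z1_def Z2_def using n rescaled_derivatives[of "real n", OF _ \<zeta>(2,3)] by simp_all
    have Zs: "smooth Z" unfolding Z_def using smooth_affine[OF \<zeta>(1), of "1 / n" 0] by simp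
    have big: "\<bar>t / n\<bar> > 3" if "\<bar>t\<bar> > 3 * real n" for t using that n by (simp add: pos_less_divide_eq)
    have Zsupp: "Z t = 0" "Z1 t = 0" "Z2 t = 0" if "\<bar>t\<bar> > 3 * real n" for t
      using \<zeta>(8)[OF big[OF that]] \<zeta>1s[OF big[OF that]] \<zeta>2s[OF big[OF that]] by (simp_all add: Z_def Z1_def Z2_def)
    have sup: "\<forall>t. \<bar>t\<bar> > 3 * real n \<longrightarrow> Z t = 0 \<and> Z t = 0" using Zsupp by auto
    let ?L = "\<lambda>x. tensor Z2 Z x + 2 * \<i> * d * tensor Z1 Z1 x - tensor Z Z2 x"
    have eq: "(LINT x|lebesgue. v x * ?L x) = (LINT x|lebesgue. of_real (indicator (square 1) x) * tensor Z Z x)"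
      using sys[unfolded weak_system_def, rule_format, OF Zs Zs Zd(1) Zd(2) Zd(1) Zd(2) sup[rule_format]] by simp
    have "(LINT x|lebesgue. of_real (indicator (square 1) x) * tensor Z Z x) = (LINT x|lebesgue. complex_of_real (indicator (square 1) x))"
    proof (intro Bochner_Integration.integral_cong refl)
      fix x :: "real^2"
      have "Z t = 1" if "\<bar>t\<bar> \<le> 1" for t
      proof -
        have "\<bar>t / n\<bar> \<le> 1" using that n by (simp add: divide_le_eq)
        then show ?thesis unfolding Z_def by (rule \<zeta>(9))
      qed
      then show "of_real (indicator (square 1) x) * tensor Z Z x = complex_of_real (indicator (square 1) x)"
        by (auto simp: indicator_def mem_square tensor_def)
    qed
    also have "\<dots> = 4"
      using measure_square[of 1] by simp
    finally have "4 = cmod (LINT x|lebesgue. v x * ?L x)" unfolding eq by simp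
    also have "\<dots> \<le> (LINT x|lebesgue. 4 * M\<^sup>2 / real n * (indicator (square (3 * real n)) x * cmod (v x)))"
    proof (cases "integrable lebesgue (\<lambda>x. v x * ?L x)")
      case True
      then show ?thesis
      proof (rule Bochner_Integration.integral_norm_bound_integral)
        show "integrable lebesgue (\<lambda>x. 4 * M\<^sup>2 / real n * (indicator (square (3 * real n)) x * cmod (v x)))"
          by (intro integrable_mult_right L2_square_integrable v)
        fix x :: "real^2"
        show "cmod (v x * ?L x) \<le> 4 * M\<^sup>2 / real n * (indicator (square (3 * real n)) x * cmod (v x))"
        proof (cases "x \<in> square (3 * real n)")
          case True
          have n1: "real n \<ge> 1" using n by simp
          have M0: "0 \<le> M" using \<zeta>(7) by simp
          have nn: "real n \<le> (real n)\<^sup>2" using n1 by (simp add: power2_eq_square)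
          have Zb: "cmod (Z t) \<le> 1" "cmod (Z1 t) \<le> M / n" "cmod (Z2 t) \<le> M / (real n)\<^sup>2" for t
            unfolding Z_def Z1_def Z2_def using \<zeta>(4,5,6) n by (auto simp: norm_divide norm_power divide_right_mono)
          have 1: "cmod (tensor Z2 Z x) \<le> M / (real n)\<^sup>2 * 1" "cmod (tensor Z Z2 x) \<le> 1 * (M / (real n)\<^sup>2)"
            "cmod (tensor Z1 Z1 x) \<le> M / n * (M / n)"
            unfolding tensor_def norm_mult
            by (intro mult_mono Zb norm_ge_zero divide_nonneg_nonneg M0 zero_le_power2 of_nat_0_le_iff zero_le_one)+
          have "cmod (?L x) \<le> cmod (tensor Z2 Z x) + 2 * cmod (tensor Z1 Z1 x) + cmod (tensor Z Z2 x)"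
            using norm_triangle_ineq4[of "tensor Z2 Z x + 2 * \<i> * d * tensor Z1 Z1 x" "tensor Z Z2 x"]
              norm_triangle_ineq[of "tensor Z2 Z x" "2 * \<i> * d * tensor Z1 Z1 x"] d by (simp add: norm_mult)
          also have "\<dots> \<le> (2 * M + 2 * M\<^sup>2) / (real n)\<^sup>2"
            using 1 by (simp add: add_divide_distrib power2_eq_square)
          also have "\<dots> \<le> 4 * M\<^sup>2 / real n"
          proof (rule frac_le)
            have "M * 1 \<le> M * M" using \<zeta>(7) by (intro mult_left_mono) auto
            then show "2 * M + 2 * M\<^sup>2 \<le> 4 * M\<^sup>2" by (simp add: power2_eq_square)
          qed (use \<zeta>(7) n1 nn in auto)
          finally have "cmod (?L x) \<le> 4 * M\<^sup>2 / real n" .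
          from mult_left_mono[OF this, of "cmod (v x)"] show ?thesis using True by (simp add: norm_mult mult.commute)
        next
          case False
          then have "3 * real n < \<bar>x $ 1\<bar> \<or> 3 * real n < \<bar>x $ 2\<bar>" by (auto simp only: mem_square not_le de_Morgan_conj)
          then have "?L x = 0" using Zsupp unfolding tensor_def by (elim disjE) simp_all
          then show ?thesis by simp
        qed
      qed
    qed (simp add: not_integrable_integral_eq)
    also have "\<dots> = 4 * M\<^sup>2 * (mass n / real n)" by (simp add: mass_def)
    finally show ?thesis .
  qed
  have "(\<lambda>n. 4 * M\<^sup>2 * (mass n / real n)) \<longlonglongrightarrow> 4 * M\<^sup>2 * 0"
    unfolding mass_def by (intro tendsto_intros L2_mass_decay v)
  moreover have "\<forall>\<^sub>F n in sequentially. 4 \<le> 4 * M\<^sup>2 * (mass n / real n)"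
    using eventually_ge_at_top[of 1] by eventually_elim (rule bound)
  ultimately have "(4::real) \<le> 4 * M\<^sup>2 * 0" by (rule tendsto_lowerbound) simp
  then show False by simp
qed

lemma wirtinger_eq: "d_zbar = wirtinger (\<i> * (-1))" "d_z = wirtinger (\<i> * 1)"
  by (intro ext; simp add: d_zbar_def d_z_def wirtinger_def)+

lemma spinor_component_measurable [measurable (raw)]:
  fixes f :: "real^2 \<Rightarrow> 'a::{euclidean_space}^2"
  assumes [measurable]: "f \<in> borel_measurable lebesgue"
  shows "(\<lambda>x. f x $ i) \<in> borel_measurable lebesgue"
proof -
  have "(\<lambda>y::'a^2. y $ i) \<in> borel_measurable borel"
    by (intro borel_measurable_continuous_onI continuous_intros)
  from measurable_compose[OF assms this] show ?thesis .
qed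

lemma D_free_component_eqs:
  "D_free m u x $ 1 = of_real m * u x $ 1 + 4 * wirtinger (\<i> * (-1)) (wirtinger (\<i> * (-1)) (\<lambda>y. u y $ 2)) x"
  "D_free m u x $ 2 = 4 * wirtinger (\<i> * 1) (wirtinger (\<i> * 1) (\<lambda>y. u y $ 1)) x - of_real m * u x $ 2"
  unfolding D_free_def wirtinger_eq by simp_all

lemma indicator_square_L2: "(\<lambda>x. vector [a * of_real (indicator (square 1) x), b * of_real (indicator (square 1) x)] :: complex^2) \<in> L2"
proof -
  let ?f = "\<lambda>x. vector [a * of_real (indicator (square 1) x), b * of_real (indicator (square 1) x)] :: complex^2"
  have eqx: "?f x = indicator (square 1) x *\<^sub>R vector [a, b]" for x
    by (simp add: vec_eq_iff forall_2 indicator_def)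
  then have eq: "?f = (\<lambda>x. indicator (square 1) x *\<^sub>R vector [a, b])" by blast
  have "(\<lambda>x. (norm (?f x))\<^sup>2) = (\<lambda>x. (norm (vector [a, b] :: complex^2))\<^sup>2 * indicator (square 1) x)"
    unfolding eqx by (auto simp: indicator_def)
  then have "integrable lebesgue (\<lambda>x. (norm (?f x))\<^sup>2)"
    by (simp add: integrable_indicator_square)
  moreover have "?f \<in> borel_measurable lebesgue" unfolding eq by measurable
  ultimately show ?thesis by (simp add: L2_def)
qed

text \<open>
  At \<open>k = m\<close> and \<open>k = - m\<close> one component of \<open>(D\<^sub>m - k) u\<close> is \<open>L\<^sub>\<plusminus>\<^sub>1\<close> applied to a single component of \<open>u\<close>,
  so \<open>no_L2_solution\<close> excludes surjectivity.
\<close>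

lemma thresholds_in_spectrum:
  fixes m :: real
  shows "of_real m \<in> spectrum H2 (D_free m)" "- of_real m \<in> spectrum H2 (D_free m)"
proof -
  have int: "integrable lebesgue (\<lambda>x::real^2. - complex_of_real (indicator (square 1) x))"
    by (intro Bochner_Integration.integrable_minus integrable_of_real integrable_indicator_square)
  have sob: "(\<lambda>y. u y $ j) \<in> sobolev 2" "(\<lambda>y. u y $ j) \<in> L2" if "u \<in> H2" for u :: spinor and j
    using that by (auto simp: sobolev_vec_def sobolev_def)
  have "of_real m \<notin> resolvent_set H2 (D_free m)"
  proof
    assume "complex_of_real m \<in> resolvent_set H2 (D_free m)"
    then have "\<exists>u\<in>H2. ae_eq (\<lambda>x. D_free m u x - of_real m *s u x) (\<lambda>x. vector [1 * of_real (indicator (square 1) x), 0 * of_real (indicator (square 1) x)])"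
      using indicator_square_L2 unfolding resolvent_set_def by blast
    then obtain u :: spinor where u: "u \<in> H2" and eq: "AE x in lebesgue. D_free m u x - of_real m *s u x = vector [1 * of_real (indicator (square 1) x), 0 * of_real (indicator (square 1) x)]"
      unfolding ae_eq_def by blast
    have "weak_system (-1) 0 (\<lambda>x. u x $ 1) (\<lambda>x. u x $ 2) (\<lambda>x. - of_real (indicator (square 1) x))"
    proof (rule weak_systemI[OF _ sob(2)[OF u] sob(1)[OF u] int])
      show "AE x in lebesgue. 0 * u x $ 1 + 4 * wirtinger (\<i> * (-1)) (wirtinger (\<i> * (-1)) (\<lambda>y. u y $ 2)) x = - (- complex_of_real (indicator (square 1) x))"
        using eq
      proof eventually_elim
        case (elim x)
        then have "(D_free m u x - of_real m *s u x) $ 1 = of_real (indicator (square 1) x)" by simp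
        then show ?case by (simp add: D_free_component_eqs(1))
      qed
    qed simp
    then show False by (rule no_L2_solution[OF _ sob(2)[OF u]]) simp
  qed
  then show "of_real m \<in> spectrum H2 (D_free m)" by (simp add: spectrum_def)
  have "- of_real m \<notin> resolvent_set H2 (D_free m)"
  proof
    assume "- complex_of_real m \<in> resolvent_set H2 (D_free m)"
    then have "\<exists>u\<in>H2. ae_eq (\<lambda>x. D_free m u x - (- of_real m) *s u x) (\<lambda>x. vector [0 * of_real (indicator (square 1) x), 1 * of_real (indicator (square 1) x)])"
      using indicator_square_L2 unfolding resolvent_set_def by blast
    then obtain u :: spinor where u: "u \<in> H2" and eq: "AE x in lebesgue. D_free m u x - (- of_real m) *s u x = vector [0 * of_real (indicator (square 1) x), 1 * of_real (indicator (square 1) x)]"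
      unfolding ae_eq_def by blast
    have "weak_system 1 0 (\<lambda>x. u x $ 2) (\<lambda>x. u x $ 1) (\<lambda>x. - of_real (indicator (square 1) x))"
    proof (rule weak_systemI[OF _ sob(2)[OF u] sob(1)[OF u] int])
      show "AE x in lebesgue. 0 * u x $ 2 + 4 * wirtinger (\<i> * 1) (wirtinger (\<i> * 1) (\<lambda>y. u y $ 1)) x = - (- complex_of_real (indicator (square 1) x))"
        using eq
      proof eventually_elim
        case (elim x)
        then have "(D_free m u x - (- of_real m) *s u x) $ 2 = of_real (indicator (square 1) x)" by simp
        then show ?case by (simp add: D_free_component_eqs(2))
      qed
    qed simp
    then show False by (rule no_L2_solution[OF _ sob(2)[OF u]]) simp
  qed
  then show "- of_real m \<in> spectrum H2 (D_free m)" by (simp add: spectrum_def)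
qed

lemma matrix_vector_component_le:
  fixes A :: "complex^2^2" and v :: "complex^2"
  shows "cmod ((A *v v) $ i) \<le> norm A * norm v"
proof -
  have "cmod ((A *v v) $ i) \<le> (\<Sum>j\<in>UNIV. cmod (A $ i $ j) * cmod (v $ j))"
    unfolding matrix_vector_mult_def by (simp add: norm_mult[symmetric] sum_norm_le del: norm_mult)
  also have "\<dots> \<le> L2_set (\<lambda>j. cmod (A $ i $ j)) UNIV * L2_set (\<lambda>j. cmod (v $ j)) UNIV"
    using L2_set_mult_ineq[of "\<lambda>j. cmod (A $ i $ j)" "\<lambda>j. cmod (v $ j)" UNIV] by simp
  also have "\<dots> = norm (A $ i) * norm v" by (simp add: norm_vec_def)
  also have "\<dots> \<le> norm A * norm v" by (intro mult_right_mono Finite_Cartesian_Product.norm_nth_le) auto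
  finally show ?thesis .
qed

lemma zero_in_sobolev: "(\<lambda>x. 0) \<in> sobolev s"
proof -
  have L2: "(\<lambda>x. 0 :: complex) \<in> L2" by (simp add: L2_def)
  have "has_weak_deriv is (\<lambda>x. 0) (\<lambda>x. 0)" for "is" :: "'a list"
    by (simp add: has_weak_deriv_def locally_integrable_def)
  with L2 show ?thesis unfolding sobolev_def by blast
qed

text \<open>
  The domain is invariant under moving a component of \<open>u\<close> into any slot and filling the other with zero.
  So admissibility makes every product \<open>V\<^sub>i\<^sub>j u\<^sub>k\<close> square integrable, and for \<open>A = |V\<^sub>i\<^sub>j|\<close> and \<open>U = |u\<^sub>k|\<close> one has
  \<open>A U \<le> A + A U\<^sup>2 \<le> A + (A U)\<^sup>2 + U\<^sup>2\<close>. This is what makes \<open>\<integral>|V||u|\<close> finite.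
\<close>

lemma potential_times_spinor_integrable:
  fixes V :: potential and u :: spinor
  assumes V: "admissible_potential V" and u: "u \<in> H2"
    and fin: "(\<integral>\<^sup>+x. ennreal (norm (V x)) \<partial>lebesgue) < \<infinity>"
  shows "integrable lebesgue (\<lambda>x. norm (V x) * norm (u x))"
proof -
  have Vm [measurable]: "V \<in> borel_measurable lebesgue" using V by (simp add: admissible_potential_def)
  have uj: "(\<lambda>x. u x $ j) \<in> sobolev 2" "(\<lambda>x. u x $ j) \<in> L2" for j
    using u by (auto simp: sobolev_vec_def sobolev_def)
  have um [measurable]: "(\<lambda>x. u x $ j) \<in> borel_measurable lebesgue" for j using uj(2)[of j] by (simp add: L2_def)
  have Vi: "integrable lebesgue V" using fin by (intro integrableI_bounded) auto
  have entry: "integrable lebesgue (\<lambda>x. cmod (V x $ i $ j) * cmod (u x $ k))" for i j k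
  proof -
    define w :: spinor where "w x = axis j (u x $ k)" for x
    have "w \<in> H2"
      unfolding sobolev_vec_def
    proof (clarify)
      fix l
      show "(\<lambda>x. w x $ l) \<in> sobolev 2"
        by (cases "l = j") (simp_all add: w_def axis_def uj zero_in_sobolev)
    qed
    then have Vw: "(\<lambda>x. V x *v w x) \<in> L2" using V by (simp add: admissible_potential_def)
    have prod: "(V x *v w x) $ i = V x $ i $ j * u x $ k" for x
      by (simp add: matrix_vector_mult_def w_def axis_def if_distrib[of "\<lambda>z. _ * z"] sum.delta cong: if_cong)
    have le: "cmod (V x $ i $ j) * cmod (u x $ k) \<le> norm (V x *v w x)" for x
      using Finite_Cartesian_Product.norm_nth_le[of "V x *v w x" i] by (simp add: prod norm_mult)
    have entry_le: "cmod (V x $ i $ j) \<le> norm (V x)" for x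
      using Finite_Cartesian_Product.norm_nth_le[of "V x $ i" j] Finite_Cartesian_Product.norm_nth_le[of "V x" i] by linarith
    show ?thesis
    proof (rule Bochner_Integration.integrable_bound)
      show "integrable lebesgue (\<lambda>x. norm (V x) + ((norm (V x *v w x))\<^sup>2 + (cmod (u x $ k))\<^sup>2))"
        using Vi Vw uj(2)[of k] by (auto simp: L2_def)
      show "AE x in lebesgue. norm (cmod (V x $ i $ j) * cmod (u x $ k)) \<le> norm (norm (V x) + ((norm (V x *v w x))\<^sup>2 + (cmod (u x $ k))\<^sup>2))"
      proof (rule AE_I2)
        fix x
        define A where "A = cmod (V x $ i $ j)"
        define U where "U = cmod (u x $ k)"
        have nn: "0 \<le> A" "0 \<le> U" by (simp_all add: A_def U_def)
        have "A * U \<le> A + A * U * U"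
        proof (cases "U \<le> 1")
          case True
          then have "A * U \<le> A * 1" using nn by (intro mult_left_mono) auto
          then show ?thesis using nn by (simp add: add_increasing2)
        next
          case False
          then have "A * U * 1 \<le> A * U * U" using nn by (intro mult_left_mono) auto
          then show ?thesis using nn by simp
        qed
        also have "A * U * U \<le> (A * U)\<^sup>2 + U\<^sup>2"
        proof -
          have "2 * (A * U * U) \<le> (A * U)\<^sup>2 + U\<^sup>2"
            using zero_le_power2[of "A * U - U"] by (simp add: power2_diff)
          moreover have "0 \<le> A * U * U" using nn by simp
          ultimately show ?thesis by linarith
        qed
        also have "(A * U)\<^sup>2 \<le> (norm (V x *v w x))\<^sup>2" using le[of x] nn by (intro power_mono) (auto simp: A_def U_def)
        also have "A \<le> norm (V x)" using entry_le by (simp add: A_def)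
        finally show "norm (cmod (V x $ i $ j) * cmod (u x $ k)) \<le> norm (norm (V x) + ((norm (V x *v w x))\<^sup>2 + (cmod (u x $ k))\<^sup>2))"
          by (simp add: A_def U_def)
      qed
    qed measurable
  qed
  have u_norm: "norm (u x) \<le> cmod (u x $ 1) + cmod (u x $ 2)" for x
    using L2_set_le_sum[of UNIV "\<lambda>j. cmod (u x $ j)"] by (simp add: norm_vec_def UNIV_2)
  have V_norm: "norm (V x) \<le> (\<Sum>i\<in>UNIV. \<Sum>j\<in>UNIV. cmod (V x $ i $ j))" for x
  proof -
    have "norm (V x) \<le> (\<Sum>i\<in>UNIV. norm (V x $ i))"
      using L2_set_le_sum[of UNIV "\<lambda>i. norm (V x $ i)"] by (simp add: norm_vec_def)
    also have "\<dots> \<le> (\<Sum>i\<in>UNIV. \<Sum>j\<in>UNIV. cmod (V x $ i $ j))"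
    proof (rule sum_mono)
      fix i show "norm (V x $ i) \<le> (\<Sum>j\<in>UNIV. cmod (V x $ i $ j))"
        using L2_set_le_sum[of UNIV "\<lambda>j. cmod (V x $ i $ j)"] by (simp add: norm_vec_def)
    qed
    finally show ?thesis .
  qed
  have unm: "(\<lambda>x. norm (u x)) \<in> borel_measurable lebesgue"
  proof -
    have "(\<lambda>x. norm (u x)) = (\<lambda>x. sqrt ((cmod (u x $ 1))\<^sup>2 + (cmod (u x $ 2))\<^sup>2))"
      by (simp add: norm_vec_def L2_set_def UNIV_2)
    then show ?thesis by simp
  qed
  show ?thesis
  proof (rule Bochner_Integration.integrable_bound)
    show "integrable lebesgue (\<lambda>x. \<Sum>i\<in>UNIV. \<Sum>j\<in>UNIV. cmod (V x $ i $ j) * cmod (u x $ 1) + cmod (V x $ i $ j) * cmod (u x $ 2))"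
      by (intro Bochner_Integration.integrable_sum Bochner_Integration.integrable_add entry)
    show "(\<lambda>x. norm (V x) * norm (u x)) \<in> borel_measurable lebesgue" using unm by measurable
    show "AE x in lebesgue. norm (norm (V x) * norm (u x)) \<le> norm (\<Sum>i\<in>UNIV. \<Sum>j\<in>UNIV. cmod (V x $ i $ j) * cmod (u x $ 1) + cmod (V x $ i $ j) * cmod (u x $ 2))"
    proof (rule AE_I2)
      fix x
      have "norm (V x) * norm (u x) \<le> (\<Sum>i\<in>UNIV. \<Sum>j\<in>UNIV. cmod (V x $ i $ j)) * (cmod (u x $ 1) + cmod (u x $ 2))"
        by (intro mult_mono V_norm u_norm sum_nonneg) auto
      also have "\<dots> = (\<Sum>i\<in>UNIV. \<Sum>j\<in>UNIV. cmod (V x $ i $ j) * cmod (u x $ 1) + cmod (V x $ i $ j) * cmod (u x $ 2))"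
        by (simp add: sum_distrib_right distrib_left sum.distrib)
      finally show "norm (norm (V x) * norm (u x)) \<le> norm (\<Sum>i\<in>UNIV. \<Sum>j\<in>UNIV. cmod (V x $ i $ j) * cmod (u x $ 1) + cmod (V x $ i $ j) * cmod (u x $ 2))"
        by simp
    qed
  qed
qed

lemma ratio_eq_sqrt:
  fixes a b w :: real
  assumes "a > 0" "b > 0" "w > 0" "w\<^sup>2 = a * b"
  shows "a / w = sqrt (a / b)"
proof -
  have "(a / w)\<^sup>2 = a / b" using assms by (simp add: power_divide power2_eq_square)
  then show ?thesis using assms by (metis divide_nonneg_nonneg less_imp_le real_sqrt_unique)
qed

text \<open>
  The two components of the eigenvalue equation form a system to which \<open>pointwise_bound\<close> applies twice,
  with the roles of the components exchanged. The coefficients are \<open>m - k\<close> and \<open>- (m + k)\<close>, whose product is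
  \<open>\<mu>\<^sup>2\<close>, so that \<open>|\<beta>| / |\<mu>|\<close> is one of the two square roots in \<open>S\<close>.
\<close>

lemma eigenfunction_estimate:
  fixes m :: real and V :: potential and k \<mu> :: complex
  assumes V: "admissible_potential V" and spec: "k \<notin> spectrum H2 (D_free m)" and ev: "eigenvalue H2 (D_pert m V) k"
    and \<mu>: "\<mu>\<^sup>2 = k\<^sup>2 - (of_real m)\<^sup>2" and fin: "(\<integral>\<^sup>+x. ennreal (norm (V x)) \<partial>lebesgue) < \<infinity>"
  defines "S \<equiv> sqrt (cmod ((k - of_real m) / (k + of_real m))) + sqrt (cmod ((k + of_real m) / (k - of_real m))) + 1"
  shows "1 \<le> 200 * (LINT x|lebesgue. norm (V x)) * S"
proof -
  obtain u where u: "u \<in> H2" "\<not> ae_eq u (\<lambda>x. 0)" "AE x in lebesgue. D_pert m V u x = k *s u x"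
    using ev unfolding eigenvalue_def ae_eq_def by blast
  have uj: "(\<lambda>x. u x $ j) \<in> sobolev 2" "(\<lambda>x. u x $ j) \<in> L2" for j
    using u(1) by (auto simp: sobolev_vec_def sobolev_def)
  have nz: "k - of_real m \<noteq> 0" "k + of_real m \<noteq> 0"
    using spec thresholds_in_spectrum[of m] by (auto simp: add_eq_0_iff2)
  have \<mu>': "\<mu>\<^sup>2 = (k - of_real m) * (k + of_real m)" using \<mu> by (simp add: power2_eq_square algebra_simps)
  have \<mu>0: "\<mu> \<noteq> 0" using \<mu>' nz by auto
  define f where "f i x = (V x *v u x) $ i" for i x
  have VuL2: "(\<lambda>x. V x *v u x) \<in> L2" using V u(1) by (simp add: admissible_potential_def)
  have fm: "f i \<in> borel_measurable lebesgue" for i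
    unfolding f_def using VuL2 by (intro spinor_component_measurable) (simp add: L2_def)
  have Vu: "integrable lebesgue (\<lambda>x. norm (V x) * norm (u x))"
    by (rule potential_times_spinor_integrable[OF V u(1) fin])
  have fle: "cmod (f i x) \<le> norm (V x) * norm (u x)" for i x
    unfolding f_def by (rule matrix_vector_component_le)
  have fi: "integrable lebesgue (f i)" for i
    by (rule Bochner_Integration.integrable_bound[OF Vu fm]) (use fle in auto)
  define N where "N = (LINT x|lebesgue. norm (V x) * norm (u x))"
  have N0: "N \<ge> 0" by (simp add: N_def)
  have fN: "(LINT x|lebesgue. cmod (f i x)) \<le> N" for i
    unfolding N_def using fi Vu fle by (intro integral_mono) auto
  let ?dbar = "wirtinger (\<i> * (-1)) (wirtinger (\<i> * (-1)) (\<lambda>y. u y $ 2))"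
  let ?d = "wirtinger (\<i> * 1) (wirtinger (\<i> * 1) (\<lambda>y. u y $ 1))"
  have comp: "AE x in lebesgue. (of_real m - k) * u x $ 1 + 4 * ?dbar x = - f 1 x"
    "AE x in lebesgue. - (of_real m + k) * u x $ 2 + 4 * ?d x = - f 2 x"
  proof -
    have comp_eq: "D_pert m V u x $ i - k * u x $ i = 0" if "D_pert m V u x = k *s u x" for x i
      using that by simp
    show "AE x in lebesgue. (of_real m - k) * u x $ 1 + 4 * ?dbar x = - f 1 x"
      using u(3)
    proof eventually_elim
      case (elim x)
      show ?case
        using comp_eq[OF elim, of 1] unfolding D_pert_def f_def vector_add_component D_free_component_eqs eq_neg_iff_add_eq_0
        by (simp add: algebra_simps)
    qed
    show "AE x in lebesgue. - (of_real m + k) * u x $ 2 + 4 * ?d x = - f 2 x"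
      using u(3)
    proof eventually_elim
      case (elim x)
      show ?case
        using comp_eq[OF elim, of 2] unfolding D_pert_def f_def vector_add_component D_free_component_eqs eq_neg_iff_add_eq_0
        by (simp add: algebra_simps)
    qed
  qed
  have sys1: "weak_system (-1) (of_real m - k) (\<lambda>x. u x $ 1) (\<lambda>x. u x $ 2) (f 1)"
    by (rule weak_systemI[OF _ uj(2) uj(1) fi comp(1)]) simp
  have sys2: "weak_system 1 (- (of_real m + k)) (\<lambda>x. u x $ 2) (\<lambda>x. u x $ 1) (f 2)"
    by (rule weak_systemI[OF _ uj(2) uj(1) fi comp(2)]) simp
  have ab: "(of_real m - k) * - (of_real m + k) = \<mu>\<^sup>2" "- (of_real m + k) * (of_real m - k) = \<mu>\<^sup>2"
    unfolding \<mu>' by (simp_all add: algebra_simps)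
  define r1 where "r1 = cmod (k + of_real m) / cmod \<mu>"
  define r2 where "r2 = cmod (k - of_real m) / cmod \<mu>"
  have r0: "r1 \<ge> 0" "r2 \<ge> 0" by (simp_all add: r1_def r2_def)
  have \<mu>2: "(cmod \<mu>)\<^sup>2 = cmod (k - of_real m) * cmod (k + of_real m)"
    by (metis \<mu>' norm_mult norm_power)
  have S: "S = r2 + r1 + 1"
    unfolding S_def r1_def r2_def norm_divide
    by (subst (1 2) ratio_eq_sqrt) (use nz \<mu>0 \<mu>2 in \<open>auto simp: mult.commute\<close>)
  have sys1': "weak_system (complex_of_real (- 1)) (of_real m - k) (\<lambda>x. u x $ 1) (\<lambda>x. u x $ 2) (f 1)"
    and sys2': "weak_system (complex_of_real 1) (- (of_real m + k)) (\<lambda>x. u x $ 2) (\<lambda>x. u x $ 1) (f 2)"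
    and sys1'': "weak_system (complex_of_real (-1)) (of_real m - k) (\<lambda>x. u x $ 1) (\<lambda>x. u x $ 2) (f 1)"
    and sys2'': "weak_system (complex_of_real (- (- 1))) (- (of_real m + k)) (\<lambda>x. u x $ 2) (\<lambda>x. u x $ 1) (f 2)"
    using sys1 sys2 by simp_all
  have u1: "AE x in lebesgue. cmod (u x $ 1) \<le> (5 * r1 + 100) * N"
  proof -
    have "AE x in lebesgue. cmod (u x $ 1) \<le> 5 * cmod (- (of_real m + k)) / cmod \<mu> * (LINT x|lebesgue. cmod (f 1 x)) + 100 * (LINT x|lebesgue. cmod (f 2 x))"
      using pointwise_bound[OF sys1' sys2' uj(2) uj(2) fi fi ab(1) \<mu>0] by (simp add: source_size_def)
    moreover have "5 * cmod (- (of_real m + k)) / cmod \<mu> * (LINT x|lebesgue. cmod (f 1 x)) + 100 * (LINT x|lebesgue. cmod (f 2 x)) \<le> (5 * r1 + 100) * N"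
    proof -
      have "5 * cmod (- (of_real m + k)) / cmod \<mu> = 5 * r1" by (simp add: r1_def add.commute norm_minus_cancel del: minus_add_distrib)
      then show ?thesis using mult_left_mono[OF fN[of 1], of "5 * r1"] fN[of 2] r0 by (simp add: distrib_right)
    qed
    ultimately show ?thesis by (auto elim: AE_mp)
  qed
  have u2: "AE x in lebesgue. cmod (u x $ 2) \<le> (5 * r2 + 100) * N"
  proof -
    have "AE x in lebesgue. cmod (u x $ 2) \<le> 5 * cmod (of_real m - k) / cmod \<mu> * (LINT x|lebesgue. cmod (f 2 x)) + 100 * (LINT x|lebesgue. cmod (f 1 x))"
      using pointwise_bound[OF sys2'' sys1'' uj(2) uj(2) fi fi ab(2) \<mu>0] by (simp add: source_size_def)
    moreover have "5 * cmod (of_real m - k) / cmod \<mu> * (LINT x|lebesgue. cmod (f 2 x)) + 100 * (LINT x|lebesgue. cmod (f 1 x)) \<le> (5 * r2 + 100) * N"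
    proof -
      have "5 * cmod (of_real m - k) / cmod \<mu> = 5 * r2" by (simp add: r2_def norm_minus_commute)
      then show ?thesis using mult_left_mono[OF fN[of 2], of "5 * r2"] fN[of 1] r0 by (simp add: distrib_right)
    qed
    ultimately show ?thesis by (auto elim: AE_mp)
  qed
  have ub: "AE x in lebesgue. norm (u x) \<le> 200 * S * N"
    using u1 u2
  proof eventually_elim
    case (elim x)
    have "norm (u x) \<le> cmod (u x $ 1) + cmod (u x $ 2)"
      using L2_set_le_sum[of UNIV "\<lambda>j. cmod (u x $ j)"] by (simp add: norm_vec_def UNIV_2)
    also have "\<dots> \<le> (5 * r1 + 100) * N + (5 * r2 + 100) * N" using elim by simp
    also have "\<dots> = (5 * r1 + 5 * r2 + 200) * N" by (simp add: algebra_simps)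
    also have "\<dots> \<le> (200 * S) * N" using r0 N0 unfolding S by (intro mult_right_mono) auto
    finally show ?case .
  qed
  have Vi: "integrable lebesgue (\<lambda>x. norm (V x))"
    using fin V by (intro integrable_norm integrableI_bounded) (auto simp: admissible_potential_def)
  have "N \<le> (LINT x|lebesgue. norm (V x) * (200 * S * N))"
    unfolding N_def[symmetric] by (subst N_def, rule integral_mono_AE[OF Vu])
      (intro integrable_mult_left Vi, use ub in \<open>eventually_elim, simp add: mult_left_mono\<close>)
  then have "N * 1 \<le> N * (200 * (LINT x|lebesgue. norm (V x)) * S)" by (simp add: mult_ac)
  moreover have "N \<noteq> 0"
  proof
    assume "N = 0"
    then have "AE x in lebesgue. norm (u x) \<le> 0" using ub by simp
    then have "ae_eq u (\<lambda>x. 0)" by (simp add: ae_eq_def)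
    then show False using u(2) by simp
  qed
  ultimately show ?thesis using N0 by (simp add: mult_le_cancel_left)
qed

theorem theorem1p2:
  "\<exists>C::real. C > 0 \<and>
    (\<forall>(m::real) (V::real^2 \<Rightarrow> complex^2^2) (k::complex) (\<mu>::complex).
       m \<ge> 0 \<longrightarrow> admissible_potential V \<longrightarrow>
       k \<notin> spectrum H2 (D_free m) \<longrightarrow> eigenvalue H2 (D_pert m V) k \<longrightarrow>
       \<mu>\<^sup>2 = k\<^sup>2 - (of_real m)\<^sup>2 \<longrightarrow>
       ennreal C *
         (ennreal \<bar>ln (cmod \<mu>)\<bar> *
            (SUP x. \<integral>\<^sup>+y. indicator (ball x (inverse (2 * cmod \<mu>))) y * ennreal (norm (V y)) \<partial>lebesgue)
          + (SUP x. \<integral>\<^sup>+y. ennreal ((1 + \<bar>ln (norm (x - y))\<bar>) * norm (V y)) \<partial>lebesgue))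
       + ennreal C * (\<integral>\<^sup>+x. ennreal (norm (V x)) \<partial>lebesgue) *
         ennreal (sqrt (cmod ((k - of_real m) / (k + of_real m)))
                  + sqrt (cmod ((k + of_real m) / (k - of_real m))) + 1)
       \<ge> 1)"
proof (rule exI[of _ 200], intro conjI allI impI)
  fix m :: real and V :: "real^2 \<Rightarrow> complex^2^2" and k \<mu> :: complex
  assume hyps: "admissible_potential V" "k \<notin> spectrum H2 (D_free m)" "eigenvalue H2 (D_pert m V) k" "\<mu>\<^sup>2 = k\<^sup>2 - (of_real m)\<^sup>2"
  define S where "S = sqrt (cmod ((k - of_real m) / (k + of_real m))) + sqrt (cmod ((k + of_real m) / (k - of_real m))) + 1"
  have S: "S \<ge> 1" by (simp add: S_def)
  let ?I = "\<integral>\<^sup>+x. ennreal (norm (V x)) \<partial>lebesgue"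
  have "1 \<le> ennreal 200 * ?I * ennreal S"
  proof (cases "?I < \<infinity>")
    case True
    have "integrable lebesgue V"
      using True hyps(1) by (intro integrableI_bounded) (auto simp: admissible_potential_def)
    then have I: "?I = ennreal (LINT x|lebesgue. norm (V x))" by (intro nn_integral_eq_integral) auto
    have "ennreal 200 * ?I * ennreal S = ennreal (200 * (LINT x|lebesgue. norm (V x)) * S)"
      unfolding I using S by (simp add: ennreal_mult)
    also have "\<dots> \<ge> ennreal 1"
      unfolding S_def by (intro ennreal_leI eigenfunction_estimate[OF hyps True])
    finally show ?thesis by simp
  next
    case False
    \<comment> \<open>The last summand is infinite, since its other factors are positive.\<close>
    then have "?I = \<infinity>" by (simp add: not_less top_unique)
    then show ?thesis using S by (simp add: ennreal_mult_top ennreal_top_mult)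
  qed
  then show "1 \<le> ennreal 200 *
         (ennreal \<bar>ln (cmod \<mu>)\<bar> *
            (SUP x. \<integral>\<^sup>+y. indicator (ball x (inverse (2 * cmod \<mu>))) y * ennreal (norm (V y)) \<partial>lebesgue)
          + (SUP x. \<integral>\<^sup>+y. ennreal ((1 + \<bar>ln (norm (x - y))\<bar>) * norm (V y)) \<partial>lebesgue))
       + ennreal 200 * ?I *
         ennreal (sqrt (cmod ((k - of_real m) / (k + of_real m)))
                  + sqrt (cmod ((k + of_real m) / (k - of_real m))) + 1)"
    unfolding S_def by (rule add_increasing[rotated]) simp
qed simp

end
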